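(* Let $1<p_1,\dots,p_m<\infty$ and $\frac1m<p<\infty$ be such that $\frac1p=\sum_{j=1}^m\frac1{p_j}$. Let $(\nu,\vec w\,)=(\nu,w_1,\dots,w_m)$ be such that $\nu$ and all the $w_j$ are weights on $\mathbf R^n$ and $\nu^p$ satisfies condition $(A)$. For each $j$ let $\Psi_j$ be a Young function whose complementary function satisfies $\bar\Psi_j\in B_{p_j}^*$. If there is a positive constant $K$ such that for all rectangles $R\in\mathcal R$, $$\left(\frac1{|R|}\int_R\nu(x)^p\,dx\right)^{1/p}\prod_{j=1}^m\|w_j^{-1}\|_{\Psi_j,R}\le K,$$ then $\mathcal M_{\mathcal R}$ is bounded from $L^{p_1}(w_1^{p_1})\times\cdots\times L^{p_m}(w_m^{p_m})$ to $L^p(\nu^p)$.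
   Context: $\mathcal R$ is the family of all (bounded, open) rectangles in $\mathbf R^n$ with sides parallel to the coordinate axes. A weight is a non-negative measurable function $w$ on $\mathbf R^n$ with $w(R)=\int_R w\,dx<\infty$ for every $R\in\mathcal R$; we write $w(E)=\int_E w\,dx$. $L^q(w)$ denotes $L^q(\mathbf R^n,w\,dx)$. Define $$\mathcal M_{\mathcal R}(\vec f\,)(x)=\sup_{R\in\mathcal R,\,R\ni x}\ \prod_{j=1}^m\frac1{|R|}\int_R|f_j(y)|\,dy,\qquad M_{\mathcal R}f(x)=\sup_{R\in\mathcal R,\,R\ni x}\frac1{|R|}\int_R|f(y)|\,dy ,$$ where $\vec f=(f_1,\dots,f_m)$. An $m$-(sub)linear operator $T$ is bounded from $X_1\times\cdots\times X_m$ to $Y$ if $\|T(\vec f\,)\|_Y\le C\prod_{j=1}^m\|f_j\|_{X_j}$ for a constant $C$ independent of $\vec f$. A Young function is a continuous, convex, strictly increasing function $\Phi:[0,\infty)\to[0,\infty)$ with $\Phi(0)=0$ and $\Phi(t)\to\infty$ as $t\to\infty$. Its complementary function is $\bar\Phi(s)=\sup_{t>0}\{st-\Phi(t)\}$, $s\ge0$. For a set $E$ of finite positive measure, the normalized Luxemburg norm is $$\|f\|_{\Phi,E}=\inf\Big\{\lambda>0:\frac1{|E|}\int_E\Phi\Big(\frac{|f(x)|}{\lambda}\Big)dx\le1\Big\}.$$ Class $B_q^*$: for $1<q<\infty$, a function $\Psi$ (a Young function, or the complementary function of one) satisfies $\Psi\in B_q^*$ if there is a constant $c>0$ such that $$\int_c^\infty\frac{\Phi_n(\Psi(t))}{t^q}\,\frac{dt}{t}<\infty,\qquad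 \Phi_n(t):=t[\log(e+t)]^{n-1}.$$ Condition $(A)$: a weight $w$ satisfies $(A)$ if there are constants $0<\lambda<1$ and $0<c(\lambda)<\infty$ such that $$w\big(\{x\in\mathbf R^n: M_{\mathcal R}(\chi_E)(x)>\lambda\}\big)\le c(\lambda)\,w(E)$$ for all measurable sets $E$. *)

theory Defs
  imports "HOL-Analysis.Analysis"
begin

(* Extended non-negative reals are used wherever a quantity may be infinite;
   their conventions are inverse 0 = top and 0 * top = 0. *)

section \<open>Extended-valued preliminaries\<close>

text \<open>Extension of an increasing unbounded function on $[0,\infty)$ by $\infty \mapsto \infty$.\<close>

definition ext_top :: "(real \<Rightarrow> real) \<Rightarrow> ennreal \<Rightarrow> ennreal" where
  "ext_top \<phi> x = (if x = top then top else ennreal (\<phi> (enn2real x)))"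

text \<open>Power with positive real exponent; only meant for \<open>a > 0\<close>.\<close>

definition epowr :: "ennreal \<Rightarrow> real \<Rightarrow> ennreal" where
  "epowr x a = ext_top (\<lambda>t. t powr a) x"

section \<open>Rectangles, weights and maximal operators\<close>

definition rectangles :: "(real ^ 'n) set set" where
  "rectangles = {box a b | a b. \<forall>i. a $ i < b $ i}"

definition avg :: "(real ^ 'n) set \<Rightarrow> (real ^ 'n \<Rightarrow> ennreal) \<Rightarrow> ennreal" where
  "avg E g = (\<integral>\<^sup>+x\<in>E. g x \<partial>lebesgue) / emeasure lebesgue E"

definition wmeasure :: "(real ^ 'n \<Rightarrow> real) \<Rightarrow> (real ^ 'n) measure" where
  "wmeasure w = density lebesgue (\<lambda>x. ennreal (w x))"

definition weight :: "(real ^ 'n \<Rightarrow> real) \<Rightarrow> bool" where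
  "weight w \<longleftrightarrow> w \<in> borel_measurable lebesgue \<and> (\<forall>x. 0 \<le> w x) \<and>
     (\<forall>R\<in>rectangles. emeasure (wmeasure w) R < top)"

definition strong_maximal :: "(real ^ 'n \<Rightarrow> real) \<Rightarrow> real ^ 'n \<Rightarrow> ennreal" where
  "strong_maximal f x = (SUP R\<in>{R\<in>rectangles. x \<in> R}. avg R (\<lambda>y. ennreal \<bar>f y\<bar>))"

definition multi_strong_maximal ::
  "nat \<Rightarrow> (nat \<Rightarrow> real ^ 'n \<Rightarrow> real) \<Rightarrow> real ^ 'n \<Rightarrow> ennreal" where
  "multi_strong_maximal m f x =
     (SUP R\<in>{R\<in>rectangles. x \<in> R}. \<Prod>j=1..m. avg R (\<lambda>y. ennreal \<bar>f j y\<bar>))"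

definition condition_A :: "(real ^ 'n \<Rightarrow> real) \<Rightarrow> bool" where
  "condition_A w \<longleftrightarrow> weight w \<and>
     (\<exists>\<theta> c :: real. 0 < \<theta> \<and> \<theta> < 1 \<and> 0 < c \<and>
        (\<forall>E\<in>sets lebesgue.
           emeasure (wmeasure w) {x. strong_maximal (indicator E) x > ennreal \<theta>}
             \<le> ennreal c * emeasure (wmeasure w) E))"

section \<open>Young functions\<close>

text \<open>Only the values on $[0,\infty)$ matter; those on negative arguments are unconstrained.\<close>

definition young_function :: "(real \<Rightarrow> real) \<Rightarrow> bool" where
  "young_function \<Phi> \<longleftrightarrow> continuous_on {0..} \<Phi> \<and> convex_on {0..} \<Phi> \<and>
     strict_mono_on {0..} \<Phi> \<and> \<Phi> 0 = 0 \<and> filterlim \<Phi> at_top at_top"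

text \<open>The complementary function may take the value $\infty$ (e.g. for $\Phi(t) = t$ and $s > 1$).
  The supremum is non-negative, as one sees by letting $t \to 0$, so that the conversion to
  \<open>ennreal\<close> does not change it.\<close>

definition complementary :: "(real \<Rightarrow> real) \<Rightarrow> real \<Rightarrow> ennreal" where
  "complementary \<Phi> s = e2ennreal (SUP t\<in>{0<..}. ereal (s * t - \<Phi> t))"

text \<open>The function \<open>f\<close> is extended-valued, so that the norm applies to $w^{-1}$ for a
  weight \<open>w\<close> with zeros. The infimum over the empty set is \<open>top\<close>.\<close>

definition luxemburg_norm ::
  "(real \<Rightarrow> real) \<Rightarrow> (real ^ 'n) set \<Rightarrow> (real ^ 'n \<Rightarrow> ennreal) \<Rightarrow> ennreal" where
  "luxemburg_norm \<Phi> E f =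
     (INF r\<in>{r::real. 0 < r \<and> avg E (\<lambda>x. ext_top \<Phi> (f x / ennreal r)) \<le> 1}. ennreal r)"

definition Phi :: "nat \<Rightarrow> real \<Rightarrow> real" where
  "Phi n t = t * ln (exp 1 + t) ^ (n - 1)"

text \<open>The argument \<open>\<Psi>\<close> is extended-valued so as to cover complementary functions; only its
  values on $(0,\infty)$ matter.\<close>

definition B_star :: "nat \<Rightarrow> real \<Rightarrow> (real \<Rightarrow> ennreal) \<Rightarrow> bool" where
  "B_star n q \<Psi> \<longleftrightarrow>
     (\<exists>c>0. (\<integral>\<^sup>+t\<in>{c<..}. ext_top (Phi n) (\<Psi> t) / ennreal (t powr q) / ennreal t \<partial>lborel) < top)"

section \<open>Boundedness between Lebesgue spaces\<close>

definition eLp_norm :: "real \<Rightarrow> 'a measure \<Rightarrow> ('a \<Rightarrow> ennreal) \<Rightarrow> ennreal" where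
  "eLp_norm p M g = epowr (\<integral>\<^sup>+x. epowr (g x) p \<partial>M) (1 / p)"

definition Lp_space :: "real \<Rightarrow> 'a measure \<Rightarrow> ('a \<Rightarrow> real) set" where
  "Lp_space p M = {f \<in> borel_measurable M. eLp_norm p M (\<lambda>x. ennreal \<bar>f x\<bar>) < top}"

text \<open>The measurability of \<open>T f\<close> is part of \<open>T f\<close> belonging to the target space.\<close>

definition bounded_Lp ::
  "nat \<Rightarrow> ((nat \<Rightarrow> 'a \<Rightarrow> real) \<Rightarrow> 'a \<Rightarrow> ennreal) \<Rightarrow>
   (nat \<Rightarrow> real) \<Rightarrow> (nat \<Rightarrow> 'a measure) \<Rightarrow> real \<Rightarrow> 'a measure \<Rightarrow> bool" where
  "bounded_Lp m T p M q N \<longleftrightarrow>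
     (\<exists>C::real. 0 \<le> C \<and>
       (\<forall>f. (\<forall>j\<in>{1..m}. f j \<in> Lp_space (p j) (M j)) \<longrightarrow>
          T f \<in> borel_measurable N \<and>
          eLp_norm q N (T f)
            \<le> ennreal C * (\<Prod>j=1..m. eLp_norm (p j) (M j) (\<lambda>x. ennreal \<bar>f j x\<bar>))))"

end

theory Submission
  imports Defs
begin

text \<open>
  Write $v(R)$ for the product of the averages of the $|f_j|$ over $R$. The proof combines three ideas.

  \<^emph>\<open>Scattered families.\<close> The maximal function is a supremum of countably many functions $v(R) \chi_R$, so
  finite families of rectangles suffice. Run through a finite family in the order of decreasing
  $v$ and keep a rectangle if the rectangles kept before cover at most the proportion $\theta$ of it. A rejected
  rectangle lies in the set where the strong maximal function of the union of the kept ones exceeds $\theta$. So by condition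
  $(A)$ the kept rectangles carry, up to a constant, the $\nu^p$-measure of all superlevel sets, and
  the integral of the $p$-th power of the maximal function is at most a constant times the sum of $v(R)^p \nu^p(R)$ over the
  kept rectangles (\<open>condition_A_scattered_selection\<close>, \<open>nn_integral_epowr_sorted_max\<close>). Each of these
  also has a part $E_R$ with $|R| \le |E_R| / (1 - \theta)$, and the $E_R$ are disjoint.

  \<^emph>\<open>The bump condition.\<close> Hoelder's inequality bounds the average of $|f_j|$ over $R$ by
  $2 \|w_j^{-1}\|_{\Psi_j,R} \|f_j w_j\|_{\bar\Psi_j,R}$, and the hypothesis on $(\nu,\vec w)$ turns $v(R)^p \nu^p(R)$ into a multiple
  of $|R| \prod_j \|f_j w_j\|_{\bar\Psi_j,R}^p$ (\<open>avg_le_Holder\<close>, \<open>bump_testing\<close>). Here $|R|$ may be replaced by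
  $|E_R|$. As the $E_R$ are disjoint, Hoelder's inequality with the exponents $p_j/p$ leaves the unweighted
  $L^{p_j}$ norms of the Orlicz maximal functions of the $f_j w_j$ (\<open>sparse_domination_finite\<close>).

  \<^emph>\<open>The Orlicz maximal operator.\<close> It remains to bound $g \mapsto \sup_{R \ni x} \|g\|_{\Phi,R}$ on $L^q$ for
  $\Phi = \bar\Psi_j \in B_q^*$, where $q = p_j$. The set where it exceeds $1/s$ is the set where the strong maximal function
  of $\Phi(s g)$ exceeds 1. Its measure is estimated by the $L (\log L)^{n-1}$ inequality of Jessen, Marcinkiewicz and Zygmund
  (\<open>strong_maximal_LlogL\<close>): an average over a rectangle is an iterated average over its sides, so the strong
  maximal operator is dominated by the composition of $n$ one-dimensional ones, and every composition after the first costs one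
  logarithm, because a truncated function has only logarithmically many relevant dyadic levels. Integrating over $s$
  against $q s^{-q-1} ds$ and rescaling $s$ by $g(x)$ produces exactly the integral in the definition of $B_q^*$ times
  $\int g^q$ (\<open>orlicz_maximal_bound\<close>).
\<close>


section \<open>Powers of extended non-negative reals and the layer cake formula\<close>

lemma epowr_top[simp]: "epowr top a = top"
  by (simp add: epowr_def ext_top_def)

lemma epowr_ennreal[simp]: "0 \<le> r \<Longrightarrow> epowr (ennreal r) a = ennreal (r powr a)"
  by (simp add: epowr_def ext_top_def)

lemma epowr_0[simp]: "epowr 0 a = 0"
  using epowr_ennreal[of 0 a] by simp

lemma epowr_1[simp]: "epowr x 1 = x"
  by (cases x) auto

lemma epowr_one[simp]: "epowr 1 a = 1"
  using epowr_ennreal[of 1 a] by simp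

lemma epowr_mono: "0 < a \<Longrightarrow> x \<le> y \<Longrightarrow> epowr x a \<le> epowr y a"
  by (cases x rule: ennreal_cases; cases y rule: ennreal_cases)
    (auto intro!: ennreal_leI powr_mono2 simp: top_unique ennreal_le_iff)

lemma epowr_eq_0_iff[simp]: "epowr x a = 0 \<longleftrightarrow> x = 0"
  by (cases x) auto

lemma epowr_mult: "epowr (x * y) a = epowr x a * epowr y a"
proof -
  have top: "epowr (top * y) a = top * epowr y a" for y
    by (cases "y = 0") (simp_all add: ennreal_top_mult)
  show ?thesis
  proof (cases "x = top \<or> y = top")
    case True
    then show ?thesis
      using top[of y] top[of x] by (elim disjE) (simp_all only: epowr_top mult.commute)
  next
    case False
    then obtain r s where "0 \<le> r" "x = ennreal r" "0 \<le> s" "y = ennreal s"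
      by (metis ennreal_cases)
    then show ?thesis by (simp add: ennreal_mult[symmetric] powr_mult)
  qed
qed

lemma epowr_prod: "epowr (\<Prod>j\<in>A. x j) a = (\<Prod>j\<in>A. epowr (x j) a)"
  by (induction A rule: infinite_finite_induct) (auto simp: epowr_mult)

lemma epowr_epowr: "epowr (epowr x a) b = epowr x (a * b)"
  by (cases x) (auto simp: powr_powr)

lemma epowr_less_top: "x < top \<Longrightarrow> epowr x a < top"
  by (cases x) auto

lemma borel_measurable_epowr[measurable]: "(\<lambda>x. epowr x a) \<in> borel_measurable borel"
  unfolding epowr_def ext_top_def by measurable

lemma epowr_SUP:
  assumes "0 < a"
  shows "epowr (SUP i\<in>I. f i) a = (SUP i\<in>I. epowr (f i) a)"
proof (rule antisym)
  have inv: "epowr (epowr x a) (1 / a) = x" "epowr (epowr x (1 / a)) a = x" for x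
    using assms by (auto simp: epowr_epowr)
  have "(SUP i\<in>I. f i) \<le> epowr (SUP i\<in>I. epowr (f i) a) (1 / a)"
  proof (rule SUP_least)
    fix i assume "i \<in> I"
    then have "epowr (epowr (f i) a) (1 / a) \<le> epowr (SUP i\<in>I. epowr (f i) a) (1 / a)"
      using assms by (intro epowr_mono SUP_upper) auto
    then show "f i \<le> epowr (SUP i\<in>I. epowr (f i) a) (1 / a)" by (simp only: inv)
  qed
  then have "epowr (SUP i\<in>I. f i) a \<le> epowr (epowr (SUP i\<in>I. epowr (f i) a) (1 / a)) a"
    using assms by (intro epowr_mono) auto
  then show "epowr (SUP i\<in>I. f i) a \<le> (SUP i\<in>I. epowr (f i) a)" by (simp only: inv)
  show "(SUP i\<in>I. epowr (f i) a) \<le> epowr (SUP i\<in>I. f i) a"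
    using assms by (intro SUP_least epowr_mono SUP_upper)
qed

lemma powr_tail_integral:
  fixes q r :: real
  assumes "0 < q" "0 < r"
  shows "(\<integral>\<^sup>+s. ennreal (q * s powr (- q - 1)) * indicator {1 / r<..} s \<partial>lborel) = ennreal (r powr q)"
proof -
  have "(\<integral>\<^sup>+s. ennreal (q * s powr (- q - 1)) * indicator {1 / r<..} s \<partial>lborel)
      = (\<integral>\<^sup>+s. ennreal (q * s powr (- q - 1)) * indicator {1 / r..} s \<partial>lborel)"
    by (intro nn_integral_cong_AE AE_I[of _ _ "{1 / r}"]) (auto simp: indicator_def)
  also have "\<dots> = ennreal (0 - (- ((1 / r) powr (- q))))"
  proof (rule nn_integral_FTC_atLeast)
    fix s assume s: "1 / r \<le> s"
    then have s0: "0 < s" using assms(2) by (meson divide_pos_pos less_le_trans zero_less_one)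
    show "((\<lambda>s. - (s powr (- q))) has_real_derivative q * s powr (- q - 1)) (at s)"
      using s0 by (auto intro!: derivative_eq_intros simp: powr_diff)
    show "0 \<le> q * s powr (- q - 1)" using assms by simp
  next
    have "((\<lambda>s. - (s powr (- q))) \<longlongrightarrow> - 0) at_top"
      using assms by (intro tendsto_minus tendsto_neg_powr filterlim_ident) auto
    then show "((\<lambda>s. - (s powr (- q))) \<longlongrightarrow> 0) at_top" by simp
  qed measurable
  also have "0 - (- ((1 / r) powr (- q))) = r powr q"
    using assms by (simp add: powr_minus_divide powr_divide)
  finally show ?thesis .
qed

text \<open>The tail integral of $q s^{-q-1}$ over $s > 1/x$ equals $x^q$. Parametrizing the level sets of a
  function by the dilation \<open>s\<close> that lifts them to height 1, and not by their height, lets a level set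
  of \<open>g\<close> at height \<open>1/s\<close> appear as the level set of \<open>s * g\<close> at height 1, where every weak-type
  estimate below is stated.\<close>

lemma epowr_layer_cake:
  assumes q: "0 < q"
  shows "(\<integral>\<^sup>+s. indicator {0<..} s * ennreal (q * s powr (- q - 1)) * indicator {1<..} (ennreal s * x) \<partial>lborel) = epowr x q"
proof -
  have *: "(\<integral>\<^sup>+s. indicator {0<..} s * ennreal (q * s powr (- q - 1)) * indicator {1<..} (ennreal s * ennreal r) \<partial>lborel) = ennreal (r powr q)"
    if r: "0 < r" for r
  proof -
    have "(1 < ennreal s * ennreal r) = (1 / r < s)" if "0 < s" for s
    proof -
      have "(1 < ennreal s * ennreal r) = (ennreal 1 < ennreal (s * r))" using that r by (simp add: ennreal_mult)
      also have "\<dots> = (1 / r < s)" using that r by (subst ennreal_less_iff) (auto simp: field_simps)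
      finally show ?thesis .
    qed
    moreover have "0 < s" if "1 / r < s" for s using that r by (meson divide_pos_pos less_trans zero_less_one)
    ultimately have "indicator {0<..} s * ennreal (q * s powr (- q - 1)) * indicator {1<..} (ennreal s * ennreal r)
        = ennreal (q * s powr (- q - 1)) * indicator {1 / r<..} s" for s
      by (cases "0 < s") (auto simp: indicator_def)
    then show ?thesis using powr_tail_integral[OF q r] by simp
  qed
  show ?thesis
  proof (cases x)
    case (real r)
    then show ?thesis using *[of r] by (cases "r = 0") auto
  next
    case top
    define I where "I = (\<integral>\<^sup>+s. indicator {0<..} s * ennreal (q * s powr (- q - 1)) * indicator {1<..} (ennreal s * x) \<partial>lborel)"
    have le: "ennreal (r powr q) \<le> I" if "0 < r" for r
      unfolding *[OF that, symmetric] I_def top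
      by (intro nn_integral_mono mult_left_mono) (auto simp: indicator_def ennreal_mult_top)
    have "I = top"
    proof (rule ccontr)
      assume "I \<noteq> top"
      then obtain r where r: "0 \<le> r" "I = ennreal r" by (cases I) auto
      have "ennreal (r + 1) \<le> I" using le[of "(r + 1) powr (1 / q)"] r(1) q by (simp add: powr_powr)
      then show False using r by (simp add: ennreal_le_iff)
    qed
    then show ?thesis using top by (simp add: I_def)
  qed
qed

lemma (in sigma_finite_measure) nn_integral_epowr_layer_cake:
  assumes q: "0 < q" and g[measurable]: "g \<in> borel_measurable M"
  shows "(\<integral>\<^sup>+x. epowr (g x) q \<partial>M) =
    (\<integral>\<^sup>+s. indicator {0<..} s * ennreal (q * s powr (- q - 1)) * emeasure M {x\<in>space M. 1 < ennreal s * g x} \<partial>lborel)"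
proof -
  interpret pair_sigma_finite M lborel by standard
  have "(\<integral>\<^sup>+x. epowr (g x) q \<partial>M)
      = (\<integral>\<^sup>+x. \<integral>\<^sup>+s. indicator {0<..} s * ennreal (q * s powr (- q - 1)) * indicator {1<..} (ennreal s * g x) \<partial>lborel \<partial>M)"
    by (simp only: epowr_layer_cake[OF q])
  also have "\<dots> = (\<integral>\<^sup>+s. \<integral>\<^sup>+x. indicator {0<..} s * ennreal (q * s powr (- q - 1)) * indicator {1<..} (ennreal s * g x) \<partial>M \<partial>lborel)"
    by (rule Fubini'[symmetric]) measurable
  also have "\<dots> = (\<integral>\<^sup>+s. indicator {0<..} s * ennreal (q * s powr (- q - 1)) * emeasure M {x\<in>space M. 1 < ennreal s * g x} \<partial>lborel)"
  proof (intro nn_integral_cong)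
    fix s :: real
    have "(\<integral>\<^sup>+x. indicator {0<..} s * ennreal (q * s powr (- q - 1)) * indicator {1<..} (ennreal s * g x) \<partial>M)
        = indicator {0<..} s * ennreal (q * s powr (- q - 1)) * (\<integral>\<^sup>+x. indicator {1<..} (ennreal s * g x) \<partial>M)"
      by (rule nn_integral_cmult) measurable
    also have "(\<integral>\<^sup>+x. indicator {1<..} (ennreal s * g x) \<partial>M) = (\<integral>\<^sup>+x. indicator {x\<in>space M. 1 < ennreal s * g x} x \<partial>M)"
      by (intro nn_integral_cong) (auto simp: indicator_def)
    also have "\<dots> = emeasure M {x\<in>space M. 1 < ennreal s * g x}"
      by (rule nn_integral_indicator) measurable
    finally show "(\<integral>\<^sup>+x. indicator {0<..} s * ennreal (q * s powr (- q - 1)) * indicator {1<..} (ennreal s * g x) \<partial>M)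
      = indicator {0<..} s * ennreal (q * s powr (- q - 1)) * emeasure M {x\<in>space M. 1 < ennreal s * g x}" .
  qed
  finally show ?thesis .
qed

section \<open>One-dimensional maximal operators along the coordinate directions\<close>

text \<open>The greedy argument: take a longest interval, discard those that meet it (they lie in its
  concentric triple), and repeat with the rest.\<close>

lemma finite_interval_Vitali:
  fixes J :: "(real \<times> real) set"
  assumes "finite J" "\<And>a b. (a, b) \<in> J \<Longrightarrow> a < b"
  shows "\<exists>D\<subseteq>J. disjoint_family_on (\<lambda>(a, b). {a<..<b}) D \<and>
           (\<Union>(a, b)\<in>J. {a<..<b}) \<subseteq> (\<Union>(a, b)\<in>D. {2 * a - b<..<2 * b - a})"
  using assms
proof (induction "card J" arbitrary: J rule: less_induct)
  case less
  show ?case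
  proof (cases "J = {}")
    case True
    then show ?thesis by (auto simp: disjoint_family_on_def)
  next
    case False
    define I where "I = (\<lambda>(a::real, b). {a<..<b})"
    have "Max ((\<lambda>(a, b). b - a) ` J) \<in> (\<lambda>(a, b). b - a) ` J"
      using less.prems(1) False by (intro Max_in) auto
    then obtain c d where cd: "(c, d) \<in> J" "d - c = Max ((\<lambda>(a, b). b - a) ` J)"
      by auto
    have len: "b - a \<le> d - c" if "(a, b) \<in> J" for a b
      unfolding cd(2) using that less.prems(1) by (intro Max_ge) force+
    define J' where "J' = {k \<in> J. I k \<inter> {c<..<d} = {}}"
    have cdlt: "c < d" using less.prems(2) cd(1) by blast
    have sub: "J' \<subseteq> J" and notin: "(c, d) \<notin> J'"
      using cdlt by (auto simp: J'_def I_def)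
    have fin: "finite J'" using sub less.prems(1) finite_subset by blast
    have "card J' < card J"
      using sub notin cd(1) less.prems(1) by (metis psubsetI psubset_card_mono)
    moreover have "a < b" if "(a, b) \<in> J'" for a b
      using that sub less.prems(2) by blast
    ultimately obtain D where D: "D \<subseteq> J'" "disjoint_family_on I D"
      "(\<Union>(a, b)\<in>J'. {a<..<b}) \<subseteq> (\<Union>(a, b)\<in>D. {2 * a - b<..<2 * b - a})"
      using less.hyps[OF _ fin] unfolding I_def by auto
    have dis: "disjoint_family_on I (insert (c, d) D)"
    proof -
      have "I k \<inter> I (c, d) = {}" if "k \<in> D" for k
        using that D(1) by (auto simp: J'_def I_def)
      then show ?thesis using D(2) unfolding disjoint_family_on_def by blast
    qed
    have "x \<in> (\<Union>(a, b)\<in>insert (c, d) D. {2 * a - b<..<2 * b - a})"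
      if x: "x \<in> {a<..<b}" "(a, b) \<in> J" for x a b
    proof (cases "(a, b) \<in> J'")
      case True
      then have "x \<in> (\<Union>(a, b)\<in>J'. {a<..<b})" using x(1) by blast
      then show ?thesis using D(3) by blast
    next
      case False
      then have "{a<..<b} \<inter> {c<..<d} \<noteq> {}"
        using x(2) unfolding J'_def I_def by simp
      then obtain y where "y \<in> {a<..<b}" "y \<in> {c<..<d}" by blast
      then have "x \<in> {2 * c - d<..<2 * d - c}" using x(1) len[OF x(2)] by auto
      then show ?thesis by blast
    qed
    then have "(\<Union>(a, b)\<in>J. {a<..<b}) \<subseteq> (\<Union>(a, b)\<in>insert (c, d) D. {2 * a - b<..<2 * b - a})"
      by blast
    moreover have "insert (c, d) D \<subseteq> J" using D(1) sub cd(1) by auto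
    ultimately show ?thesis using dis unfolding I_def by blast
  qed
qed

text \<open>The part of \<open>h\<close> with values at most 1/2 contributes at most half of an average that exceeds 1.\<close>

lemma interval_average_truncate:
  fixes h :: "real \<Rightarrow> ennreal"
  assumes ab: "a < b" and h[measurable]: "h \<in> borel_measurable borel"
    and gt: "(\<integral>\<^sup>+t\<in>{a<..<b}. h t \<partial>lborel) > ennreal (b - a)"
  shows "ennreal (b - a) \<le> 2 * (\<integral>\<^sup>+t\<in>{a<..<b}. h t * indicator {1/2<..} (h t) \<partial>lborel)"
    (is "_ \<le> 2 * ?I")
proof -
  have "(\<integral>\<^sup>+t\<in>{a<..<b}. h t \<partial>lborel)
      \<le> (\<integral>\<^sup>+t. ennreal (1/2) * indicator {a<..<b} t + h t * indicator {1/2<..} (h t) * indicator {a<..<b} t \<partial>lborel)"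
  proof (intro nn_integral_mono)
    fix t :: real
    have half: "ennreal (1/2) = 1/2" by (simp add: divide_ennreal_def)
    show "h t * indicator {a<..<b} t \<le> ennreal (1/2) * indicator {a<..<b} t + h t * indicator {1/2<..} (h t) * indicator {a<..<b} t"
      unfolding half by (auto simp: indicator_def not_less)
  qed
  also have "\<dots> = ennreal (1/2) * ennreal (b - a) + ?I"
    using ab by (subst nn_integral_add) (auto simp: nn_integral_cmult_indicator)
  finally have *: "ennreal (b - a) < ennreal (1/2) * ennreal (b - a) + ?I"
    using gt by order
  show ?thesis
  proof (cases ?I)
    case (real r)
    then have "ennreal (b - a) < ennreal (1/2 * (b - a) + r)"
      using * ab real by (subst ennreal_plus) (auto simp: ennreal_mult[symmetric] simp del: ennreal_half)
    then have "b - a < 1/2 * (b - a) + r"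
      using real ab by (subst (asm) ennreal_less_iff) auto
    then have "ennreal (b - a) \<le> ennreal (2 * r)" by (intro ennreal_leI) argo
    then show ?thesis using real by (simp add: ennreal_mult)
  qed (simp add: ennreal_mult_top)
qed

text \<open>The usual covering argument. Only the large values of \<open>h\<close> enter on the right; the small ones
  could not be controlled when the estimate is iterated. The constant 6 is the factor 3 of the covering times the factor 2 of the truncation.\<close>

lemma interval_maximal_weak_type:
  fixes h :: "real \<Rightarrow> ennreal"
  assumes J: "finite J" "\<And>a b. (a, b) \<in> J \<Longrightarrow> a < b"
    and h[measurable]: "h \<in> borel_measurable borel"
    and large: "\<And>a b. (a, b) \<in> J \<Longrightarrow> (\<integral>\<^sup>+t\<in>{a<..<b}. h t \<partial>lborel) > ennreal (b - a)"
  shows "emeasure lborel (\<Union>(a, b)\<in>J. {a<..<b}) \<le> 6 * (\<integral>\<^sup>+t. h t * indicator {1/2<..} (h t) \<partial>lborel)"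
proof -
  define g where "g t = h t * indicator {1/2<..} (h t)" for t
  have g[measurable]: "g \<in> borel_measurable borel" unfolding g_def by measurable
  define I where "I = (\<lambda>(a::real, b). {a<..<b})"
  define I3 where "I3 = (\<lambda>(a::real, b). {2 * a - b<..<2 * b - a})"
  obtain D where D: "D \<subseteq> J" "disjoint_family_on I D" "(\<Union>k\<in>J. I k) \<subseteq> (\<Union>k\<in>D. I3 k)"
    using finite_interval_Vitali[OF J] unfolding I_def I3_def by blast
  have fin: "finite D" using D(1) J(1) finite_subset by blast
  have [measurable]: "I k \<in> sets borel" "I3 k \<in> sets borel" for k
    by (auto simp: I_def I3_def split: prod.split)
  have "emeasure lborel (\<Union>k\<in>J. I k) \<le> emeasure lborel (\<Union>k\<in>D. I3 k)"
    using D(3) fin by (intro emeasure_mono) auto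
  also have "\<dots> \<le> (\<Sum>k\<in>D. emeasure lborel (I3 k))"
    using fin by (intro emeasure_subadditive_finite) auto
  also have "\<dots> \<le> (\<Sum>k\<in>D. 6 * (\<integral>\<^sup>+t\<in>I k. g t \<partial>lborel))"
  proof (intro sum_mono)
    fix k assume k: "k \<in> D"
    obtain a b where ab: "k = (a, b)" by (cases k)
    have lt: "a < b" using k ab D(1) J(2) by blast
    have "emeasure lborel (I3 k) = ennreal (3 * (b - a))"
      using lt by (simp add: I3_def ab algebra_simps)
    also have "\<dots> = 3 * ennreal (b - a)" using lt by (subst ennreal_mult) simp_all
    also have "\<dots> \<le> 3 * (2 * (\<integral>\<^sup>+t\<in>{a<..<b}. h t * indicator {1/2<..} (h t) \<partial>lborel))"
      using k ab D(1) lt by (intro mult_left_mono interval_average_truncate large) auto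
    also have "\<dots> = 6 * (\<integral>\<^sup>+t\<in>I k. g t \<partial>lborel)"
      by (simp add: I_def ab g_def mult.assoc[symmetric])
    finally show "emeasure lborel (I3 k) \<le> 6 * (\<integral>\<^sup>+t\<in>I k. g t \<partial>lborel)" .
  qed
  also have "\<dots> = 6 * (\<integral>\<^sup>+t. (\<Sum>k\<in>D. g t * indicator (I k) t) \<partial>lborel)"
    by (subst nn_integral_sum) (auto simp: sum_distrib_left)
  also have "\<dots> \<le> 6 * (\<integral>\<^sup>+t. g t \<partial>lborel)"
  proof (intro mult_left_mono nn_integral_mono)
    fix t
    have "(\<Sum>k\<in>D. g t * indicator (I k) t) = g t * indicator (\<Union>k\<in>D. I k) t"
      by (simp add: sum_distrib_left indicator_UN_disjoint[OF fin D(2)])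
    also have "\<dots> \<le> g t" by (simp add: indicator_def)
    finally show "(\<Sum>k\<in>D. g t * indicator (I k) t) \<le> g t" .
  qed auto
  finally show ?thesis unfolding I_def g_def by (simp add: case_prod_beta)
qed

text \<open>Tonelli's theorem with one coordinate split off: \<open>f\<close> collects the coordinates other than \<open>b\<close>.\<close>

lemma nn_integral_lborel_coordinate:
  fixes F :: "'a::euclidean_space \<Rightarrow> ennreal"
  assumes b: "b \<in> Basis" and F[measurable]: "F \<in> borel_measurable borel"
  shows "(\<integral>\<^sup>+x. F x \<partial>lborel) =
    (\<integral>\<^sup>+f. (\<integral>\<^sup>+y. F ((\<Sum>c\<in>Basis - {b}. f c *\<^sub>R c) + y *\<^sub>R b) \<partial>lborel) \<partial>(Pi\<^sub>M (Basis - {b}) (\<lambda>_. lborel)))"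
proof -
  interpret product_sigma_finite "\<lambda>_::'a. lborel :: real measure"
    by standard
  have Bas: "insert b (Basis - {b}) = Basis" using b by auto
  have "(\<integral>\<^sup>+x. F x \<partial>lborel)
      = (\<integral>\<^sup>+f. F (\<Sum>c\<in>Basis. f c *\<^sub>R c) \<partial>(Pi\<^sub>M (insert b (Basis - {b})) (\<lambda>_. lborel)))"
    unfolding Bas by (subst lborel_eq) (rule nn_integral_distr, measurable)
  also have "\<dots> = (\<integral>\<^sup>+f. (\<integral>\<^sup>+y. F (\<Sum>c\<in>Basis. (f(b := y)) c *\<^sub>R c) \<partial>lborel) \<partial>(Pi\<^sub>M (Basis - {b}) (\<lambda>_. lborel)))"
    by (rule product_nn_integral_insert) (auto simp: Bas)
  also have "\<dots> = (\<integral>\<^sup>+f. (\<integral>\<^sup>+y. F ((\<Sum>c\<in>Basis - {b}. f c *\<^sub>R c) + y *\<^sub>R b) \<partial>lborel) \<partial>(Pi\<^sub>M (Basis - {b}) (\<lambda>_. lborel)))"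
  proof (intro nn_integral_cong)
    fix f :: "'a \<Rightarrow> real" and y :: real
    have "(\<Sum>c\<in>Basis. (f(b := y)) c *\<^sub>R c) = y *\<^sub>R b + (\<Sum>c\<in>Basis - {b}. (f(b := y)) c *\<^sub>R c)"
      by (subst sum.remove[OF _ b]) auto
    also have "(\<Sum>c\<in>Basis - {b}. (f(b := y)) c *\<^sub>R c) = (\<Sum>c\<in>Basis - {b}. f c *\<^sub>R c)"
      by (intro sum.cong) auto
    finally show "F (\<Sum>c\<in>Basis. (f(b := y)) c *\<^sub>R c) = F ((\<Sum>c\<in>Basis - {b}. f c *\<^sub>R c) + y *\<^sub>R b)"
      by (simp add: add.commute)
  qed
  finally show ?thesis .
qed

text \<open>The value at \<open>x\<close> is the average over the segment that one sweeps when the \<open>b\<close>-coordinate of \<open>x\<close>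
  runs through the fixed interval \<open>I\<close>; it does not depend on the \<open>b\<close>-coordinate of \<open>x\<close>.\<close>

definition dir_avg :: "'a::euclidean_space \<Rightarrow> real \<times> real \<Rightarrow> ('a \<Rightarrow> ennreal) \<Rightarrow> 'a \<Rightarrow> ennreal" where
  "dir_avg b I h x =
     (\<integral>\<^sup>+t\<in>{fst I<..<snd I}. h (x + (t - x \<bullet> b) *\<^sub>R b) \<partial>lborel) / ennreal (snd I - fst I)"

text \<open>The intervals come from a family \<open>J\<close> that will be finite: this makes measurability immediate, and
  the constants below do not depend on \<open>J\<close>.\<close>

definition dir_max :: "'a::euclidean_space \<Rightarrow> (real \<times> real) set \<Rightarrow> ('a \<Rightarrow> ennreal) \<Rightarrow> 'a \<Rightarrow> ennreal" where
  "dir_max b J h x = (SUP I\<in>J. indicator {fst I<..<snd I} (x \<bullet> b) * dir_avg b I h x)"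

lemma borel_measurable_dir_avg[measurable]:
  assumes [measurable]: "h \<in> borel_measurable borel"
  shows "dir_avg b I h \<in> borel_measurable borel"
  unfolding dir_avg_def by measurable

lemma borel_measurable_dir_max[measurable]:
  assumes "finite J" and [measurable]: "h \<in> borel_measurable borel"
  shows "dir_max b J h \<in> borel_measurable borel"
  unfolding dir_max_def using assms(1)
  by (intro borel_measurable_SUP) (auto simp: countable_finite)

lemma dir_avg_cmult:
  assumes [measurable]: "h \<in> borel_measurable borel"
  shows "dir_avg b I (\<lambda>x. c * h x) x = c * dir_avg b I h x"
  unfolding dir_avg_def mult.assoc
  by (subst nn_integral_cmult) (auto simp: ennreal_times_divide)

lemma dir_max_cmult:
  assumes [measurable]: "h \<in> borel_measurable borel"
  shows "dir_max b J (\<lambda>x. c * h x) = (\<lambda>x. c * dir_max b J h x)"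
  unfolding dir_max_def dir_avg_cmult[OF assms]
  by (simp add: SUP_mult_left_ennreal mult.left_commute)

text \<open>On each line parallel to \<open>b\<close> this is the one-dimensional estimate; integrate over the lines.\<close>

lemma dir_max_weak_type:
  fixes h :: "'a::euclidean_space \<Rightarrow> ennreal"
  assumes b: "b \<in> Basis" and J: "finite J" "\<And>I. I \<in> J \<Longrightarrow> fst I < snd I"
    and h[measurable]: "h \<in> borel_measurable borel"
  shows "emeasure lborel {x. dir_max b J h x > 1} \<le> 6 * (\<integral>\<^sup>+x. h x * indicator {1/2<..} (h x) \<partial>lborel)"
proof -
  have [measurable]: "dir_max b J h \<in> borel_measurable borel" using J(1) h by (rule borel_measurable_dir_max)
  define e where "e f = (\<Sum>c\<in>Basis - {b}. f c *\<^sub>R c)" for f :: "'a \<Rightarrow> real"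
  have e: "e f \<bullet> b = 0" for f
    unfolding e_def inner_sum_left using b by (intro sum.neutral) (auto simp: inner_Basis)
  have bb: "b \<bullet> b = 1" using b by simp
  have sect: "(\<integral>\<^sup>+y. indicator {x. dir_max b J h x > 1} (e f + y *\<^sub>R b) \<partial>lborel)
      \<le> 6 * (\<integral>\<^sup>+y. h (e f + y *\<^sub>R b) * indicator {1/2<..} (h (e f + y *\<^sub>R b)) \<partial>lborel)" for f
  proof -
    define H where "H t = h (e f + t *\<^sub>R b)" for t
    have [measurable]: "H \<in> borel_measurable borel" unfolding H_def by measurable
    define J' where "J' = {I\<in>J. (\<integral>\<^sup>+t\<in>{fst I<..<snd I}. H t \<partial>lborel) > ennreal (snd I - fst I)}"
    have avg: "dir_avg b I h (e f + y *\<^sub>R b) = (\<integral>\<^sup>+t\<in>{fst I<..<snd I}. H t \<partial>lborel) / ennreal (snd I - fst I)" for I y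
      unfolding dir_avg_def H_def by (simp add: e inner_left_distrib bb algebra_simps)
    have "{y. dir_max b J h (e f + y *\<^sub>R b) > 1} \<subseteq> (\<Union>(a, c)\<in>J'. {a<..<c})"
    proof safe
      fix y assume "1 < dir_max b J h (e f + y *\<^sub>R b)"
      then obtain I where I: "I \<in> J" "1 < indicator {fst I<..<snd I} ((e f + y *\<^sub>R b) \<bullet> b) * dir_avg b I h (e f + y *\<^sub>R b)"
        unfolding dir_max_def less_SUP_iff by auto
      have y: "(e f + y *\<^sub>R b) \<bullet> b = y" by (simp add: e inner_left_distrib bb)
      have yI: "y \<in> {fst I<..<snd I}" and gt: "1 < dir_avg b I h (e f + y *\<^sub>R b)"
        using I(2) unfolding y by (auto split: split_indicator_asm)
      have "I \<in> J'"
      proof (rule ccontr)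
        assume "I \<notin> J'"
        then have "dir_avg b I h (e f + y *\<^sub>R b) \<le> ennreal (snd I - fst I) / ennreal (snd I - fst I)"
          unfolding avg using I(1) by (intro divide_right_mono_ennreal) (simp add: J'_def)
        also have "\<dots> = 1" using J(2)[OF I(1)] by simp
        finally show False using gt by simp
      qed
      with yI show "y \<in> (\<Union>(a, c)\<in>J'. {a<..<c})" by (auto intro!: bexI[of _ I])
    qed
    then have "emeasure lborel {y. dir_max b J h (e f + y *\<^sub>R b) > 1} \<le> emeasure lborel (\<Union>(a, c)\<in>J'. {a<..<c})"
      by (intro emeasure_mono) (auto intro!: borel_open open_UN)
    also have "\<dots> \<le> 6 * (\<integral>\<^sup>+t. H t * indicator {1/2<..} (H t) \<partial>lborel)"
      using J by (intro interval_maximal_weak_type) (force simp: J'_def)+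
    also have "emeasure lborel {y. dir_max b J h (e f + y *\<^sub>R b) > 1}
        = (\<integral>\<^sup>+y. indicator {y. dir_max b J h (e f + y *\<^sub>R b) > 1} y \<partial>lborel)"
      by (subst nn_integral_indicator) auto
    finally show ?thesis unfolding H_def by (simp add: indicator_def)
  qed
  have "emeasure lborel {x. dir_max b J h x > 1} = (\<integral>\<^sup>+x. indicator {x. dir_max b J h x > 1} x \<partial>lborel)"
    by (subst nn_integral_indicator) auto
  also have "\<dots> = (\<integral>\<^sup>+f. (\<integral>\<^sup>+y. indicator {x. dir_max b J h x > 1} (e f + y *\<^sub>R b) \<partial>lborel) \<partial>(Pi\<^sub>M (Basis - {b}) (\<lambda>_. lborel)))"
    unfolding e_def using b by (intro nn_integral_lborel_coordinate) auto
  also have "\<dots> \<le> (\<integral>\<^sup>+f. 6 * (\<integral>\<^sup>+y. h (e f + y *\<^sub>R b) * indicator {1/2<..} (h (e f + y *\<^sub>R b)) \<partial>lborel) \<partial>(Pi\<^sub>M (Basis - {b}) (\<lambda>_. lborel)))"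
    by (intro nn_integral_mono sect)
  also have "\<dots> = 6 * (\<integral>\<^sup>+f. (\<integral>\<^sup>+y. h (e f + y *\<^sub>R b) * indicator {1/2<..} (h (e f + y *\<^sub>R b)) \<partial>lborel) \<partial>(Pi\<^sub>M (Basis - {b}) (\<lambda>_. lborel)))"
    unfolding e_def by (intro nn_integral_cmult) measurable
  also have "\<dots> = 6 * (\<integral>\<^sup>+x. h x * indicator {1/2<..} (h x) \<partial>lborel)"
    unfolding e_def using b by (subst nn_integral_lborel_coordinate[of b]) auto
  finally show ?thesis .
qed

section \<open>The Jessen-Marcinkiewicz-Zygmund inequality for the strong maximal operator\<close>

text \<open>The integrand on the right-hand side of the weak-type inequality for \<open>k\<close> iterated directional maximal
  operators. The cutoff $2^{-k}$ is the threshold 1/2 compounded \<open>k\<close> times.\<close>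

definition truncated_Phi :: "nat \<Rightarrow> ennreal \<Rightarrow> ennreal" where
  "truncated_Phi k u = ext_top (Phi k) u * indicator {ennreal ((1/2) ^ k)<..} u"

lemma borel_measurable_ext_top_Phi[measurable]: "ext_top (Phi k) \<in> borel_measurable borel"
  unfolding ext_top_def Phi_def by measurable

lemma borel_measurable_truncated_Phi[measurable]: "truncated_Phi k \<in> borel_measurable borel"
  unfolding truncated_Phi_def by measurable

lemma term_le_suminf_ennreal: "f j \<le> suminf f" for f :: "nat \<Rightarrow> ennreal"
  using sum_le_suminf[of f "{j}"] by simp

text \<open>A dyadic substitute for the layer cake formula: if $2^{j-1} < v \le 2^j$, the term number \<open>j\<close>
  is already at least \<open>v\<close>.\<close>

lemma truncated_le_dyadic_sum:
  fixes v :: ennreal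
  shows "v * indicator {1/2<..} v \<le> (\<Sum>j. ennreal (2 ^ j) * indicator {1<..} (ennreal (2 / 2 ^ j) * v))"
proof (cases v)
  case (real r)
  have half: "1/2 = ennreal (1/2)" by (simp add: divide_ennreal_def)
  show ?thesis
  proof (cases "r > 1/2")
    case True
    obtain i where "r < 2 ^ i" using real_arch_pow[of 2 r] by auto
    then have ex: "\<exists>i. r \<le> 2 ^ i" by (auto intro!: exI[of _ i])
    define j where "j = (LEAST i. r \<le> 2 ^ i)"
    have j: "r \<le> 2 ^ j" unfolding j_def by (rule LeastI_ex[OF ex])
    have "2 ^ j < 2 * r"
    proof (cases j)
      case 0
      then show ?thesis using True by simp
    next
      case (Suc i)
      then have "\<not> r \<le> 2 ^ i" unfolding j_def using not_less_Least by (metis lessI)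
      then show ?thesis using Suc by simp
    qed
    then have "1 < ennreal (2 / 2 ^ j * r)"
      by (subst ennreal_1[symmetric], subst ennreal_less_iff) (auto simp: field_simps)
    then have "1 < ennreal (2 / 2 ^ j) * v" using real by (simp add: ennreal_mult[symmetric])
    then have "v \<le> ennreal (2 ^ j) * indicator {1<..} (ennreal (2 / 2 ^ j) * v)"
      using real j by (simp add: ennreal_leI)
    also have "\<dots> \<le> (\<Sum>j. ennreal (2 ^ j) * indicator {1<..} (ennreal (2 / 2 ^ j) * v))"
      by (rule term_le_suminf_ennreal)
    finally show ?thesis by (auto simp: indicator_def)
  next
    case False
    then have "v \<le> 1/2" unfolding half real(2) by (intro ennreal_leI) simp
    then show ?thesis by (simp add: indicator_def not_less[symmetric])
  qed
next
  case top
  have "(\<Sum>j. ennreal (2 ^ j)) = top"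
  proof (rule ccontr)
    define s where "s = (\<Sum>j. ennreal (2 ^ j))"
    have le: "ennreal (2 ^ j) \<le> s" for j
      unfolding s_def by (rule term_le_suminf_ennreal)
    assume "(\<Sum>j. ennreal (2 ^ j)) \<noteq> top"
    then have "s \<noteq> top" by (simp only: s_def not_False_eq_True)
    then obtain r where r: "0 \<le> r" "s = ennreal r" by (cases s) auto
    obtain i where i: "r < 2 ^ i" using real_arch_pow[of 2 r] by auto
    have "2 ^ i \<le> r" using le[of i] r(1) unfolding r(2) by (subst (asm) ennreal_le_iff)
    then show False using i by simp
  qed
  then show ?thesis using top by (simp add: ennreal_mult_top)
qed

text \<open>Each summand is at most about $u (\log (e + u))^{k-1}$, because the dilation factor cancels against
  $2^j$, and the cutoff leaves only $O(\log (e + u))$ nonzero summands. This is where one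
  application of a directional operator costs exactly one logarithm.\<close>

lemma truncated_Phi_dyadic_sum:
  assumes k: "1 \<le> k"
  shows "(\<Sum>j. ennreal (2 ^ j) * truncated_Phi k (ennreal (2 / 2 ^ j) * u))
           \<le> ennreal (2 ^ k * (real k + 4)) * truncated_Phi (Suc k) u"
proof (cases u)
  case top
  then show ?thesis by (simp add: truncated_Phi_def ext_top_def ennreal_mult_top)
next
  case (real r)
  have nz: "2 ^ j < 2 ^ Suc k * r" if "truncated_Phi k (ennreal (2 / 2 ^ j) * u) \<noteq> 0" for j
  proof -
    have "ennreal ((1/2) ^ k) < ennreal (2 / 2 ^ j * r)"
      using that real by (simp add: truncated_Phi_def ennreal_mult[symmetric] split: split_indicator_asm)
    then have "(1/2) ^ k < 2 / 2 ^ j * r" by (subst (asm) ennreal_less_iff) auto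
    then show ?thesis by (simp add: field_simps power_divide)
  qed
  show ?thesis
  proof (cases "r > (1/2) ^ Suc k")
    case False
    have "truncated_Phi k (ennreal (2 / 2 ^ j) * u) = 0" for j
    proof (rule ccontr)
      assume "\<not> ?thesis"
      then have "2 ^ j < 2 ^ Suc k * r" by (rule nz)
      moreover have "2 ^ Suc k * r \<le> 1" using False by (simp add: field_simps power_divide)
      moreover have "(1::real) \<le> 2 ^ j" by simp
      ultimately show False by linarith
    qed
    then show ?thesis by simp
  next
    case True
    have rpos: "0 < r" using True by (meson less_trans zero_less_divide_1_iff zero_less_numeral zero_less_power)
    define L where "L = ln (exp 1 + r)"
    have L1: "1 \<le> L" unfolding L_def using rpos by (subst ln_ge_iff) (auto simp: add_pos_pos)
    have lnr: "ln r \<le> L" unfolding L_def using rpos by (intro ln_mono) (auto simp: add_pos_pos)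
    \<comment> \<open>a bound for the number of nonzero summands: the cutoff gives $j < k + 1 + \log_2 r$ and $\log_2 r \le 2 L$\<close>
    define N where "N = nat \<lceil>(real k + 3) * L\<rceil>"
    have N: "real N \<le> (real k + 4) * L"
    proof -
      have "real N \<le> (real k + 3) * L + 1" unfolding N_def using L1 by (simp add: of_nat_nat)
      then show ?thesis using L1 by (simp add: algebra_simps)
    qed
    have zero: "ennreal (2 ^ j) * truncated_Phi k (ennreal (2 / 2 ^ j) * u) = 0" if "j \<notin> {..<N}" for j
    proof (rule ccontr)
      assume "\<not> ?thesis"
      then have "2 ^ j < 2 ^ Suc k * r" using nz by force
      then have "ln (2 ^ j) < ln (2 ^ Suc k * r)" using rpos by (subst ln_less_cancel_iff) auto
      then have "real j * ln 2 < real (Suc k) * ln 2 + ln r"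
        using rpos by (simp add: ln_mult ln_realpow distrib_right)
      then have "real j < real (Suc k) + ln r / ln 2" by (simp add: field_simps)
      also have "ln r / ln 2 \<le> 2 * L"
      proof -
        have "ln r \<le> L" "1/2 \<le> ln (2::real)" using lnr ln2_ge_two_thirds by auto
        moreover have "2 * L * (1/2) \<le> 2 * L * ln 2"
          using L1 ln2_ge_two_thirds by (intro mult_left_mono) auto
        ultimately have "ln r \<le> 2 * L * ln 2" by simp
        then show ?thesis by (simp add: divide_le_eq)
      qed
      also have "real (Suc k) + 2 * L \<le> (real k + 3) * L"
      proof -
        have "real (Suc k) \<le> real (Suc k) * L" using L1 by (simp add: mult_le_cancel_left1)
        then show ?thesis by (simp add: algebra_simps)
      qed
      also have "\<dots> \<le> real N" unfolding N_def by linarith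
      finally show False using that by simp
    qed
    have term_le: "ennreal (2 ^ j) * truncated_Phi k (ennreal (2 / 2 ^ j) * u) \<le> ennreal (2 * r * (2 * L) ^ (k - 1))" for j
    proof -
      have le: "2 / 2 ^ j * r \<le> 2 * r" using rpos by (simp add: field_simps)
      have "ln (exp 1 + 2 / 2 ^ j * r) \<le> ln ((exp 1 + r)\<^sup>2)"
      proof (intro ln_mono)
        have "exp 1 + 2 * r \<le> (exp 1 + r)\<^sup>2"
        proof -
          have e: "2 \<le> exp (1::real)" using exp_ge_add_one_self[of 1] by simp
          have "exp 1 \<le> exp (1::real) * exp 1" using e by (simp add: mult_le_cancel_left1)
          moreover have "2 * r \<le> 2 * exp 1 * r" using e rpos by simp
          moreover have "(exp 1 + r)\<^sup>2 = exp 1 * exp 1 + 2 * exp 1 * r + r * r"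
            by (simp add: power2_eq_square algebra_simps)
          moreover have "0 \<le> r * r" by simp
          ultimately show ?thesis by linarith
        qed
        then show "exp 1 + 2 / 2 ^ j * r \<le> (exp 1 + r)\<^sup>2" using le by simp
      qed (use rpos in \<open>auto simp: add_pos_pos\<close>)
      also have "\<dots> = 2 * L" unfolding L_def using rpos by (simp add: ln_realpow add_pos_pos)
      finally have lnle: "ln (exp 1 + 2 / 2 ^ j * r) \<le> 2 * L" .
      have ln0: "0 \<le> ln (exp 1 + 2 / 2 ^ j * r)"
      proof -
        have "1 \<le> exp (1::real)" by simp
        moreover have "0 \<le> 2 / 2 ^ j * r" using rpos by simp
        ultimately show ?thesis by (intro ln_ge_zero) linarith
      qed
      have "ennreal (2 ^ j) * truncated_Phi k (ennreal (2 / 2 ^ j) * u) \<le> ennreal (2 ^ j) * ext_top (Phi k) (ennreal (2 / 2 ^ j) * u)"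
        by (intro mult_left_mono) (auto simp: truncated_Phi_def indicator_def)
      also have "\<dots> = ennreal (2 ^ j) * ennreal (Phi k (2 / 2 ^ j * r))"
        using real rpos by (simp add: ext_top_def ennreal_mult[symmetric])
      also have "\<dots> = ennreal (2 ^ j * Phi k (2 / 2 ^ j * r))"
        using rpos ln0 by (subst ennreal_mult) (auto simp: Phi_def)
      also have "2 ^ j * Phi k (2 / 2 ^ j * r) = 2 * r * ln (exp 1 + 2 / 2 ^ j * r) ^ (k - 1)"
        by (simp add: Phi_def)
      also have "ennreal \<dots> \<le> ennreal (2 * r * (2 * L) ^ (k - 1))"
        using lnle ln0 rpos by (intro ennreal_leI mult_left_mono power_mono) auto
      finally show ?thesis .
    qed
    have "(\<Sum>j. ennreal (2 ^ j) * truncated_Phi k (ennreal (2 / 2 ^ j) * u))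
        = (\<Sum>j<N. ennreal (2 ^ j) * truncated_Phi k (ennreal (2 / 2 ^ j) * u))"
      by (intro suminf_finite zero) auto
    also have "\<dots> \<le> of_nat (card {..<N}) * ennreal (2 * r * (2 * L) ^ (k - 1))"
      by (intro sum_bounded_above term_le)
    also have "\<dots> = ennreal (real N * (2 * r * (2 * L) ^ (k - 1)))"
      using rpos L1 by (subst ennreal_mult) (auto simp: ennreal_of_nat_eq_real_of_nat)
    also have "\<dots> \<le> ennreal ((real k + 4) * L * (2 * r * (2 * L) ^ (k - 1)))"
      using N rpos L1 by (intro ennreal_leI mult_right_mono) auto
    also have "(real k + 4) * L * (2 * r * (2 * L) ^ (k - 1)) = 2 ^ k * (real k + 4) * (r * L ^ k)"
      using k by (cases k) (simp_all add: power_mult_distrib algebra_simps)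
    also have "ennreal \<dots> = ennreal (2 ^ k * (real k + 4)) * ennreal (r * L ^ k)"
      using rpos L1 by (subst ennreal_mult) auto
    also have "ennreal (r * L ^ k) = truncated_Phi (Suc k) u"
      using real True rpos by (simp add: truncated_Phi_def ext_top_def Phi_def L_def ennreal_less_iff)
    finally show ?thesis .
  qed
qed

text \<open>What the iteration uses about a directional maximal operator. Homogeneity turns the
  estimate at height 1 into estimates at all heights.\<close>

definition weak_type_op :: "(('a::euclidean_space \<Rightarrow> ennreal) \<Rightarrow> 'a \<Rightarrow> ennreal) \<Rightarrow> bool" where
  "weak_type_op T \<longleftrightarrow> (\<forall>h\<in>borel_measurable borel. T h \<in> borel_measurable borel \<and>
     (\<forall>c. T (\<lambda>x. c * h x) = (\<lambda>x. c * T h x)) \<and>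
     emeasure lborel {x. T h x > 1} \<le> 6 * (\<integral>\<^sup>+x. h x * indicator {1/2<..} (h x) \<partial>lborel))"

lemma weak_type_op_foldr:
  assumes "\<And>T. T \<in> set Ts \<Longrightarrow> weak_type_op T" and h: "h \<in> borel_measurable borel"
  shows "foldr (\<lambda>T. T) Ts h \<in> borel_measurable borel"
    and "foldr (\<lambda>T. T) Ts (\<lambda>x. c * h x) = (\<lambda>x. c * foldr (\<lambda>T. T) Ts h x)"
  using assms(1) by (induction Ts) (auto simp: weak_type_op_def h)

text \<open>Apply the weak-type estimate of the outermost operator \<open>T\<close> to the function \<open>g\<close> produced by the
  others, cut the truncated \<open>g\<close> into dyadic levels, and use the induction hypothesis on each level.
  The constant depends on the number of operators only, hence the order of the quantifiers.\<close>

lemma weak_type_iterate: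
  "\<exists>C>0. \<forall>Ts. length Ts = Suc k \<and> (\<forall>T\<in>set Ts. weak_type_op T) \<longrightarrow>
     (\<forall>h\<in>borel_measurable borel. emeasure lborel {x::'a::euclidean_space. foldr (\<lambda>T. T) Ts h x > 1}
         \<le> ennreal C * (\<integral>\<^sup>+x. truncated_Phi (Suc k) (h x) \<partial>lborel))"
proof (induction k)
  case 0
  have id: "ext_top (Phi (Suc 0)) u = u" for u by (cases u) (auto simp: ext_top_def Phi_def)
  have half: "1/2 = ennreal (1/2)" by (simp add: divide_ennreal_def)
  show ?case
    by (rule exI[of _ 6]) (auto simp: length_Suc_conv weak_type_op_def truncated_Phi_def id half)
next
  case (Suc k)
  then obtain C where C: "C > 0" "\<And>Ts (h :: 'a \<Rightarrow> ennreal). length Ts = Suc k \<Longrightarrow> (\<And>T. T\<in>set Ts \<Longrightarrow> weak_type_op T) \<Longrightarrow>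
     h\<in>borel_measurable borel \<Longrightarrow> emeasure lborel {x. foldr (\<lambda>T. T) Ts h x > 1}
         \<le> ennreal C * (\<integral>\<^sup>+x. truncated_Phi (Suc k) (h x) \<partial>lborel)" by metis
  define D where "D = 2 ^ Suc k * (real (Suc k) + 4)"
  have "emeasure lborel {x. foldr (\<lambda>T. T) Ts h x > 1}
         \<le> ennreal (6 * C * D) * (\<integral>\<^sup>+x. truncated_Phi (Suc (Suc k)) (h x) \<partial>lborel)"
    if Ts: "length Ts = Suc (Suc k)" "\<And>T. T\<in>set Ts \<Longrightarrow> weak_type_op T" and h[measurable]: "h\<in>borel_measurable borel"
    for Ts and h :: "'a \<Rightarrow> ennreal"
  proof -
    obtain T Us where TU: "Ts = T # Us" "length Us = Suc k" using Ts(1) by (auto simp: length_Suc_conv)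
    have U: "\<And>T. T\<in>set Us \<Longrightarrow> weak_type_op T" and T: "weak_type_op T" using Ts(2) TU by auto
    define g where "g = foldr (\<lambda>T. T) Us h"
    have g[measurable]: "g \<in> borel_measurable borel" unfolding g_def by (rule weak_type_op_foldr[OF U h])
    have scale: "foldr (\<lambda>T. T) Us (\<lambda>x. c * h x) = (\<lambda>x. c * g x)" for c
      unfolding g_def by (rule weak_type_op_foldr(2)) (use U h in auto)
    have lev: "emeasure lborel {x. ennreal c * g x > 1} \<le> ennreal C * (\<integral>\<^sup>+x. truncated_Phi (Suc k) (ennreal c * h x) \<partial>lborel)" for c
      using C(2)[of Us "\<lambda>x. ennreal c * h x"] TU(2) U unfolding scale by simp
    have "emeasure lborel {x. foldr (\<lambda>T. T) Ts h x > 1} \<le> 6 * (\<integral>\<^sup>+x. g x * indicator {1/2<..} (g x) \<partial>lborel)"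
      using T g unfolding TU g_def weak_type_op_def by simp
    also have "\<dots> \<le> 6 * (\<integral>\<^sup>+x. (\<Sum>j. ennreal (2 ^ j) * indicator {1<..} (ennreal (2 / 2 ^ j) * g x)) \<partial>lborel)"
      by (intro mult_left_mono nn_integral_mono truncated_le_dyadic_sum) auto
    also have "\<dots> = 6 * (\<Sum>j. ennreal (2 ^ j) * (\<integral>\<^sup>+x. indicator {1<..} (ennreal (2 / 2 ^ j) * g x) \<partial>lborel))"
      by (subst nn_integral_suminf) (auto simp: nn_integral_cmult)
    also have "\<dots> = 6 * (\<Sum>j. ennreal (2 ^ j) * emeasure lborel {x. ennreal (2 / 2 ^ j) * g x > 1})"
    proof -
      have "(\<integral>\<^sup>+x. indicator {1<..} (ennreal (2 / 2 ^ j) * g x) \<partial>lborel)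
          = (\<integral>\<^sup>+x. indicator {x. ennreal (2 / 2 ^ j) * g x > 1} x \<partial>lborel)" for j
        by (intro nn_integral_cong) (auto simp: indicator_def)
      then show ?thesis by (subst (asm) nn_integral_indicator) auto
    qed
    also have "\<dots> \<le> 6 * (\<Sum>j. ennreal (2 ^ j) * (ennreal C * (\<integral>\<^sup>+x. truncated_Phi (Suc k) (ennreal (2 / 2 ^ j) * h x) \<partial>lborel)))"
      by (intro mult_left_mono suminf_le lev) auto
    also have "\<dots> = 6 * (ennreal C * (\<integral>\<^sup>+x. (\<Sum>j. ennreal (2 ^ j) * truncated_Phi (Suc k) (ennreal (2 / 2 ^ j) * h x)) \<partial>lborel))"
      by (subst nn_integral_suminf) (auto simp: nn_integral_cmult mult.left_commute)
    also have "\<dots> \<le> 6 * (ennreal C * (\<integral>\<^sup>+x. ennreal D * truncated_Phi (Suc (Suc k)) (h x) \<partial>lborel))"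
      unfolding D_def by (intro mult_left_mono nn_integral_mono truncated_Phi_dyadic_sum) auto
    also have "\<dots> = ennreal (6 * C * D) * (\<integral>\<^sup>+x. truncated_Phi (Suc (Suc k)) (h x) \<partial>lborel)"
    proof -
      have "0 \<le> D" by (simp add: D_def)
      then have "ennreal (6 * C * D) = 6 * (ennreal C * ennreal D)"
        using C(1) by (simp add: ennreal_mult mult.assoc)
      then show ?thesis by (simp add: nn_integral_cmult mult.assoc)
    qed
    finally show ?thesis .
  qed
  moreover have "6 * C * D > 0" using C(1) by (simp add: D_def)
  ultimately show ?case by blast
qed

lemma weak_type_op_dir_max:
  assumes "b \<in> Basis" "finite J" "\<And>I. I \<in> J \<Longrightarrow> fst I < snd I"
  shows "weak_type_op (dir_max b J)"
  unfolding weak_type_op_def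
  using assms by (auto intro!: dir_max_weak_type borel_measurable_dir_max dir_max_cmult)

text \<open>Averaging successively over the sides of the box \<open>box a c\<close> in the directions \<open>bs\<close>. Once \<open>bs\<close>
  exhausts the basis, the result is the constant function whose value is the average of \<open>h\<close> over the box.\<close>

definition iter_avg :: "'a::euclidean_space \<Rightarrow> 'a \<Rightarrow> 'a list \<Rightarrow> ('a \<Rightarrow> ennreal) \<Rightarrow> 'a \<Rightarrow> ennreal" where
  "iter_avg a c bs h = foldr (\<lambda>b. dir_avg b (a \<bullet> b, c \<bullet> b)) bs h"

lemma iter_avg_simps[simp]:
  "iter_avg a c [] h = h"
  "iter_avg a c (b # bs) h = dir_avg b (a \<bullet> b, c \<bullet> b) (iter_avg a c bs h)"
  by (auto simp: iter_avg_def)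

lemma borel_measurable_iter_avg[measurable]:
  "h \<in> borel_measurable borel \<Longrightarrow> iter_avg a c bs h \<in> borel_measurable borel"
  by (induction bs) auto

text \<open>Averaging in a direction removes the dependence on that coordinate, and averaging in an
  orthogonal direction does not bring it back.\<close>

lemma iter_avg_shift:
  assumes "set bs \<subseteq> Basis" "d \<in> set bs"
  shows "iter_avg a c bs h (x + s *\<^sub>R d) = iter_avg a c bs h x"
  using assms
proof (induction bs arbitrary: x)
  case (Cons b bs)
  have b: "b \<in> Basis" and d: "d \<in> Basis" using Cons.prems by auto
  show ?case
  proof (cases "d = b")
    case True
    have "x + s *\<^sub>R b + (t - (x + s *\<^sub>R b) \<bullet> b) *\<^sub>R b = x + (t - x \<bullet> b) *\<^sub>R b" for t
      using b by (simp add: inner_left_distrib algebra_simps)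
    then show ?thesis unfolding True iter_avg_simps dir_avg_def by (simp only:)
  next
    case False
    then have "d \<in> set bs" using Cons.prems by auto
    then have IH: "iter_avg a c bs h (y + s *\<^sub>R d) = iter_avg a c bs h y" for y
      using Cons by auto
    have "d \<bullet> b = 0" using False b d by (simp add: inner_Basis)
    then have "x + s *\<^sub>R d + (t - (x + s *\<^sub>R d) \<bullet> b) *\<^sub>R b = (x + (t - x \<bullet> b) *\<^sub>R b) + s *\<^sub>R d" for t
      by (simp add: inner_left_distrib algebra_simps)
    then show ?thesis unfolding iter_avg_simps dir_avg_def by (simp only: IH)
  qed
qed simp

text \<open>A function that is invariant under translations in all basis directions is constant.\<close>

lemma iter_avg_const:
  fixes x y :: "'a::euclidean_space"
  assumes "set bs = Basis"
  shows "iter_avg a c bs h x = iter_avg a c bs h y"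
proof -
  have "iter_avg a c bs h (y + (\<Sum>b\<in>B. ((x - y) \<bullet> b) *\<^sub>R b)) = iter_avg a c bs h y"
    if "finite B" "B \<subseteq> Basis" for B
    using that
  proof (induction B rule: finite_induct)
    case (insert b B)
    have "y + (\<Sum>b\<in>insert b B. ((x - y) \<bullet> b) *\<^sub>R b) = (y + (\<Sum>b\<in>B. ((x - y) \<bullet> b) *\<^sub>R b)) + ((x - y) \<bullet> b) *\<^sub>R b"
      using insert by (simp add: algebra_simps)
    then show ?case using insert assms by (simp only: iter_avg_shift insert_subset order_refl)
  qed simp
  from this[of Basis] show ?thesis by (simp add: euclidean_representation)
qed

text \<open>Replacing a function by its averages over the full side of the box preserves the integral over
  each segment of the box parallel to that side.\<close>

lemma box_integral_dir_avg:
  fixes h :: "'a::euclidean_space \<Rightarrow> ennreal"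
  assumes b: "b \<in> Basis" and ac: "a \<bullet> b < c \<bullet> b" and h[measurable]: "h \<in> borel_measurable borel"
  shows "(\<integral>\<^sup>+x\<in>box a c. dir_avg b (a \<bullet> b, c \<bullet> b) h x \<partial>lborel) = (\<integral>\<^sup>+x\<in>box a c. h x \<partial>lborel)"
proof -
  define e where "e f = (\<Sum>c\<in>Basis - {b}. f c *\<^sub>R c)" for f :: "'a \<Rightarrow> real"
  have eb: "e f \<bullet> b = 0" for f
    unfolding e_def inner_sum_left using b by (intro sum.neutral) (auto simp: inner_Basis)
  have bb: "b \<bullet> b = 1" using b by simp
  define P where "P f \<longleftrightarrow> (\<forall>i\<in>Basis - {b}. a \<bullet> i < e f \<bullet> i \<and> e f \<bullet> i < c \<bullet> i)" for f
  have ind: "indicator (box a c) (e f + y *\<^sub>R b) = (if P f then indicator {a \<bullet> b<..<c \<bullet> b} y else (0::ennreal))" for f y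
  proof -
    have "e f + y *\<^sub>R b \<in> box a c \<longleftrightarrow> P f \<and> y \<in> {a \<bullet> b<..<c \<bullet> b}"
    proof -
      have "(e f + y *\<^sub>R b) \<bullet> i = (if i = b then y else e f \<bullet> i)" if "i \<in> Basis" for i
        using that b by (auto simp: inner_left_distrib eb inner_Basis)
      then show ?thesis unfolding mem_box P_def using b by auto
    qed
    then show ?thesis by (auto simp: indicator_def)
  qed
  have sect: "(\<integral>\<^sup>+y. dir_avg b (a \<bullet> b, c \<bullet> b) h (e f + y *\<^sub>R b) * indicator (box a c) (e f + y *\<^sub>R b) \<partial>lborel)
     = (\<integral>\<^sup>+y. h (e f + y *\<^sub>R b) * indicator (box a c) (e f + y *\<^sub>R b) \<partial>lborel)" for f
  proof (cases "P f")
    case True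
    have avg: "dir_avg b (a \<bullet> b, c \<bullet> b) h (e f + y *\<^sub>R b) = (\<integral>\<^sup>+t\<in>{a \<bullet> b<..<c \<bullet> b}. h (e f + t *\<^sub>R b) \<partial>lborel) / ennreal (c \<bullet> b - a \<bullet> b)" for y
      unfolding dir_avg_def by (simp add: eb inner_left_distrib bb algebra_simps)
    define A where "A = (\<integral>\<^sup>+t\<in>{a \<bullet> b<..<c \<bullet> b}. h (e f + t *\<^sub>R b) \<partial>lborel)"
    have "(\<integral>\<^sup>+y. A / ennreal (c \<bullet> b - a \<bullet> b) * indicator {a \<bullet> b<..<c \<bullet> b} y \<partial>lborel)
        = A / ennreal (c \<bullet> b - a \<bullet> b) * ennreal (c \<bullet> b - a \<bullet> b)"
      using ac by (subst nn_integral_cmult_indicator) auto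
    also have "\<dots> = A" using ac by (simp add: ennreal_divide_times)
    finally show ?thesis unfolding avg ind using True by (simp add: A_def)
  qed (simp add: ind)
  show ?thesis
    by (simp add: nn_integral_lborel_coordinate[OF b] sect[unfolded e_def])
qed

lemma box_integral_iter_avg:
  fixes h :: "'a::euclidean_space \<Rightarrow> ennreal"
  assumes "set bs \<subseteq> Basis" "\<And>b. b \<in> Basis \<Longrightarrow> a \<bullet> b < c \<bullet> b" "h \<in> borel_measurable borel"
  shows "(\<integral>\<^sup>+x\<in>box a c. iter_avg a c bs h x \<partial>lborel) = (\<integral>\<^sup>+x\<in>box a c. h x \<partial>lborel)"
  using assms by (induction bs) (auto simp: box_integral_dir_avg)

text \<open>Points of the box stay in the box when one coordinate moves within the corresponding side, so on
  the box every averaging step is dominated by a maximal operator that knows this side.\<close>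

lemma iter_avg_le_iter_max:
  fixes h :: "'a::euclidean_space \<Rightarrow> ennreal"
  assumes "set bs \<subseteq> Basis" "\<And>b. b \<in> Basis \<Longrightarrow> (a \<bullet> b, c \<bullet> b) \<in> J b" "x \<in> box a c"
  shows "iter_avg a c bs h x \<le> foldr (\<lambda>T. T) (map (\<lambda>b. dir_max b (J b)) bs) h x"
  using assms(1,3)
proof (induction bs arbitrary: x)
  case (Cons b bs)
  define H where "H = foldr (\<lambda>T. T) (map (\<lambda>b. dir_max b (J b)) bs) h"
  have b: "b \<in> Basis" using Cons.prems by auto
  have seg: "x + (t - x \<bullet> b) *\<^sub>R b \<in> box a c" if "t \<in> {a \<bullet> b<..<c \<bullet> b}" for t
  proof -
    have "(x + (t - x \<bullet> b) *\<^sub>R b) \<bullet> i = (if i = b then t else x \<bullet> i)" if "i \<in> Basis" for i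
      using that b by (auto simp: inner_left_distrib inner_Basis)
    then show ?thesis using that Cons.prems(2) unfolding mem_box by auto
  qed
  have "iter_avg a c (b # bs) h x \<le> dir_avg b (a \<bullet> b, c \<bullet> b) H x"
    unfolding iter_avg_simps dir_avg_def
    using Cons.IH Cons.prems(1) seg
    by (intro divide_right_mono_ennreal nn_integral_mono) (auto simp: H_def indicator_def)
  also have "\<dots> = indicator {a \<bullet> b<..<c \<bullet> b} (x \<bullet> b) * dir_avg b (a \<bullet> b, c \<bullet> b) H x"
    using Cons.prems(2) b by (auto simp: mem_box)
  also have "\<dots> \<le> dir_max b (J b) H x"
    unfolding dir_max_def by (rule SUP_upper2[OF assms(2)[OF b]]) simp
  finally show ?case by (simp add: H_def)
qed simp

text \<open>The $L (\log L)^{n-1}$ inequality of Jessen, Marcinkiewicz and Zygmund, for finite families of boxes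
  and with a constant that is independent of the family. An average over a box is an iterated average over its
  sides, hence at most the iterated directional maximal function at every point of the box.\<close>

lemma strong_maximal_LlogL:
  obtains C :: real where "C > 0"
    and "\<And>S (h :: 'a::euclidean_space \<Rightarrow> ennreal). finite S \<Longrightarrow>
      (\<And>a c b. (a, c) \<in> S \<Longrightarrow> b \<in> Basis \<Longrightarrow> a \<bullet> b < c \<bullet> b) \<Longrightarrow> h \<in> borel_measurable borel \<Longrightarrow>
      emeasure lborel (\<Union>(a, c)\<in>{(a, c)\<in>S. (\<integral>\<^sup>+x\<in>box a c. h x \<partial>lborel) > emeasure lborel (box a c)}. box a c)
        \<le> ennreal C * (\<integral>\<^sup>+x. truncated_Phi DIM('a) (h x) \<partial>lborel)"
proof -
  obtain k where k: "DIM('a) = Suc k" using DIM_positive by (metis gr0_conv_Suc)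
  obtain C where C: "C > 0" "\<And>Ts (h :: 'a \<Rightarrow> ennreal). length Ts = Suc k \<Longrightarrow> (\<And>T. T\<in>set Ts \<Longrightarrow> weak_type_op T) \<Longrightarrow>
     h\<in>borel_measurable borel \<Longrightarrow> emeasure lborel {x. foldr (\<lambda>T. T) Ts h x > 1}
         \<le> ennreal C * (\<integral>\<^sup>+x. truncated_Phi (Suc k) (h x) \<partial>lborel)" using weak_type_iterate[of k, where 'a = 'a] by metis
  obtain bs :: "'a list" where bs: "set bs = Basis" "distinct bs" using finite_distinct_list[OF finite_Basis] by blast
  have "emeasure lborel (\<Union>(a, c)\<in>{(a, c)\<in>S. (\<integral>\<^sup>+x\<in>box a c. h x \<partial>lborel) > emeasure lborel (box a c)}. box a c)
          \<le> ennreal C * (\<integral>\<^sup>+x. truncated_Phi (Suc k) (h x) \<partial>lborel)"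
    if S: "finite S" "\<And>a c b. (a, c) \<in> S \<Longrightarrow> b \<in> Basis \<Longrightarrow> a \<bullet> b < c \<bullet> b"
      and h[measurable]: "h \<in> borel_measurable borel" for S and h :: "'a \<Rightarrow> ennreal"
  proof -
    define J where "J b = (\<lambda>(a, c). (a \<bullet> b, c \<bullet> b)) ` S" for b :: 'a
    define Ts where "Ts = map (\<lambda>b. dir_max b (J b)) bs"
    have len: "length Ts = Suc k" unfolding Ts_def using bs k distinct_card[of bs] by simp
    have wt: "weak_type_op T" if "T \<in> set Ts" for T
      using that S bs(1) by (auto simp: Ts_def J_def intro!: weak_type_op_dir_max)
    have "(\<Union>(a, c)\<in>{(a, c)\<in>S. (\<integral>\<^sup>+x\<in>box a c. h x \<partial>lborel) > emeasure lborel (box a c)}. box a c)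
        \<subseteq> {x. foldr (\<lambda>T. T) Ts h x > 1}"
    proof safe
      fix x a c assume x: "x \<in> box a c" and ac: "(a, c) \<in> S"
        and gt: "(\<integral>\<^sup>+x\<in>box a c. h x \<partial>lborel) > emeasure lborel (box a c)"
      have "(\<integral>\<^sup>+x\<in>box a c. h x \<partial>lborel) = (\<integral>\<^sup>+y\<in>box a c. iter_avg a c bs h y \<partial>lborel)"
        using bs S ac by (intro box_integral_iter_avg[symmetric]) auto
      also have "\<dots> = (\<integral>\<^sup>+y\<in>box a c. iter_avg a c bs h x \<partial>lborel)"
        using iter_avg_const[OF bs(1)] by (intro nn_integral_cong) metis
      also have "\<dots> = iter_avg a c bs h x * emeasure lborel (box a c)"
        by (intro nn_integral_cmult_indicator) auto
      finally have "iter_avg a c bs h x > 1"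
        using gt by (metis (no_types, lifting) linorder_not_le mult_1 mult_right_mono zero_le)
      also have "iter_avg a c bs h x \<le> foldr (\<lambda>T. T) Ts h x"
        unfolding Ts_def using bs ac x by (intro iter_avg_le_iter_max) (auto simp: J_def intro: rev_image_eqI)
      finally show "foldr (\<lambda>T. T) Ts h x > 1" .
    qed
    then have "emeasure lborel (\<Union>(a, c)\<in>{(a, c)\<in>S. (\<integral>\<^sup>+x\<in>box a c. h x \<partial>lborel) > emeasure lborel (box a c)}. box a c)
        \<le> emeasure lborel {x. foldr (\<lambda>T. T) Ts h x > 1}"
      using weak_type_op_foldr(1)[OF wt h] by (intro emeasure_mono) auto
    also have "\<dots> \<le> ennreal C * (\<integral>\<^sup>+x. truncated_Phi (Suc k) (h x) \<partial>lborel)"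
      by (rule C(2)[OF len wt h])
    finally show ?thesis .
  qed
  with C(1) show thesis unfolding k[symmetric] by (rule that)
qed

section \<open>Complementary functions and the Orlicz maximal operator\<close>

text \<open>The conversion to extended non-negative reals truncates at 0 and commutes with suprema. In this form
  monotonicity, measurability and the scaling inequality can be checked term by term.\<close>

lemma complementary_eq_SUP_ennreal:
  "complementary \<Psi> s = (SUP t\<in>{0<..}. ennreal (s * t - \<Psi> t))"
proof (rule antisym)
  have "(SUP t\<in>{0<..}. ereal (s * t - \<Psi> t)) \<le> enn2ereal (SUP t\<in>{0<..}. ennreal (s * t - \<Psi> t))"
  proof (rule SUP_least)
    fix t :: real assume "t \<in> {0<..}"
    then have "enn2ereal (ennreal (s * t - \<Psi> t)) \<le> enn2ereal (SUP t\<in>{0<..}. ennreal (s * t - \<Psi> t))"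
      by (intro less_eq_ennreal.rep_eq[THEN iffD1] SUP_upper)
    then show "ereal (s * t - \<Psi> t) \<le> enn2ereal (SUP t\<in>{0<..}. ennreal (s * t - \<Psi> t))"
      by (auto simp: ennreal.rep_eq)
  qed
  then show "complementary \<Psi> s \<le> (SUP t\<in>{0<..}. ennreal (s * t - \<Psi> t))"
    unfolding complementary_def using e2ennreal_mono by fastforce
  show "(SUP t\<in>{0<..}. ennreal (s * t - \<Psi> t)) \<le> complementary \<Psi> s"
  proof (rule SUP_least)
    fix t :: real assume "t \<in> {0<..}"
    then have "e2ennreal (ereal (s * t - \<Psi> t)) \<le> complementary \<Psi> s"
      unfolding complementary_def by (intro e2ennreal_mono SUP_upper)
    then show "ennreal (s * t - \<Psi> t) \<le> complementary \<Psi> s" by (simp add: e2ennreal_ereal)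
  qed
qed

lemma complementary_mono: "s \<le> s' \<Longrightarrow> complementary \<Psi> s \<le> complementary \<Psi> s'"
  unfolding complementary_eq_SUP_ennreal
  by (intro SUP_mono) (auto intro!: ennreal_leI mult_right_mono bexI)

lemma borel_measurable_complementary[measurable]: "complementary \<Psi> \<in> borel_measurable borel"
proof (rule borel_measurableI_greater)
  fix y
  have "{s \<in> space borel. y < complementary \<Psi> s} = (\<Union>t\<in>{0<..}. {s. y < ennreal (s * t - \<Psi> t)})"
    by (auto simp: complementary_eq_SUP_ennreal less_SUP_iff)
  moreover have "open (\<Union>t\<in>{0<..}. {s. y < ennreal (s * t - \<Psi> t)})"
    by (intro open_UN ballI open_Collect_less continuous_on_ennreal continuous_intros)
  ultimately show "{s \<in> space borel. y < complementary \<Psi> s} \<in> sets borel" by simp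
qed

lemma young_function_pos: "young_function \<Psi> \<Longrightarrow> 0 < t \<Longrightarrow> 0 < \<Psi> t"
  unfolding young_function_def by (auto dest: strict_mono_onD[of _ _ 0 t])

lemma young_inequality:
  assumes "young_function \<Psi>" "0 \<le> t"
  shows "ennreal (s * t) \<le> ennreal (\<Psi> t) + complementary \<Psi> s"
proof (cases "t = 0")
  case False
  with assms have t: "0 < t" by simp
  have "ennreal (s * t) \<le> ennreal (\<Psi> t) + ennreal (s * t - \<Psi> t)"
  proof (cases "\<Psi> t \<le> s * t")
    case True
    then show ?thesis using young_function_pos[OF assms(1) t] by (simp add: ennreal_plus[symmetric] del: ennreal_plus)
  next
    case False
    then have "ennreal (s * t) \<le> ennreal (\<Psi> t)" by (intro ennreal_leI) simp
    then show ?thesis by (simp add: add_increasing2)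
  qed
  also have "ennreal (s * t - \<Psi> t) \<le> complementary \<Psi> s"
    unfolding complementary_eq_SUP_ennreal using t by (intro SUP_upper) simp
  finally show ?thesis by (simp add: add_left_mono)
qed simp

text \<open>Convexity of the complementary function along rays from the origin, where it vanishes. It shows that the
  complementary function is small near 0 as soon as it is finite somewhere.\<close>

lemma complementary_scale:
  assumes "young_function \<Psi>" "0 \<le> l" "l \<le> 1"
  shows "complementary \<Psi> (l * s) \<le> ennreal l * complementary \<Psi> s"
  unfolding complementary_eq_SUP_ennreal SUP_mult_left_ennreal
proof (intro SUP_mono)
  fix t :: real assume t: "t \<in> {0<..}"
  have "l * \<Psi> t \<le> 1 * \<Psi> t"
    using t assms young_function_pos[OF assms(1), of t] by (intro mult_right_mono) auto
  then have "l * s * t - \<Psi> t \<le> l * (s * t - \<Psi> t)" by (simp add: algebra_simps)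
  then have "ennreal (l * s * t - \<Psi> t) \<le> ennreal l * ennreal (s * t - \<Psi> t)"
    using assms(2) by (simp add: ennreal_mult'[symmetric] ennreal_leI)
  with t show "\<exists>t'\<in>{0<..}. ennreal (l * s * t - \<Psi> t) \<le> ennreal l * ennreal (s * t' - \<Psi> t')" by blast
qed

lemma complementary_0: "young_function \<Psi> \<Longrightarrow> complementary \<Psi> 0 = 0"
  using complementary_scale[of \<Psi> 0 0] by simp

lemma ext_top_Phi_mono:
  assumes "u \<le> v"
  shows "ext_top (Phi n) u \<le> ext_top (Phi n) v"
proof (cases "v = top")
  case False
  then obtain s where s: "0 \<le> s" "v = ennreal s" by (cases v) auto
  then obtain r where r: "0 \<le> r" "u = ennreal r" using assms by (cases u) (auto simp: top_unique)
  have rs: "r \<le> s" using assms r s by simp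
  have "1 \<le> exp (1::real)" by simp
  then have e: "1 \<le> exp 1 + r" "exp 1 + r \<le> exp 1 + s" using r(1) rs by linarith+
  then have "0 \<le> ln (exp 1 + r)" "ln (exp 1 + r) \<le> ln (exp 1 + s)" by (auto intro!: ln_ge_zero ln_mono)
  then have "ln (exp 1 + r) ^ (n - 1) \<le> ln (exp 1 + s) ^ (n - 1)" "0 \<le> ln (exp 1 + r) ^ (n - 1)"
    by (auto intro!: power_mono)
  then have "Phi n r \<le> Phi n s"
    unfolding Phi_def using s(1) rs by (intro mult_mono) auto
  then show ?thesis using r s by (simp add: ext_top_def ennreal_leI)
qed (simp add: ext_top_def)

text \<open>The integral of the class $B_q^*$ over the whole half-line, made convergent at 0 by the cutoff in
  \<^const>\<open>truncated_Phi\<close>. The factor \<open>q\<close> normalizes it for the layer cake formula.\<close>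

definition bump_integral :: "nat \<Rightarrow> real \<Rightarrow> (real \<Rightarrow> ennreal) \<Rightarrow> ennreal" where
  "bump_integral n q \<Phi> =
     (\<integral>\<^sup>+u. indicator {0<..} u * ennreal (q * u powr (- q - 1)) * truncated_Phi n (\<Phi> u) \<partial>lborel)"

lemma B_star_integrand:
  assumes "0 < t"
  shows "x / ennreal (t powr q) / ennreal t = ennreal (t powr (- q - 1)) * x"
proof -
  have "ennreal (t powr (- q - 1)) = inverse (ennreal (t powr q)) * inverse (ennreal t)"
    using assms by (simp add: inverse_ennreal ennreal_mult[symmetric] powr_minus powr_diff field_simps powr_add)
  then show ?thesis by (simp add: divide_ennreal_def ac_simps)
qed

text \<open>Near infinity this is the hypothesis. It forces the complementary function to be finite at some
  \<open>d > c\<close>, hence bounded on \<open>{0..c}\<close>; and below \<open>l * d\<close> the cutoff makes the integrand vanish.\<close>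

lemma bump_integral_finite:
  assumes Y: "young_function \<Psi>" and B: "B_star n q (complementary \<Psi>)" and q: "0 < q"
  shows "bump_integral n q (complementary \<Psi>) < top"
proof -
  define \<Phi> where "\<Phi> = complementary \<Psi>"
  have [measurable]: "\<Phi> \<in> borel_measurable borel" unfolding \<Phi>_def by measurable
  obtain c where c: "0 < c" and fin: "(\<integral>\<^sup>+t\<in>{c<..}. ext_top (Phi n) (\<Phi> t) / ennreal (t powr q) / ennreal t \<partial>lborel) < top"
    using B unfolding B_star_def \<Phi>_def by blast
  have fin': "(\<integral>\<^sup>+t\<in>{c<..}. ennreal (t powr (- q - 1)) * ext_top (Phi n) (\<Phi> t) \<partial>lborel) < top"
  proof -
    have "(\<integral>\<^sup>+t\<in>{c<..}. ennreal (t powr (- q - 1)) * ext_top (Phi n) (\<Phi> t) \<partial>lborel)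
      = (\<integral>\<^sup>+t\<in>{c<..}. ext_top (Phi n) (\<Phi> t) / ennreal (t powr q) / ennreal t \<partial>lborel)"
      using c by (intro nn_integral_cong) (auto simp: B_star_integrand indicator_def)
    then show ?thesis using fin by simp
  qed
  have "\<exists>d>c. \<Phi> d < top"
  proof (rule ccontr)
    assume "\<not> ?thesis"
    then have top: "\<Phi> t = top" if "c < t" for t using that by (metis less_top)
    have "(\<integral>\<^sup>+t\<in>{c<..}. ennreal (t powr (- q - 1)) * ext_top (Phi n) (\<Phi> t) \<partial>lborel)
        = (\<integral>\<^sup>+t. top * indicator {c<..} t \<partial>lborel)"
      using c by (intro nn_integral_cong) (auto simp: top ext_top_def ennreal_mult_top indicator_def)
    also have "\<dots> = top * emeasure lborel {c<..}" by (rule nn_integral_cmult_indicator) simp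
    also have "emeasure lborel {c<..} \<noteq> 0"
    proof -
      have "emeasure lborel {c<..<c + 1} \<le> emeasure lborel {c<..}"
        by (rule emeasure_mono) auto
      then show ?thesis by auto
    qed
    then have "top * emeasure lborel {c<..} = top" by (simp only: ennreal_top_mult if_False)
    finally show False using fin' by (simp only: less_irrefl)
  qed
  then obtain d where d: "c < d" "\<Phi> d < top" by blast
  define M where "M = ext_top (Phi n) (\<Phi> d)"
  have M: "M < top" unfolding M_def using d(2) by (simp add: ext_top_def)
  obtain F where F: "0 \<le> F" "\<Phi> d = ennreal F" using d(2) by (cases "\<Phi> d") auto
  \<comment> \<open>small enough for the cutoff to act at \<open>l * d\<close>, and at most 1\<close>
  define l where "l = (1/2) ^ n / (F + 1)"
  have l: "0 < l" "l \<le> 1" unfolding l_def using F(1) by (auto simp: divide_le_eq power_le_one add_increasing)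
  have "l * F \<le> (1/2) ^ n"
  proof -
    have "F / (F + 1) \<le> 1" using F(1) by (simp add: divide_le_eq)
    then have "(1/2) ^ n * (F / (F + 1)) \<le> (1/2) ^ n * 1" by (intro mult_left_mono) auto
    then show ?thesis by (simp add: l_def)
  qed
  have small: "\<Phi> (l * d) \<le> ennreal ((1/2) ^ n)"
  proof -
    have "\<Phi> (l * d) \<le> ennreal l * ennreal F"
      using complementary_scale[OF Y, of l d] l F(2) unfolding \<Phi>_def by simp
    also have "\<dots> = ennreal (l * F)" using l F(1) by (simp add: ennreal_mult)
    also have "\<dots> \<le> ennreal ((1/2) ^ n)" using \<open>l * F \<le> (1/2) ^ n\<close> by (rule ennreal_leI)
    finally show ?thesis .
  qed
  have bound: "indicator {0<..} u * ennreal (q * u powr (- q - 1)) * truncated_Phi n (\<Phi> u)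
     \<le> ennreal q * (ennreal (u powr (- q - 1)) * ext_top (Phi n) (\<Phi> u) * indicator {c<..} u)
        + ennreal (q * (l * d) powr (- q - 1)) * M * indicator {0..c} u" for u
  proof (cases "u \<le> l * d")
    case True
    then have "\<Phi> u \<le> ennreal ((1/2) ^ n)"
      using small complementary_mono[OF True, of \<Psi>] unfolding \<Phi>_def by order
    then have "truncated_Phi n (\<Phi> u) = 0" by (simp add: truncated_Phi_def leD)
    then show ?thesis by simp
  next
    case False
    then have u: "l * d < u" by simp
    have ld: "0 < l * d" using l c d by (intro mult_pos_pos) auto
    have zy: "truncated_Phi n (\<Phi> u) \<le> ext_top (Phi n) (\<Phi> u)" by (simp add: truncated_Phi_def indicator_def)
    show ?thesis
    proof (cases "c < u")
      case True
      then have "indicator {0<..} u * ennreal (q * u powr (- q - 1)) * truncated_Phi n (\<Phi> u)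
        \<le> ennreal (q * u powr (- q - 1)) * ext_top (Phi n) (\<Phi> u)"
        using zy by (auto simp: indicator_def intro!: mult_left_mono)
      also have "\<dots> = ennreal q * (ennreal (u powr (- q - 1)) * ext_top (Phi n) (\<Phi> u) * indicator {c<..} u)"
        using True q by (simp add: ennreal_mult mult.assoc)
      finally show ?thesis by (simp add: add_increasing2)
    next
      case False
      have "ext_top (Phi n) (\<Phi> u) \<le> M"
        unfolding M_def \<Phi>_def using False d by (intro ext_top_Phi_mono complementary_mono) auto
      moreover have "u powr (- q - 1) \<le> (l * d) powr (- q - 1)"
        using u ld q by (intro powr_mono2') auto
      ultimately have "ennreal (q * u powr (- q - 1)) * truncated_Phi n (\<Phi> u) \<le> ennreal (q * (l * d) powr (- q - 1)) * M"
        using zy q by (intro mult_mono ennreal_leI mult_left_mono) auto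
      then show ?thesis using False u ld by (simp add: indicator_def)
    qed
  qed
  have "bump_integral n q \<Phi> \<le> (\<integral>\<^sup>+u. ennreal q * (ennreal (u powr (- q - 1)) * ext_top (Phi n) (\<Phi> u) * indicator {c<..} u)
        + ennreal (q * (l * d) powr (- q - 1)) * M * indicator {0..c} u \<partial>lborel)"
    unfolding bump_integral_def by (intro nn_integral_mono bound)
  also have "\<dots> = ennreal q * (\<integral>\<^sup>+t\<in>{c<..}. ennreal (t powr (- q - 1)) * ext_top (Phi n) (\<Phi> t) \<partial>lborel)
      + ennreal (q * (l * d) powr (- q - 1)) * M * ennreal c"
    using c by (subst nn_integral_add) (auto simp: nn_integral_cmult nn_integral_cmult_indicator)
  also have "\<dots> < top" using fin' M by (simp add: ennreal_mult_less_top)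
  finally show ?thesis unfolding \<Phi>_def .
qed

text \<open>The normalized Luxemburg norm for an extended-valued \<open>\<Phi>\<close>, as needed for complementary functions,
  with the inequality for the mean cleared of its denominator.\<close>

definition orlicz_norm :: "(real \<Rightarrow> ennreal) \<Rightarrow> 'a::euclidean_space set \<Rightarrow> ('a \<Rightarrow> real) \<Rightarrow> ennreal" where
  "orlicz_norm \<Phi> R g =
     (INF s\<in>{s::real. 0 < s \<and> (\<integral>\<^sup>+x\<in>R. \<Phi> (g x / s) \<partial>lborel) \<le> emeasure lborel R}. ennreal s)"

text \<open>The substitution $u = r s$.\<close>

lemma bump_integral_scale:
  assumes [measurable]: "\<Phi> \<in> borel_measurable borel" and \<Phi>0: "\<Phi> 0 = 0" and q: "0 < q" and r: "0 \<le> r"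
  shows "(\<integral>\<^sup>+s. indicator {0<..} s * ennreal (q * s powr (- q - 1)) * truncated_Phi n (\<Phi> (r * s)) \<partial>lborel)
     = bump_integral n q \<Phi> * ennreal (r powr q)"
proof (cases "r = 0")
  case True
  then show ?thesis using \<Phi>0 by (simp add: truncated_Phi_def)
next
  case False
  with r have r: "0 < r" by simp
  define F where "F u = indicator {0<..} u * ennreal (q * u powr (- q - 1)) * truncated_Phi n (\<Phi> u)" for u
  have F[measurable]: "F \<in> borel_measurable borel" unfolding F_def by measurable
  have scale: "F (0 + r * s) * ennreal (r powr (q + 1)) = indicator {0<..} s * ennreal (q * s powr (- q - 1)) * truncated_Phi n (\<Phi> (r * s))" for s
  proof (cases "0 < s")
    case True
    have "q * (r * s) powr (- q - 1) * r powr (q + 1) = q * s powr (- q - 1)"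
    proof -
      have "r powr (- q - 1) * r powr (q + 1) = 1" using r by (simp add: powr_add[symmetric])
      then show ?thesis using r True by (simp add: powr_mult algebra_simps)
    qed
    then have "ennreal (q * (r * s) powr (- q - 1)) * ennreal (r powr (q + 1)) = ennreal (q * s powr (- q - 1))"
      using q by (simp add: ennreal_mult[symmetric])
    then have "ennreal (q * (r * s) powr (- q - 1)) * z * ennreal (r powr (q + 1)) = ennreal (q * s powr (- q - 1)) * z" for z
      by (metis mult.assoc mult.commute)
    then show ?thesis using True r by (simp add: F_def)
  next
    case False
    then show ?thesis using r by (simp add: F_def zero_less_mult_iff)
  qed
  have "(\<integral>\<^sup>+s. indicator {0<..} s * ennreal (q * s powr (- q - 1)) * truncated_Phi n (\<Phi> (r * s)) \<partial>lborel)
      = (\<integral>\<^sup>+s. F (0 + r * s) * ennreal (r powr (q + 1)) \<partial>lborel)"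
    by (simp only: scale)
  also have "\<dots> = (\<integral>\<^sup>+s. F (0 + r * s) \<partial>lborel) * ennreal (r powr (q + 1))"
    by (rule nn_integral_multc) measurable
  also have "ennreal (r powr (q + 1)) = ennreal r * ennreal (r powr q)"
    using r by (simp add: ennreal_mult[symmetric] powr_add)
  also have "(\<integral>\<^sup>+s. F (0 + r * s) \<partial>lborel) * (ennreal r * ennreal (r powr q))
     = (\<integral>\<^sup>+u. F u \<partial>lborel) * ennreal (r powr q)"
    using r by (subst nn_integral_real_affine[OF F, of r 0]) (simp_all only: abs_of_pos ac_simps)
  finally show ?thesis by (simp add: F_def bump_integral_def)
qed

text \<open>If $\|g\|_{\Phi,R} > 1/s$ then the average of $\Phi(s g)$ over \<open>R\<close> exceeds 1. Hence the level sets of the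
  Orlicz maximal function are controlled by the inequality \<open>strong_maximal_LlogL\<close> for $\Phi(s g)$;
  integrating over \<open>s\<close> and exchanging the integrals leaves, for each \<open>x\<close>, the integral of
  \<open>bump_integral_scale\<close> with \<open>r = g x\<close>.\<close>

lemma orlicz_maximal_bound:
  obtains C :: real where "C > 0"
    and "\<And>S q \<Phi> (g :: 'a::euclidean_space \<Rightarrow> real). finite S \<Longrightarrow>
      (\<And>a c b. (a, c) \<in> S \<Longrightarrow> b \<in> Basis \<Longrightarrow> a \<bullet> b < c \<bullet> b) \<Longrightarrow> 0 < q \<Longrightarrow>
      \<Phi> \<in> borel_measurable borel \<Longrightarrow> \<Phi> 0 = 0 \<Longrightarrow> g \<in> borel_measurable borel \<Longrightarrow> (\<And>x. 0 \<le> g x) \<Longrightarrow>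
      (\<integral>\<^sup>+x. epowr (SUP (a, c)\<in>S. indicator (box a c) x * orlicz_norm \<Phi> (box a c) g) q \<partial>lborel)
        \<le> ennreal C * bump_integral DIM('a) q \<Phi> * (\<integral>\<^sup>+x. ennreal (g x powr q) \<partial>lborel)"
proof (rule strong_maximal_LlogL[where 'a = 'a])
  let ?n = "DIM('a)"
  fix C :: real
  assume C: "C > 0"
    "\<And>S (h :: 'a \<Rightarrow> ennreal). finite S \<Longrightarrow>
      (\<And>a c b. (a, c) \<in> S \<Longrightarrow> b \<in> Basis \<Longrightarrow> a \<bullet> b < c \<bullet> b) \<Longrightarrow> h \<in> borel_measurable borel \<Longrightarrow>
      emeasure lborel (\<Union>(a, c)\<in>{(a, c)\<in>S. (\<integral>\<^sup>+x\<in>box a c. h x \<partial>lborel) > emeasure lborel (box a c)}. box a c)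
        \<le> ennreal C * (\<integral>\<^sup>+x. truncated_Phi ?n (h x) \<partial>lborel)"
  have "(\<integral>\<^sup>+x. epowr (SUP (a, c)\<in>S. indicator (box a c) x * orlicz_norm \<Phi> (box a c) g) q \<partial>lborel)
         \<le> ennreal C * bump_integral ?n q \<Phi> * (\<integral>\<^sup>+x. ennreal (g x powr q) \<partial>lborel)"
    if S: "finite S" "\<And>a c b. (a, c) \<in> S \<Longrightarrow> b \<in> Basis \<Longrightarrow> a \<bullet> b < c \<bullet> b" and q: "0 < q"
      and \<Phi>[measurable]: "\<Phi> \<in> borel_measurable borel" and \<Phi>0: "\<Phi> 0 = 0"
      and g[measurable]: "g \<in> borel_measurable borel" and g0: "\<And>x. 0 \<le> g x"
    for S q \<Phi> and g :: "'a \<Rightarrow> real"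
  proof -
    define M where "M x = (SUP (a, c)\<in>S. indicator (box a c) x * orlicz_norm \<Phi> (box a c) g)" for x
    have [measurable]: "M \<in> borel_measurable borel"
      unfolding M_def using S(1) by (intro borel_measurable_SUP) (auto simp: countable_finite split: prod.split)
    have lev: "emeasure lborel {x\<in>space lborel. 1 < ennreal s * M x} \<le> ennreal C * (\<integral>\<^sup>+x. truncated_Phi ?n (\<Phi> (g x * s)) \<partial>lborel)"
      if s: "0 < s" for s
    proof -
      have "{x\<in>space lborel. 1 < ennreal s * M x} \<subseteq>
        (\<Union>(a, c)\<in>{(a, c)\<in>S. (\<integral>\<^sup>+x\<in>box a c. \<Phi> (g x * s) \<partial>lborel) > emeasure lborel (box a c)}. box a c)"
      proof safe
        fix x assume "1 < ennreal s * M x"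
        then obtain a c where ac: "(a, c) \<in> S" "1 < ennreal s * (indicator (box a c) x * orlicz_norm \<Phi> (box a c) g)"
          unfolding M_def SUP_mult_left_ennreal less_SUP_iff by auto
        have x: "x \<in> box a c" and gt: "1 < ennreal s * orlicz_norm \<Phi> (box a c) g"
          using ac(2) by (auto split: split_indicator_asm)
        have "(\<integral>\<^sup>+x\<in>box a c. \<Phi> (g x * s) \<partial>lborel) > emeasure lborel (box a c)"
        proof (rule ccontr)
          assume "\<not> ?thesis"
          then have "orlicz_norm \<Phi> (box a c) g \<le> ennreal (1 / s)"
            unfolding orlicz_norm_def using s by (intro INF_lower) (auto simp: not_less)
          then have "ennreal s * orlicz_norm \<Phi> (box a c) g \<le> ennreal s * ennreal (1 / s)"
            by (intro mult_left_mono) auto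
          also have "\<dots> = 1" using s by (simp add: ennreal_mult[symmetric])
          finally show False using gt by simp
        qed
        then show "x \<in> (\<Union>(a, c)\<in>{(a, c)\<in>S. (\<integral>\<^sup>+x\<in>box a c. \<Phi> (g x * s) \<partial>lborel) > emeasure lborel (box a c)}. box a c)"
          using x ac(1) by blast
      qed
      then have "emeasure lborel {x\<in>space lborel. 1 < ennreal s * M x} \<le> emeasure lborel
        (\<Union>(a, c)\<in>{(a, c)\<in>S. (\<integral>\<^sup>+x\<in>box a c. \<Phi> (g x * s) \<partial>lborel) > emeasure lborel (box a c)}. box a c)"
        by (intro emeasure_mono) (auto intro!: borel_open open_UN)
      also have "\<dots> \<le> ennreal C * (\<integral>\<^sup>+x. truncated_Phi ?n (\<Phi> (g x * s)) \<partial>lborel)"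
        by (intro C(2) S) measurable
      finally show ?thesis .
    qed
    have "(\<integral>\<^sup>+x. epowr (M x) q \<partial>lborel)
      = (\<integral>\<^sup>+s. indicator {0<..} s * ennreal (q * s powr (- q - 1)) * emeasure lborel {x\<in>space lborel. 1 < ennreal s * M x} \<partial>lborel)"
      by (rule lborel.nn_integral_epowr_layer_cake[OF q]) measurable
    also have "\<dots> \<le> (\<integral>\<^sup>+s. indicator {0<..} s * ennreal (q * s powr (- q - 1)) * (ennreal C * (\<integral>\<^sup>+x. truncated_Phi ?n (\<Phi> (g x * s)) \<partial>lborel)) \<partial>lborel)"
      by (intro nn_integral_mono) (auto simp: indicator_def intro!: mult_left_mono lev[simplified])
    also have "\<dots> = ennreal C * (\<integral>\<^sup>+s. (\<integral>\<^sup>+x. indicator {0<..} s * ennreal (q * s powr (- q - 1)) * truncated_Phi ?n (\<Phi> (g x * s)) \<partial>lborel) \<partial>lborel)"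
      by (subst nn_integral_cmult[symmetric]) (auto simp: nn_integral_cmult mult.left_commute)
    also have "(\<integral>\<^sup>+s. (\<integral>\<^sup>+x. indicator {0<..} s * ennreal (q * s powr (- q - 1)) * truncated_Phi ?n (\<Phi> (g x * s)) \<partial>lborel) \<partial>lborel)
       = (\<integral>\<^sup>+x. (\<integral>\<^sup>+s. indicator {0<..} s * ennreal (q * s powr (- q - 1)) * truncated_Phi ?n (\<Phi> (g x * s)) \<partial>lborel) \<partial>lborel)"
      by (rule lborel_pair.Fubini') measurable
    also have "\<dots> = (\<integral>\<^sup>+x. bump_integral ?n q \<Phi> * ennreal (g x powr q) \<partial>lborel)"
      by (simp only: bump_integral_scale[OF \<Phi> \<Phi>0 q g0])
    also have "\<dots> = bump_integral ?n q \<Phi> * (\<integral>\<^sup>+x. ennreal (g x powr q) \<partial>lborel)"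
      by (rule nn_integral_cmult) measurable
    finally show ?thesis unfolding M_def by (simp add: mult.assoc)
  qed
  with C(1) show thesis by (rule that)
qed

section \<open>A discrete Hoelder inequality for several factors\<close>

text \<open>Sum the tangent line inequality $\ln z \le z - 1$ at $z = y_j / G$ with the weights $\alpha_j$, where
  \<open>G\<close> is the weighted geometric mean.\<close>

lemma weighted_arith_geom_mean:
  fixes y \<alpha> :: "'a \<Rightarrow> real"
  assumes A: "finite A" and \<alpha>: "\<And>j. j \<in> A \<Longrightarrow> 0 < \<alpha> j" "(\<Sum>j\<in>A. \<alpha> j) = 1"
    and y0: "\<And>j. j \<in> A \<Longrightarrow> 0 \<le> y j"
  shows "(\<Prod>j\<in>A. y j powr \<alpha> j) \<le> (\<Sum>j\<in>A. \<alpha> j * y j)"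
proof (cases "\<exists>j\<in>A. y j = 0")
  case True
  then have "(\<Prod>j\<in>A. y j powr \<alpha> j) = 0" using A by (intro prod_zero) auto
  also have "\<dots> \<le> (\<Sum>j\<in>A. \<alpha> j * y j)" 
    by (intro sum_nonneg mult_nonneg_nonneg less_imp_le[OF \<alpha>(1)] y0)
  finally show ?thesis .
next
  case False
  have y: "0 < y j" if "j \<in> A" for j
  proof -
    have "y j \<noteq> 0" using False that by blast
    then show ?thesis using y0[OF that] by simp
  qed
  define G where "G = (\<Prod>j\<in>A. y j powr \<alpha> j)"
  have pos: "0 < y j powr \<alpha> j" if "j \<in> A" for j using y[OF that] by simp
  have G: "0 < G" unfolding G_def by (rule prod_pos[OF pos])
  have lnG: "ln G = (\<Sum>j\<in>A. \<alpha> j * ln (y j))"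
  proof -
    have "ln G = (\<Sum>j\<in>A. ln (y j powr \<alpha> j))"
      unfolding G_def by (rule ln_prod[OF A pos[THEN less_imp_neq, THEN not_sym]])
    also have "\<dots> = (\<Sum>j\<in>A. \<alpha> j * ln (y j))"
    proof (rule sum.cong[OF refl])
      fix j assume "j \<in> A"
      from y[OF this] show "ln (y j powr \<alpha> j) = \<alpha> j * ln (y j)" by (simp add: ln_powr)
    qed
    finally show ?thesis .
  qed
  have "(\<Sum>j\<in>A. \<alpha> j * (1 + (ln (y j) - ln G))) = (\<Sum>j\<in>A. \<alpha> j) + (\<Sum>j\<in>A. \<alpha> j * ln (y j)) - (\<Sum>j\<in>A. \<alpha> j) * ln G"
    by (simp add: sum.distrib sum_subtractf sum_distrib_right right_diff_distrib distrib_left)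
  also have "\<dots> = 1" unfolding lnG[symmetric] \<alpha>(2) by simp
  finally have "1 = (\<Sum>j\<in>A. \<alpha> j * (1 + (ln (y j) - ln G)))" by (rule sym)
  also have "\<dots> \<le> (\<Sum>j\<in>A. \<alpha> j * (y j / G))"
  proof (rule sum_mono)
    fix j assume j: "j \<in> A"
    have "0 < y j / G" using y[OF j] G by simp
    from ln_le_minus_one[OF this] have "1 + (ln (y j) - ln G) \<le> y j / G" using y[OF j] G by (simp add: ln_div)
    then show "\<alpha> j * (1 + (ln (y j) - ln G)) \<le> \<alpha> j * (y j / G)"
      using \<alpha>(1)[OF j] by (intro mult_left_mono) auto
  qed
  also have "\<dots> = (\<Sum>j\<in>A. \<alpha> j * y j) / G" by (simp add: sum_divide_distrib)
  finally have "G \<le> (\<Sum>j\<in>A. \<alpha> j * y j)" using G by (simp add: le_divide_eq)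
  then show ?thesis unfolding G_def .
qed

text \<open>Normalize the sums to 1 and apply the weighted inequality of arithmetic and geometric means
  termwise. In the extended reals the normalization fails if a sum is 0 or infinite; then one side is trivial.\<close>

lemma sum_prod_Holder:
  fixes x :: "'j \<Rightarrow> 'i \<Rightarrow> ennreal"
  assumes A: "finite A" "\<And>j. j \<in> A \<Longrightarrow> 0 < \<alpha> j" "(\<Sum>j\<in>A. \<alpha> j) = 1" and I: "finite I"
  shows "(\<Sum>i\<in>I. \<Prod>j\<in>A. epowr (x j i) (\<alpha> j)) \<le> (\<Prod>j\<in>A. epowr (\<Sum>i\<in>I. x j i) (\<alpha> j))"
proof (cases "\<exists>j\<in>A. (\<Sum>i\<in>I. x j i) = 0")
  case True
  then obtain k where k: "k \<in> A" "\<And>i. i \<in> I \<Longrightarrow> x k i = 0" using I by auto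
  have "(\<Prod>j\<in>A. epowr (x j i) (\<alpha> j)) = 0" if "i \<in> I" for i
    using A(1) k that by (intro prod_zero) auto
  then have "(\<Sum>i\<in>I. \<Prod>j\<in>A. epowr (x j i) (\<alpha> j)) = 0" by (rule sum.neutral[rule_format])
  then show ?thesis by (simp only: zero_le)
next
  case nz: False
  show ?thesis
  proof (cases "\<exists>j\<in>A. (\<Sum>i\<in>I. x j i) = top")
    case True
    then obtain k where k: "k \<in> A" "(\<Sum>i\<in>I. x k i) = top" by auto
    have "(\<Prod>j\<in>A - {k}. epowr (\<Sum>i\<in>I. x j i) (\<alpha> j)) \<noteq> 0"
      using nz A(1) by (auto simp: prod_zero_iff)
    then have "(\<Prod>j\<in>A. epowr (\<Sum>i\<in>I. x j i) (\<alpha> j)) = top"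
      using A(1) k by (subst prod.remove[of _ k]) (auto simp: ennreal_top_mult)
    then show ?thesis by simp
  next
    case False
    define r where "r j i = enn2real (x j i)" for j i
    have fin: "x j i < top" if "j \<in> A" "i \<in> I" for i j
    proof -
      have "x j i \<le> (\<Sum>i\<in>I. x j i)" by (rule member_le_sum[OF that(2) zero_le I])
      also have "\<dots> < top" using False that(1) by (simp add: less_top)
      finally show ?thesis .
    qed
    then have xr: "x j i = ennreal (r j i)" if "j \<in> A" "i \<in> I" for i j
      using that unfolding r_def by simp
    have r0: "0 \<le> r j i" for j i unfolding r_def by simp
    define X where "X j = (\<Sum>i\<in>I. r j i)" for j
    have XX: "(\<Sum>i\<in>I. x j i) = ennreal (X j)" if "j \<in> A" for j
      unfolding X_def using xr[OF that] r0 by (simp add: sum_ennreal)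
    have X: "0 < X j" if "j \<in> A" for j
    proof (rule ccontr)
      assume "\<not> ?thesis"
      then have "(\<Sum>i\<in>I. x j i) = 0" unfolding XX[OF that] by (simp add: ennreal_neg)
      then show False using nz that by blast
    qed
    have "(\<Sum>i\<in>I. \<Prod>j\<in>A. (r j i / X j) powr \<alpha> j) \<le> (\<Sum>i\<in>I. \<Sum>j\<in>A. \<alpha> j * (r j i / X j))"
      by (intro sum_mono weighted_arith_geom_mean A divide_nonneg_pos r0 X)
    also have "\<dots> = (\<Sum>j\<in>A. \<alpha> j * ((\<Sum>i\<in>I. r j i) / X j))"
      unfolding sum_divide_distrib sum_distrib_left by (rule sum.swap)
    also have "\<dots> = (\<Sum>j\<in>A. \<alpha> j)"
    proof (intro sum.cong refl)
      fix j assume "j \<in> A"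
      from X[OF this] show "\<alpha> j * ((\<Sum>i\<in>I. r j i) / X j) = \<alpha> j" unfolding X_def by simp
    qed
    finally have le1: "(\<Sum>i\<in>I. \<Prod>j\<in>A. (r j i / X j) powr \<alpha> j) \<le> 1" using A(3) by simp
    have "(\<Sum>i\<in>I. \<Prod>j\<in>A. r j i powr \<alpha> j) = (\<Prod>j\<in>A. X j powr \<alpha> j) * (\<Sum>i\<in>I. \<Prod>j\<in>A. (r j i / X j) powr \<alpha> j)"
      unfolding sum_distrib_left prod.distrib[symmetric]
    proof (intro sum.cong prod.cong refl)
      fix i j assume "j \<in> A"
      show "r j i powr \<alpha> j = X j powr \<alpha> j * (r j i / X j) powr \<alpha> j"
      proof -
        have eq: "X j * (r j i / X j) = r j i" using X[OF \<open>j \<in> A\<close>] by simp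
        have "(X j * (r j i / X j)) powr \<alpha> j = X j powr \<alpha> j * (r j i / X j) powr \<alpha> j"
          by (rule powr_mult)
        then show ?thesis unfolding eq .
      qed
    qed
    also have "\<dots> \<le> (\<Prod>j\<in>A. X j powr \<alpha> j) * 1"
      by (intro mult_left_mono prod_nonneg le1) simp
    finally have real: "(\<Sum>i\<in>I. \<Prod>j\<in>A. r j i powr \<alpha> j) \<le> (\<Prod>j\<in>A. X j powr \<alpha> j)" by simp
    have "(\<Sum>i\<in>I. \<Prod>j\<in>A. epowr (x j i) (\<alpha> j)) = (\<Sum>i\<in>I. \<Prod>j\<in>A. ennreal (r j i powr \<alpha> j))"
      by (intro sum.cong prod.cong refl) (simp add: xr r0)
    also have "\<dots> = ennreal (\<Sum>i\<in>I. \<Prod>j\<in>A. r j i powr \<alpha> j)"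
      by (simp only: prod_ennreal powr_ge_zero sum_ennreal prod_nonneg)
    also have "\<dots> \<le> ennreal (\<Prod>j\<in>A. X j powr \<alpha> j)" by (rule ennreal_leI[OF real])
    also have "\<dots> = (\<Prod>j\<in>A. ennreal (X j powr \<alpha> j))" by (simp only: prod_ennreal powr_ge_zero)
    also have "\<dots> = (\<Prod>j\<in>A. epowr (\<Sum>i\<in>I. x j i) (\<alpha> j))"
      using X by (intro prod.cong refl) (simp add: XX less_imp_le)
    finally show ?thesis .
  qed
qed

section \<open>Reduction to scattered families of rectangles\<close>

text \<open>A decision for each index that depends on the earlier positive decisions can be carried out.\<close>

lemma greedy_selection:
  fixes P :: "nat \<Rightarrow> nat set \<Rightarrow> bool"
  shows "\<exists>B\<subseteq>{..<N}. \<forall>i<N. i \<in> B \<longleftrightarrow> P i (B \<inter> {..<i})"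
proof (induction N)
  case (Suc N)
  then obtain B where B: "B \<subseteq> {..<N}" "\<And>i. i < N \<Longrightarrow> i \<in> B \<longleftrightarrow> P i (B \<inter> {..<i})" by blast
  define B' where "B' = (if P N B then insert N B else B)"
  have cut: "B' \<inter> {..<i} = B \<inter> {..<i}" if "i \<le> N" for i using that by (auto simp: B'_def)
  have "B \<inter> {..<N} = B" using B(1) by auto
  then have "N \<in> B' \<longleftrightarrow> P N (B' \<inter> {..<N})" using B(1) cut[of N] by (auto simp: B'_def)
  moreover have "i \<in> B' \<longleftrightarrow> P i (B' \<inter> {..<i})" if "i < N" for i
    using B(2)[OF that] cut[of i] that by (auto simp: B'_def)
  moreover have "B' \<subseteq> {..<Suc N}" using B(1) by (auto simp: B'_def)
  ultimately show ?case by (metis less_Suc_eq)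
qed simp

text \<open>For each rational level, the Lindeloef property gives countably many members above this level that cover
  what all such members cover.\<close>

lemma countable_family_SUP:
  fixes v :: "'a::second_countable_topology set \<Rightarrow> ennreal"
  assumes op: "\<And>R. R \<in> \<R> \<Longrightarrow> open R"
  obtains \<F> where "\<F> \<subseteq> \<R>" "countable \<F>"
    "\<And>x. (SUP R\<in>{R\<in>\<R>. x \<in> R}. v R) = (SUP R\<in>\<F>. indicator R x * v R)"
proof -
  define \<R>r where "\<R>r r = {R\<in>\<R>. ennreal (real_of_rat r) < v R}" for r :: rat
  have "\<exists>\<G>. \<G> \<subseteq> \<R>r r \<and> countable \<G> \<and> \<Union>\<G> = \<Union>(\<R>r r)" for r
    using Lindelof[of "\<R>r r"] op unfolding \<R>r_def by (metis (no_types, lifting) mem_Collect_eq)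
  then obtain \<G> where \<G>: "\<And>r. \<G> r \<subseteq> \<R>r r" "\<And>r. countable (\<G> r)" "\<And>r. \<Union>(\<G> r) = \<Union>(\<R>r r)" by metis
  define \<F> where "\<F> = (\<Union>r. \<G> r)"
  have sub: "\<F> \<subseteq> \<R>" unfolding \<F>_def using \<G>(1) by (auto simp: \<R>r_def)
  have "(SUP R\<in>{R\<in>\<R>. x \<in> R}. v R) = (SUP R\<in>\<F>. indicator R x * v R)" for x
  proof (rule antisym)
    show "(SUP R\<in>\<F>. indicator R x * v R) \<le> (SUP R\<in>{R\<in>\<R>. x \<in> R}. v R)"
    proof (rule SUP_least)
      fix R assume "R \<in> \<F>"
      then show "indicator R x * v R \<le> (SUP R\<in>{R\<in>\<R>. x \<in> R}. v R)"
        using sub by (cases "x \<in> R") (auto intro!: SUP_upper)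
    qed
    show "(SUP R\<in>{R\<in>\<R>. x \<in> R}. v R) \<le> (SUP R\<in>\<F>. indicator R x * v R)"
    proof (rule SUP_least)
      fix R assume R: "R \<in> {R\<in>\<R>. x \<in> R}"
      show "v R \<le> (SUP R\<in>\<F>. indicator R x * v R)"
      proof (rule ccontr)
        assume "\<not> ?thesis"
        then obtain r where r: "(SUP R\<in>\<F>. indicator R x * v R) < ennreal (real_of_rat r)" "ennreal (real_of_rat r) < v R"
          using ennreal_rat_dense by (metis not_le)
        then have "x \<in> \<Union>(\<R>r r)" using R by (auto simp: \<R>r_def)
        then obtain Q where Q: "Q \<in> \<G> r" "x \<in> Q" using \<G>(3) by blast
        then have "ennreal (real_of_rat r) < indicator Q x * v Q" using \<G>(1) by (auto simp: \<R>r_def)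
        also have "\<dots> \<le> (SUP R\<in>\<F>. indicator R x * v R)" using Q(1) by (intro SUP_upper) (auto simp: \<F>_def)
        finally show False using r(1) by simp
      qed
    qed
  qed
  moreover have "countable \<F>" unfolding \<F>_def using \<G>(2) by auto
  ultimately show ?thesis using sub that by blast
qed

text \<open>Since the values decrease, every superlevel set of the maximum is a union of an initial segment
  of the sets. So the comparison of initial segments with their selected members passes to the superlevel sets, and the
  layer cake formula, used in both directions, sums it up.\<close>

lemma nn_integral_epowr_sorted_max:
  fixes v :: "nat \<Rightarrow> ennreal"
  assumes "sigma_finite_measure M" and p: "0 < p"
    and R: "\<And>i. i < N \<Longrightarrow> R i \<in> sets M"
    and dec: "\<And>i k. i \<le> k \<Longrightarrow> k < N \<Longrightarrow> v k \<le> v i"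
    and B: "B \<subseteq> {..<N}"
    and cover: "\<And>k. k \<le> N \<Longrightarrow> emeasure M (\<Union>i<k. R i) \<le> c * emeasure M (\<Union>i\<in>B \<inter> {..<k}. R i)"
  shows "(\<integral>\<^sup>+x. epowr (SUP i\<in>{..<N}. indicator (R i) x * v i) p \<partial>M) \<le> c * (\<Sum>i\<in>B. epowr (v i) p * emeasure M (R i))"
proof -
  interpret sigma_finite_measure M by fact
  define g where "g x = (SUP i\<in>{..<N}. indicator (R i) x * v i)" for x
  have [measurable]: "g \<in> borel_measurable M" unfolding g_def using R by (intro borel_measurable_SUP) auto
  have finB: "finite B" using B finite_subset by blast
  define K where "K s = indicator {0<..} s * ennreal (p * s powr (- p - 1))" for s :: real
  have [measurable]: "K \<in> borel_measurable borel" unfolding K_def by measurable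
  have lev: "emeasure M {x\<in>space M. 1 < ennreal s * g x} \<le> c * (\<Sum>i\<in>B. indicator {1<..} (ennreal s * v i) * emeasure M (R i))" for s
  proof -
    \<comment> \<open>the superlevel set consists of the first \<open>k\<close> sets\<close>
    define k where "k = (LEAST k. k = N \<or> \<not> 1 < ennreal s * v k)"
    have kN: "k \<le> N" unfolding k_def by (rule Least_le) simp
    have k: "k = N \<or> \<not> 1 < ennreal s * v k" unfolding k_def by (rule LeastI[of _ N]) simp
    have lt: "1 < ennreal s * v i" if "i < k" for i
      using not_less_Least[OF that[unfolded k_def]] by blast
    have ge: "i < k" if "i < N" "1 < ennreal s * v i" for i
    proof (rule ccontr)
      assume "\<not> i < k"
      then have "v i \<le> v k" "k \<noteq> N" using dec that(1) by auto
      then have "ennreal s * v i \<le> ennreal s * v k" by (intro mult_left_mono) auto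
      then show False using k that(2) \<open>k \<noteq> N\<close> by (meson order_less_le_trans)
    qed
    have "{x\<in>space M. 1 < ennreal s * g x} \<subseteq> (\<Union>i<k. R i)"
    proof safe
      fix x assume "1 < ennreal s * g x"
      then obtain i where i: "i < N" "1 < ennreal s * (indicator (R i) x * v i)"
        unfolding g_def SUP_mult_left_ennreal less_SUP_iff by auto
      then have "x \<in> R i" "1 < ennreal s * v i" by (auto split: split_indicator_asm)
      then show "x \<in> (\<Union>i<k. R i)" using ge i(1) by blast
    qed
    then have "emeasure M {x\<in>space M. 1 < ennreal s * g x} \<le> emeasure M (\<Union>i<k. R i)"
      using R kN by (intro emeasure_mono) auto
    also have "\<dots> \<le> c * emeasure M (\<Union>i\<in>B \<inter> {..<k}. R i)" by (rule cover[OF kN])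
    also have "emeasure M (\<Union>i\<in>B \<inter> {..<k}. R i) \<le> (\<Sum>i\<in>B \<inter> {..<k}. emeasure M (R i))"
      using R B finB by (intro emeasure_subadditive_finite) auto
    also have "\<dots> = (\<Sum>i\<in>B \<inter> {..<k}. indicator {1<..} (ennreal s * v i) * emeasure M (R i))"
      using lt by (intro sum.cong) auto
    also have "\<dots> \<le> (\<Sum>i\<in>B. indicator {1<..} (ennreal s * v i) * emeasure M (R i))"
      using finB by (intro sum_mono2) auto
    finally show ?thesis by (simp add: mult_left_mono)
  qed
  have "(\<integral>\<^sup>+x. epowr (g x) p \<partial>M) = (\<integral>\<^sup>+s. K s * emeasure M {x\<in>space M. 1 < ennreal s * g x} \<partial>lborel)"
    unfolding K_def by (rule nn_integral_epowr_layer_cake[OF p]) measurable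
  also have "\<dots> \<le> (\<integral>\<^sup>+s. K s * (c * (\<Sum>i\<in>B. indicator {1<..} (ennreal s * v i) * emeasure M (R i))) \<partial>lborel)"
    by (intro nn_integral_mono mult_left_mono lev) auto
  also have "\<dots> = (\<integral>\<^sup>+s. c * (\<Sum>i\<in>B. (K s * indicator {1<..} (ennreal s * v i)) * emeasure M (R i)) \<partial>lborel)"
    unfolding mult.left_commute[of "K _" c] sum_distrib_left mult.assoc ..
  also have "\<dots> = c * (\<integral>\<^sup>+s. (\<Sum>i\<in>B. (K s * indicator {1<..} (ennreal s * v i)) * emeasure M (R i)) \<partial>lborel)"
    by (rule nn_integral_cmult) measurable
  also have "(\<integral>\<^sup>+s. (\<Sum>i\<in>B. (K s * indicator {1<..} (ennreal s * v i)) * emeasure M (R i)) \<partial>lborel)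
      = (\<Sum>i\<in>B. \<integral>\<^sup>+s. (K s * indicator {1<..} (ennreal s * v i)) * emeasure M (R i) \<partial>lborel)"
    by (rule nn_integral_sum) measurable
  also have "\<dots> = (\<Sum>i\<in>B. (\<integral>\<^sup>+s. K s * indicator {1<..} (ennreal s * v i) \<partial>lborel) * emeasure M (R i))"
    by (intro sum.cong refl nn_integral_multc) measurable
  also have "\<dots> = (\<Sum>i\<in>B. epowr (v i) p * emeasure M (R i))"
    unfolding K_def epowr_layer_cake[OF p] ..
  finally show ?thesis unfolding g_def .
qed

lemma rectanglesE:
  fixes R :: "(real ^ 'n) set"
  assumes "R \<in> rectangles"
  obtains a c where "R = box a c" "\<And>b. b \<in> Basis \<Longrightarrow> a \<bullet> b < c \<bullet> b"
proof -
  obtain a c where ac: "R = box a c" "\<And>i. a $ i < c $ i" using assms unfolding rectangles_def by blast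
  have "a \<bullet> b < c \<bullet> b" if "b \<in> Basis" for b :: "real ^ 'n"
    using that ac(2) by (auto simp: Basis_vec_def inner_axis)
  with ac(1) show ?thesis by (rule that)
qed

lemma rectangle_open: "R \<in> rectangles \<Longrightarrow> open R"
  by (auto simp: rectangles_def)

lemma rectangle_borel[measurable]: "R \<in> rectangles \<Longrightarrow> R \<in> sets borel"
  by (simp add: rectangle_open)

lemma emeasure_lebesgue_borel: "E \<in> sets borel \<Longrightarrow> emeasure lebesgue E = emeasure lborel E"
  by (simp add: emeasure_completion)

lemma emeasure_rectangle:
  assumes "R \<in> rectangles"
  shows "0 < emeasure lborel R" "emeasure lborel R < top"
proof -
  obtain a c where ac: "R = box a c" "\<And>b. b \<in> Basis \<Longrightarrow> a \<bullet> b < c \<bullet> b" using rectanglesE[OF assms] by blast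
  have "emeasure lborel R = ennreal (\<Prod>b\<in>Basis. (c - a) \<bullet> b)"
    unfolding ac(1) using ac(2) by (intro emeasure_lborel_box) (auto intro: less_imp_le)
  moreover have "0 < (\<Prod>b\<in>Basis. (c - a) \<bullet> b)"
    using ac(2) by (intro prod_pos) (auto simp: inner_diff_left)
  ultimately show "0 < emeasure lborel R" "emeasure lborel R < top" by auto
qed

lemma avg_le_1_iff:
  assumes "R \<in> rectangles"
  shows "avg R h \<le> 1 \<longleftrightarrow> (\<integral>\<^sup>+x\<in>R. h x \<partial>lborel) \<le> emeasure lborel R"
proof -
  have R: "emeasure lborel R \<noteq> 0" "emeasure lborel R < top" using emeasure_rectangle[OF assms] by auto
  have "avg R h = (\<integral>\<^sup>+x\<in>R. h x \<partial>lborel) / emeasure lborel R"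
    unfolding avg_def using assms by (simp add: nn_integral_completion emeasure_lebesgue_borel)
  moreover have "a / b \<le> 1 \<longleftrightarrow> a \<le> b" if b: "b \<noteq> 0" "b < top" for a b :: ennreal
  proof
    assume "a / b \<le> 1"
    then have "a / b * b \<le> 1 * b" by (rule mult_right_mono) simp
    then show "a \<le> b" using b by (simp add: ennreal_divide_times)
  next
    assume "a \<le> b"
    then have "a / b \<le> b / b" by (rule divide_right_mono_ennreal)
    then show "a / b \<le> 1" using b by simp
  qed
  ultimately show ?thesis using R by simp
qed

lemma avg_indicator:
  assumes R: "R \<in> rectangles" and E: "E \<in> sets borel"
  shows "avg R (\<lambda>y. ennreal \<bar>indicator E y\<bar>) = emeasure lborel (R \<inter> E) / emeasure lborel R"
proof -
  have "(\<integral>\<^sup>+y\<in>R. ennreal \<bar>indicator E y\<bar> \<partial>lborel) = (\<integral>\<^sup>+y. indicator (R \<inter> E) y \<partial>lborel)"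
    by (intro nn_integral_cong) (auto simp: indicator_def)
  also have "\<dots> = emeasure lborel (R \<inter> E)" using R E by (intro nn_integral_indicator) auto
  finally show ?thesis unfolding avg_def using R by (simp add: nn_integral_completion emeasure_lebesgue_borel)
qed

lemma open_strong_maximal_level: "open {x. t < strong_maximal f x}"
proof -
  have "{x. t < strong_maximal f x} = \<Union>{R\<in>rectangles. t < avg R (\<lambda>y. ennreal \<bar>f y\<bar>)}"
    unfolding strong_maximal_def less_SUP_iff by blast
  then show ?thesis using rectangle_open by auto
qed

lemma sets_wmeasure[simp]: "sets (wmeasure w) = sets lebesgue"
  by (simp add: wmeasure_def)

lemma space_wmeasure[simp]: "space (wmeasure w) = UNIV"
  by (simp add: wmeasure_def)

lemma weight_sigma_finite:
  fixes w :: "real ^ 'n \<Rightarrow> real"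
  assumes "weight w"
  shows "sigma_finite_measure (wmeasure w)"
proof
  define Q :: "nat \<Rightarrow> (real ^ 'n) set" where "Q n = box (\<chi> i. - real (Suc n)) (\<chi> i. real (Suc n))" for n
  have Q: "Q n \<in> rectangles" for n unfolding Q_def rectangles_def by fastforce
  have "x \<in> (\<Union>n. Q n)" for x
  proof -
    obtain n where n: "norm x < real n" using reals_Archimedean2 by blast
    have "- real (Suc n) < x $ i \<and> x $ i < real (Suc n)" for i using component_le_norm_cart[of x i] n by auto
    then have "x \<in> Q n" by (simp only: Q_def mem_box_cart vec_lambda_beta simp_thms)
    then show ?thesis by blast
  qed
  then have "\<Union>(range Q) = space (wmeasure w)" by auto
  moreover have "emeasure (wmeasure w) (Q n) \<noteq> \<infinity>" for n
    using assms Q[of n] unfolding weight_def infinity_ennreal_def by (metis less_irrefl)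
  moreover have "range Q \<subseteq> sets (wmeasure w)" using Q rectangle_borel by auto
  ultimately show "\<exists>A. countable A \<and> A \<subseteq> sets (wmeasure w) \<and> \<Union>A = space (wmeasure w) \<and> (\<forall>a\<in>A. emeasure (wmeasure w) a \<noteq> \<infinity>)"
    by (intro exI[of _ "range Q"]) auto
qed

text \<open>Keep \<open>R i\<close> if the kept sets before it cover at most the proportion \<open>\<theta>\<close> of it. Then a kept rectangle
  has a large part \<open>E\<close> that is disjoint from the earlier kept ones; and every rectangle, kept or not, lies in the set where the maximal
  function of the union of the kept ones exceeds \<open>\<theta>\<close>, which condition $(A)$ controls.\<close>

lemma condition_A_scattered_selection:
  fixes R :: "nat \<Rightarrow> (real ^ 'n) set"
  assumes \<theta>: "0 < \<theta>" "\<theta> < 1"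
    and A: "\<And>E. E \<in> sets lebesgue \<Longrightarrow>
       emeasure (wmeasure \<omega>) {x. strong_maximal (indicator E) x > ennreal \<theta>} \<le> c * emeasure (wmeasure \<omega>) E"
    and R: "\<And>i. i < N \<Longrightarrow> R i \<in> rectangles"
  obtains B where "B \<subseteq> {..<N}"
    "\<And>i. i \<in> B \<Longrightarrow> emeasure lborel (R i) \<le> ennreal (1 / (1 - \<theta>)) * emeasure lborel (R i - (\<Union>j\<in>B \<inter> {..<i}. R j))"
    "\<And>k. k \<le> N \<Longrightarrow> emeasure (wmeasure \<omega>) (\<Union>i<k. R i) \<le> c * emeasure (wmeasure \<omega>) (\<Union>i\<in>B \<inter> {..<k}. R i)"
proof -
  define U where "U X = (\<Union>j\<in>X. R j)" for X
  obtain B where B: "B \<subseteq> {..<N}"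
    "\<And>i. i < N \<Longrightarrow> i \<in> B \<longleftrightarrow> emeasure lborel (R i \<inter> U (B \<inter> {..<i})) \<le> ennreal \<theta> * emeasure lborel (R i)"
    using greedy_selection[of N "\<lambda>i X. emeasure lborel (R i \<inter> U X) \<le> ennreal \<theta> * emeasure lborel (R i)"] by blast
  have meas: "U (B \<inter> {..<i}) \<in> sets borel" for i
    unfolding U_def using B(1) R by (intro borel_open open_UN) (auto simp: rectangle_open)
  have small: "emeasure lborel (R i) \<le> ennreal (1 / (1 - \<theta>)) * emeasure lborel (R i - U (B \<inter> {..<i}))" if i: "i \<in> B" for i
  proof -
    have iN: "i < N" using B(1) i by auto
    have Ri: "R i \<in> sets borel" using R[OF iN] by (rule rectangle_borel)
    obtain r where r: "0 \<le> r" "emeasure lborel (R i) = ennreal r"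
      using emeasure_rectangle(2)[OF R[OF iN]] by (cases "emeasure lborel (R i)") auto
    have le: "emeasure lborel (R i) \<le> ennreal \<theta> * emeasure lborel (R i) + emeasure lborel (R i - U (B \<inter> {..<i}))"
    proof -
      have "emeasure lborel (R i) = emeasure lborel (R i \<inter> U (B \<inter> {..<i})) + emeasure lborel (R i - U (B \<inter> {..<i}))"
        using Ri meas[of i] by (subst plus_emeasure) (auto intro!: arg_cong[where f = "emeasure lborel"])
      then show ?thesis using B(2)[OF iN] i by (metis add_right_mono)
    qed
    show ?thesis
    proof (cases "emeasure lborel (R i - U (B \<inter> {..<i}))")
      case (real s)
      have "ennreal r \<le> ennreal (\<theta> * r + s)"
        using le \<theta> r real by (simp add: ennreal_mult)
      then have "r \<le> \<theta> * r + s" using \<theta> r real by (subst (asm) ennreal_le_iff) auto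
      then have "r \<le> 1 / (1 - \<theta>) * s" using \<theta> by (simp add: field_simps)
      then have "ennreal r \<le> ennreal (1 / (1 - \<theta>) * s)" by (rule ennreal_leI)
      also have "\<dots> = ennreal (1 / (1 - \<theta>)) * ennreal s" using \<theta> real by (intro ennreal_mult) auto
      finally show ?thesis using r real by simp
    next
      case top
      then show ?thesis using \<theta> by (simp add: ennreal_mult_top)
    qed
  qed
  \<comment> \<open>a rejected set meets the kept ones in more than the proportion \<open>\<theta>\<close>; a kept one lies in their union\<close>
  have cover: "emeasure (wmeasure \<omega>) (\<Union>i<k. R i) \<le> c * emeasure (wmeasure \<omega>) (U (B \<inter> {..<k}))" if k: "k \<le> N" for k
  proof -
    define E where "E = U (B \<inter> {..<k})"
    have E: "E \<in> sets borel" unfolding E_def by (rule meas)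
    have "R i \<subseteq> {x. strong_maximal (indicator E) x > ennreal \<theta>}" if i: "i < k" for i
    proof
      fix x assume x: "x \<in> R i"
      have iN: "i < N" using i k by simp
      have Ri: "R i \<in> sets borel" using R[OF iN] by (rule rectangle_borel)
      note mR = emeasure_rectangle[OF R[OF iN]]
      have gt: "emeasure lborel (R i \<inter> E) > ennreal \<theta> * emeasure lborel (R i)"
      proof (cases "i \<in> B")
        case True
        then have "R i \<inter> E = R i" using i unfolding E_def U_def by auto
        moreover have "ennreal \<theta> * emeasure lborel (R i) < 1 * emeasure lborel (R i)"
          using \<theta> mR by (intro ennreal_mult_strict_right_mono) auto
        ultimately show ?thesis by simp
      next
        case False
        then have "ennreal \<theta> * emeasure lborel (R i) < emeasure lborel (R i \<inter> U (B \<inter> {..<i}))"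
          using B(2)[OF iN] by simp
        also have "\<dots> \<le> emeasure lborel (R i \<inter> E)"
          using Ri E i unfolding E_def U_def by (intro emeasure_mono) auto
        finally show ?thesis .
      qed
      have "ennreal \<theta> < emeasure lborel (R i \<inter> E) / emeasure lborel (R i)"
      proof (rule ccontr)
        assume "\<not> ?thesis"
        then have "emeasure lborel (R i \<inter> E) / emeasure lborel (R i) * emeasure lborel (R i) \<le> ennreal \<theta> * emeasure lborel (R i)"
          by (intro mult_right_mono) auto
        also have "emeasure lborel (R i \<inter> E) / emeasure lborel (R i) * emeasure lborel (R i) = emeasure lborel (R i \<inter> E)"
          using mR by (simp add: ennreal_divide_times)
        finally show False using gt by simp
      qed
      also have "\<dots> = avg (R i) (\<lambda>y. ennreal \<bar>indicator E y\<bar>)" using avg_indicator[OF R[OF iN] E] by simp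
      also have "\<dots> \<le> strong_maximal (indicator E) x"
        unfolding strong_maximal_def using R[OF iN] x by (intro SUP_upper) auto
      finally show "x \<in> {x. strong_maximal (indicator E) x > ennreal \<theta>}" by simp
    qed
    then have "emeasure (wmeasure \<omega>) (\<Union>i<k. R i) \<le> emeasure (wmeasure \<omega>) {x. strong_maximal (indicator E) x > ennreal \<theta>}"
      using open_strong_maximal_level[of "ennreal \<theta>" "indicator E"]
      by (intro emeasure_mono) (auto dest: borel_open)
    also have "\<dots> \<le> c * emeasure (wmeasure \<omega>) E" using E by (intro A) simp
    finally show ?thesis unfolding E_def .
  qed
  show ?thesis using that[OF B(1) small[unfolded U_def] cover[unfolded U_def]] by simp
qed

section \<open>Young's inequality on rectangles and the bump condition\<close>

lemma borel_measurable_ext_top_young[measurable]: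
  assumes "young_function \<Psi>"
  shows "ext_top \<Psi> \<in> borel_measurable borel"
proof -
  have "continuous_on {0..} \<Psi>" using assms by (simp add: young_function_def)
  moreover have "continuous_on UNIV (\<lambda>t::real. max 0 t)" by (intro continuous_intros)
  ultimately have "continuous_on UNIV (\<lambda>t. \<Psi> (max 0 t))"
    by (rule continuous_on_compose2) auto
  then have [measurable]: "(\<lambda>t. \<Psi> (max 0 t)) \<in> borel_measurable borel"
    by (rule borel_measurable_continuous_onI)
  have eq: "ext_top \<Psi> = (\<lambda>x. if x = top then top else ennreal (\<Psi> (max 0 (enn2real x))))"
    by (rule ext) (simp add: ext_top_def)
  show ?thesis unfolding eq by measurable
qed

lemma young_function_scale:
  assumes Y: "young_function \<Psi>" and r: "0 < r" "r \<le> 1"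
  shows "ext_top \<Psi> y \<le> ennreal r * ext_top \<Psi> (y / ennreal r)"
proof (cases y)
  case (real t)
  have "convex_on {0..} \<Psi>" "\<Psi> 0 = 0" using Y unfolding young_function_def by auto
  then have "\<Psi> ((1 - r) *\<^sub>R 0 + r *\<^sub>R (t / r)) \<le> (1 - r) * \<Psi> 0 + r * \<Psi> (t / r)"
    using r real(1) by (intro convex_onD) auto
  then have "\<Psi> t \<le> r * \<Psi> (t / r)" using r \<open>\<Psi> 0 = 0\<close> by simp
  then have "ennreal (\<Psi> t) \<le> ennreal (r * \<Psi> (t / r))" by (rule ennreal_leI)
  also have "\<dots> = ennreal r * ennreal (\<Psi> (t / r))" using r by (intro ennreal_mult') simp
  finally show ?thesis using real r by (simp add: ext_top_def divide_ennreal)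
next
  case top
  then show ?thesis using r by (simp add: ext_top_def ennreal_mult_top ennreal_top_divide)
qed

text \<open>Since \<open>w\<close> is finite everywhere, \<open>1/w\<close> is positive everywhere. If the norm were 0, convexity would
  force the mean of $\Psi(1/w)$ to vanish. This excludes the product $0 \cdot \infty$ in the bump condition, which would make
  it void for some rectangles.\<close>

lemma luxemburg_norm_inverse_nonzero:
  fixes w :: "real ^ 'n \<Rightarrow> real"
  assumes Y: "young_function \<Psi>" and R: "R \<in> rectangles"
    and w[measurable]: "w \<in> borel_measurable lebesgue"
  shows "luxemburg_norm \<Psi> R (\<lambda>x. inverse (ennreal (w x))) \<noteq> 0"
proof
  assume 0: "luxemburg_norm \<Psi> R (\<lambda>x. inverse (ennreal (w x))) = 0"
  note [measurable] = borel_measurable_ext_top_young[OF Y]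
  define h where "h x = ext_top \<Psi> (inverse (ennreal (w x)))" for x
  have h[measurable]: "h \<in> borel_measurable lebesgue" unfolding h_def by measurable
  have [measurable]: "R \<in> sets lebesgue" using rectangle_borel[OF R] by simp
  note mR = emeasure_rectangle[OF R]
  \<comment> \<open>norms below \<open>e\<close> make the integral of \<open>h\<close> of order \<open>e\<close>, by convexity\<close>
  have le: "(\<integral>\<^sup>+x\<in>R. h x \<partial>lebesgue) \<le> ennreal e * emeasure lborel R" if e: "0 < e" "e \<le> 1" for e
  proof -
    have "luxemburg_norm \<Psi> R (\<lambda>x. inverse (ennreal (w x))) < ennreal e" using 0 e by simp
    then obtain r where r: "0 < r" "avg R (\<lambda>x. ext_top \<Psi> (inverse (ennreal (w x)) / ennreal r)) \<le> 1" "ennreal r < ennreal e"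
      unfolding luxemburg_norm_def INF_less_iff by auto
    have re: "r < e" using r e by (simp add: ennreal_less_iff)
    have "(\<integral>\<^sup>+x\<in>R. h x \<partial>lebesgue) \<le> (\<integral>\<^sup>+x. ennreal r * (ext_top \<Psi> (inverse (ennreal (w x)) / ennreal r) * indicator R x) \<partial>lebesgue)"
      unfolding h_def mult.assoc[symmetric] using r re e by (intro nn_integral_mono mult_right_mono young_function_scale Y) auto
    also have "\<dots> = ennreal r * (\<integral>\<^sup>+x\<in>R. ext_top \<Psi> (inverse (ennreal (w x)) / ennreal r) \<partial>lebesgue)"
      by (rule nn_integral_cmult) measurable
    also have "\<dots> \<le> ennreal e * emeasure lborel R"
      using r(2) re unfolding avg_le_1_iff[OF R] by (intro mult_mono ennreal_leI) (auto simp: nn_integral_completion)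
    finally show ?thesis .
  qed
  have "(\<integral>\<^sup>+x\<in>R. h x \<partial>lebesgue) = 0"
  proof -
    obtain m where m: "0 < m" "emeasure lborel R = ennreal m" using mR by (cases "emeasure lborel R") auto
    have fin: "(\<integral>\<^sup>+x\<in>R. h x \<partial>lebesgue) < top"
      using le[of 1] mR(2) by (auto intro: order_le_less_trans)
    then obtain t where t: "0 \<le> t" "(\<integral>\<^sup>+x\<in>R. h x \<partial>lebesgue) = ennreal t" by (cases "\<integral>\<^sup>+x\<in>R. h x \<partial>lebesgue") auto
    have "t = 0"
    proof (rule ccontr)
      assume "t \<noteq> 0"
      then have t0: "0 < t" using t by simp
      define e where "e = min 1 (t / (2 * m))"
      have e: "0 < e" "e \<le> 1" unfolding e_def using t0 m by auto
      have "ennreal t \<le> ennreal (e * m)" using le[OF e] t m e by (simp add: ennreal_mult)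
      then have "t \<le> e * m" using e m t0 by (subst (asm) ennreal_le_iff) auto
      also have "\<dots> \<le> t / (2 * m) * m" unfolding e_def using m by (intro mult_right_mono) auto
      also have "\<dots> = t / 2" using m by simp
      finally show False using t0 by simp
    qed
    then show ?thesis using t by simp
  qed
  then have "AE x in lebesgue. h x * indicator R x = 0"
    by (subst (asm) nn_integral_0_iff_AE) auto
  moreover have "h x \<noteq> 0" for x
  proof (cases "w x > 0")
    case True
    then show ?thesis using young_function_pos[OF Y, of "inverse (w x)"]
      by (simp add: h_def ext_top_def inverse_ennreal)
  next
    case False
    then have "ennreal (w x) = 0" by (simp add: ennreal_neg)
    then show ?thesis by (simp add: h_def ext_top_def)
  qed
  ultimately have "AE x in lebesgue. x \<notin> R" by (auto simp: indicator_def)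
  then have "emeasure lebesgue R = 0"
    by (subst (asm) AE_iff_measurable[OF _ refl]) auto
  then show False using mR rectangle_borel[OF R] by (simp add: emeasure_lebesgue_borel)
qed

lemma orlicz_norm_cong_AE:
  assumes "AE x in lborel. g x = g' x"
  shows "orlicz_norm \<Phi> R g = orlicz_norm \<Phi> R g'"
proof -
  have "(\<integral>\<^sup>+x\<in>R. \<Phi> (g x / s) \<partial>lborel) = (\<integral>\<^sup>+x\<in>R. \<Phi> (g' x / s) \<partial>lborel)" for s
    using assms by (intro nn_integral_cong_AE) auto
  then show ?thesis unfolding orlicz_norm_def by simp
qed

text \<open>Where \<open>w\<close> vanishes, the first summand on the right is infinite.\<close>

lemma le_young_sum:
  assumes Y: "young_function \<Psi>" and r: "0 < r" and s: "0 < s" and w0: "0 \<le> (w::real)"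
  shows "ennreal \<bar>y\<bar> \<le> ennreal (r * s) *
    (ext_top \<Psi> (inverse (ennreal w) / ennreal r) + complementary \<Psi> (\<bar>y\<bar> * w / s))"
proof (cases "w = 0")
  case True
  then show ?thesis using r s by (simp add: ext_top_def ennreal_top_divide ennreal_mult_top)
next
  case False
  then have w: "0 < w" using w0 by simp
  have "ennreal \<bar>y\<bar> = ennreal (r * s * (\<bar>y\<bar> * w / s * (1 / (w * r))))"
    using w r s by simp
  also have "\<dots> = ennreal (r * s) * ennreal (\<bar>y\<bar> * w / s * (1 / (w * r)))"
    using r s by (intro ennreal_mult') simp
  also have "\<dots> \<le> ennreal (r * s) * (ennreal (\<Psi> (1 / (w * r))) + complementary \<Psi> (\<bar>y\<bar> * w / s))"
    using w r by (intro mult_left_mono young_inequality[OF Y]) auto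
  also have "ennreal (\<Psi> (1 / (w * r))) = ext_top \<Psi> (inverse (ennreal w) / ennreal r)"
  proof -
    have "inverse (ennreal w) / ennreal r = ennreal (1 / (w * r))"
      using w r by (simp add: inverse_ennreal divide_ennreal field_simps)
    then show ?thesis using w r by (simp add: ext_top_def)
  qed
  finally show ?thesis .
qed

text \<open>The generalized Hoelder inequality: integrate Young's inequality for competitors \<open>r\<close> and \<open>s\<close> of the
  two norms and take infima one after the other. The first norm is neither 0 nor infinite, so that dividing by it is harmless.\<close>

lemma avg_le_Holder:
  fixes f w :: "real ^ 'n \<Rightarrow> real"
  assumes Y: "young_function \<Psi>" and R: "R \<in> rectangles"
    and f[measurable]: "f \<in> borel_measurable lebesgue"
    and w[measurable]: "w \<in> borel_measurable lebesgue" and w0: "\<And>x. 0 \<le> w x"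
    and L: "luxemburg_norm \<Psi> R (\<lambda>x. inverse (ennreal (w x))) < top"
  shows "avg R (\<lambda>x. ennreal \<bar>f x\<bar>) \<le> 2 * luxemburg_norm \<Psi> R (\<lambda>x. inverse (ennreal (w x)))
           * orlicz_norm (complementary \<Psi>) R (\<lambda>x. \<bar>f x\<bar> * w x)" (is "?A \<le> 2 * ?L * ?N")
proof -
  note [measurable] = borel_measurable_ext_top_young[OF Y]
  have [measurable]: "R \<in> sets lebesgue" using rectangle_borel[OF R] by simp
  note mR = emeasure_rectangle[OF R]
  have L0: "?L \<noteq> 0" by (rule luxemburg_norm_inverse_nonzero[OF Y R w])
  have le: "?A \<le> 2 * ennreal r * ennreal s"
    if r: "0 < r" "avg R (\<lambda>x. ext_top \<Psi> (inverse (ennreal (w x)) / ennreal r)) \<le> 1"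
      and s: "0 < s" "(\<integral>\<^sup>+x\<in>R. complementary \<Psi> (\<bar>f x\<bar> * w x / s) \<partial>lborel) \<le> emeasure lborel R" for r s
  proof -
    define u where "u x = ext_top \<Psi> (inverse (ennreal (w x)) / ennreal r) * indicator R x" for x
    define v where "v x = complementary \<Psi> (\<bar>f x\<bar> * w x / s) * indicator R x" for x
    have [measurable]: "u \<in> borel_measurable lebesgue" "v \<in> borel_measurable lebesgue"
      unfolding u_def v_def by measurable
    have "(\<integral>\<^sup>+x\<in>R. ennreal \<bar>f x\<bar> \<partial>lebesgue) \<le> (\<integral>\<^sup>+x. ennreal (r * s) * (u x + v x) \<partial>lebesgue)"
    proof (rule nn_integral_mono)
      fix x
      have "ennreal \<bar>f x\<bar> * indicator R x \<le> ennreal (r * s) *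
          (ext_top \<Psi> (inverse (ennreal (w x)) / ennreal r) + complementary \<Psi> (\<bar>f x\<bar> * w x / s)) * indicator R x"
        by (rule mult_right_mono[OF le_young_sum[OF Y r(1) s(1) w0] zero_le])
      then show "ennreal \<bar>f x\<bar> * indicator R x \<le> ennreal (r * s) * (u x + v x)"
        by (simp only: u_def v_def distrib_right mult.assoc)
    qed
    also have "\<dots> = ennreal (r * s) * ((\<integral>\<^sup>+x. u x \<partial>lebesgue) + (\<integral>\<^sup>+x. v x \<partial>lebesgue))"
      by (subst nn_integral_cmult, measurable) (subst nn_integral_add, measurable)
    also have "\<dots> \<le> ennreal (r * s) * (emeasure lborel R + emeasure lborel R)"
      using r(2) s(2) unfolding avg_le_1_iff[OF R] u_def v_def
      by (intro mult_left_mono add_mono) (simp_all add: nn_integral_completion)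
    also have "\<dots> = 2 * ennreal r * ennreal s * emeasure lborel R"
      using r(1) by (simp add: ennreal_mult' mult.assoc mult_2[symmetric] mult.left_commute)
    finally have "?A \<le> 2 * ennreal r * ennreal s * emeasure lborel R / emeasure lebesgue R"
      unfolding avg_def by (rule divide_right_mono_ennreal)
    also have "\<dots> = 2 * ennreal r * ennreal s"
      using mR R by (simp add: emeasure_lebesgue_borel rectangle_borel ennreal_times_divide[symmetric])
    finally show ?thesis .
  qed
  have div: "a \<le> b * x" if "a / b \<le> x" "b \<noteq> 0" "b < top" for a b x :: ennreal
  proof -
    have "a / b * b \<le> x * b" using that(1) by (rule mult_right_mono) simp
    moreover have "a / b * b = a" using that(2,3) by (simp add: ennreal_divide_times)
    ultimately show ?thesis by (simp only: mult.commute[of x])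
  qed
  have div': "a / b \<le> x" if "a \<le> b * x" "b \<noteq> 0" "b < top" for a b x :: ennreal
  proof -
    have "a / b \<le> b * x / b" using that(1) by (rule divide_right_mono_ennreal)
    also have "\<dots> = x" using that(2,3) by (simp add: mult.commute[of b] ennreal_times_divide[symmetric])
    finally show ?thesis .
  qed
  have leL: "?A \<le> 2 * ?L * ennreal s"
    if s: "0 < s" "(\<integral>\<^sup>+x\<in>R. complementary \<Psi> (\<bar>f x\<bar> * w x / s) \<partial>lborel) \<le> emeasure lborel R" for s
  proof -
    have b: "2 * ennreal s \<noteq> 0" "2 * ennreal s < top" using s(1) by (auto simp: ennreal_mult_less_top)
    have "?A / (2 * ennreal s) \<le> ?L"
      unfolding luxemburg_norm_def
    proof (rule INF_greatest)
      fix r assume "r \<in> {r. 0 < r \<and> avg R (\<lambda>x. ext_top \<Psi> (inverse (ennreal (w x)) / ennreal r)) \<le> 1}"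
      then have "?A \<le> 2 * ennreal r * ennreal s" using le s by blast
      then have "?A \<le> 2 * ennreal s * ennreal r" by (simp only: mult.assoc mult.commute[of "ennreal r"])
      then show "?A / (2 * ennreal s) \<le> ennreal r" using b by (rule div')
    qed
    then have "?A \<le> 2 * ennreal s * ?L" using b by (rule div)
    then show ?thesis by (simp only: mult.assoc mult.commute[of "ennreal s"])
  qed
  have b: "2 * ?L \<noteq> 0" "2 * ?L < top" using L0 L by (auto simp: ennreal_mult_less_top)
  have "?A / (2 * ?L) \<le> ?N"
    unfolding orlicz_norm_def
  proof (rule INF_greatest)
    fix s assume "s \<in> {s. 0 < s \<and> (\<integral>\<^sup>+x\<in>R. complementary \<Psi> (\<bar>f x\<bar> * w x / s) \<partial>lborel) \<le> emeasure lborel R}"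
    then have "?A \<le> 2 * ?L * ennreal s" using leL by blast
    then show "?A / (2 * ?L) \<le> ennreal s" using b by (rule div')
  qed
  then show ?thesis using b by (rule div)
qed

lemma prod_mono_ennreal:
  fixes f g :: "'j \<Rightarrow> ennreal"
  assumes "\<And>j. j \<in> J \<Longrightarrow> f j \<le> g j"
  shows "(\<Prod>j\<in>J. f j) \<le> (\<Prod>j\<in>J. g j)"
  using assms by (induction J rule: infinite_finite_induct) (auto intro!: mult_mono)

text \<open>If some norm \<open>L j\<close> is infinite, the bump condition forces \<open>V = 0\<close>, and the left-hand side vanishes
  even if an average \<open>a j\<close> is infinite. Otherwise all Hoelder inequalities are available, and the bump condition
  absorbs the factors \<open>L j\<close> and \<open>V\<close>.\<close>

lemma bump_testing:
  fixes a L N :: "'j \<Rightarrow> ennreal" and V r :: ennreal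
  assumes J: "finite J" and p: "0 < p" and K: "0 < K"
    and L: "\<And>j. j \<in> J \<Longrightarrow> L j \<noteq> 0"
    and bump: "epowr V (1 / p) * (\<Prod>j\<in>J. L j) \<le> ennreal K"
    and Holder: "\<And>j. j \<in> J \<Longrightarrow> L j < top \<Longrightarrow> a j \<le> 2 * L j * N j"
  shows "epowr (\<Prod>j\<in>J. a j) p * V \<le> epowr (2 ^ card J * ennreal K) p * (\<Prod>j\<in>J. epowr (N j) p)"
proof (cases "\<exists>j\<in>J. L j = top")
  case True
  then obtain k where k: "k \<in> J" "L k = top" by blast
  have "(\<Prod>j\<in>J - {k}. L j) \<noteq> 0" using J L by (simp add: prod_zero_iff)
  then have "(\<Prod>j\<in>J. L j) = top"
    using J k by (subst prod.remove[of _ k]) (auto simp: ennreal_top_mult)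
  then have "epowr V (1 / p) = 0"
    using bump by (metis ennreal_less_top ennreal_mult_top top.extremum_uniqueI less_irrefl)
  then have "V = 0" by simp
  then show ?thesis by simp
next
  case False
  have Vp: "V = epowr (epowr V (1 / p)) p" using p by (simp add: epowr_epowr)
  have "(\<Prod>j\<in>J. a j) \<le> (\<Prod>j\<in>J. 2 * L j * N j)"
    using False Holder by (intro prod_mono_ennreal) (simp add: less_top)
  also have "\<dots> = 2 ^ card J * (\<Prod>j\<in>J. L j) * (\<Prod>j\<in>J. N j)"
    by (simp add: prod.distrib)
  finally have "epowr (\<Prod>j\<in>J. a j) p * V \<le> epowr (2 ^ card J * (\<Prod>j\<in>J. L j) * (\<Prod>j\<in>J. N j)) p * epowr (epowr V (1 / p)) p"
    using p Vp by (metis epowr_mono mult_right_mono zero_le)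
  also have "\<dots> = epowr (2 ^ card J * (epowr V (1 / p) * (\<Prod>j\<in>J. L j))) p * epowr (\<Prod>j\<in>J. N j) p"
    unfolding epowr_mult[symmetric] by (simp only: ac_simps)
  also have "\<dots> \<le> epowr (2 ^ card J * ennreal K) p * epowr (\<Prod>j\<in>J. N j) p"
    by (intro mult_right_mono epowr_mono p mult_left_mono bump) auto
  finally show ?thesis by (simp add: epowr_prod)
qed

lemma prod_epowr_exponents:
  assumes J: "finite J" "J \<noteq> {}" and e: "e < top"
  shows "(\<Prod>j\<in>J. epowr e (\<alpha> j)) = epowr e (\<Sum>j\<in>J. \<alpha> j)"
proof (cases "e = 0")
  case True
  then show ?thesis using J by (auto simp: prod_zero_iff)
next
  case False
  then obtain t where t: "0 < t" "e = ennreal t" using e by (cases e) (auto simp: less_le)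
  have "(\<Prod>j\<in>J. epowr e (\<alpha> j)) = (\<Prod>j\<in>J. ennreal (t powr \<alpha> j))" using t by simp
  also have "\<dots> = ennreal (\<Prod>j\<in>J. t powr \<alpha> j)" by (intro prod_ennreal) simp
  also have "(\<Prod>j\<in>J. t powr \<alpha> j) = t powr (\<Sum>j\<in>J. \<alpha> j)" using t by (intro powr_sum[symmetric]) auto
  finally show ?thesis using t by simp
qed

lemma sum_prod_powers_Holder:
  fixes N :: "'j \<Rightarrow> 'i \<Rightarrow> ennreal" and e :: "'i \<Rightarrow> ennreal"
  assumes J: "finite J" and p: "0 < p" and q: "\<And>j. j \<in> J \<Longrightarrow> 0 < q j"
    and pq: "(\<Sum>j\<in>J. p / q j) = 1" and I: "finite I" and e: "\<And>i. i \<in> I \<Longrightarrow> e i < top"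
  shows "(\<Sum>i\<in>I. (\<Prod>j\<in>J. epowr (N j i) p) * e i)
    \<le> (\<Prod>j\<in>J. epowr (\<Sum>i\<in>I. epowr (N j i) (q j) * e i) (p / q j))"
proof -
  have ne: "J \<noteq> {}" using pq by auto
  have "(\<Sum>i\<in>I. (\<Prod>j\<in>J. epowr (N j i) p) * e i) = (\<Sum>i\<in>I. \<Prod>j\<in>J. epowr (epowr (N j i) (q j) * e i) (p / q j))"
  proof (rule sum.cong[OF refl])
    fix i assume i: "i \<in> I"
    have "(\<Prod>j\<in>J. epowr (epowr (N j i) (q j) * e i) (p / q j)) = (\<Prod>j\<in>J. epowr (N j i) p * epowr (e i) (p / q j))"
    proof (rule prod.cong[OF refl])
      fix j assume "j \<in> J"
      from q[OF this] show "epowr (epowr (N j i) (q j) * e i) (p / q j) = epowr (N j i) p * epowr (e i) (p / q j)"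
        by (simp add: epowr_mult epowr_epowr)
    qed
    also have "\<dots> = (\<Prod>j\<in>J. epowr (N j i) p) * e i"
      using prod_epowr_exponents[OF J ne e[OF i], of "\<lambda>j. p / q j"] pq by (simp add: prod.distrib)
    finally show "(\<Prod>j\<in>J. epowr (N j i) p) * e i = (\<Prod>j\<in>J. epowr (epowr (N j i) (q j) * e i) (p / q j))" by simp
  qed
  also have "\<dots> \<le> (\<Prod>j\<in>J. epowr (\<Sum>i\<in>I. epowr (N j i) (q j) * e i) (p / q j))"
    using p q by (intro sum_prod_Holder J I pq) auto
  finally show ?thesis .
qed

text \<open>The sets \<open>E i\<close> are disjoint, and on \<open>E i\<close> the maximal function is at least \<open>N (R i)\<close>.\<close>

lemma scattered_sum_le_integral:
  fixes R :: "nat \<Rightarrow> 'a::euclidean_space set" and N :: "'a set \<Rightarrow> ennreal"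
  assumes I: "finite I" and R: "\<And>i. i \<in> I \<Longrightarrow> R i \<in> sets borel" and q: "0 < q"
    and E: "\<And>i. i \<in> I \<Longrightarrow> E i = R i - (\<Union>j\<in>I \<inter> {..<i}. R j)" and S: "R ` I \<subseteq> S"
  shows "(\<Sum>i\<in>I. epowr (N (R i)) q * emeasure lborel (E i))
    \<le> (\<integral>\<^sup>+x. epowr (SUP Q\<in>S. indicator Q x * N Q) q \<partial>lborel)"
proof -
  have Em: "E i \<in> sets borel" if "i \<in> I" for i
    unfolding E[OF that] using R that I by (intro sets.Diff sets.finite_UN) auto
  have "(\<Sum>i\<in>I. epowr (N (R i)) q * emeasure lborel (E i)) = (\<Sum>i\<in>I. \<integral>\<^sup>+x. epowr (N (R i)) q * indicator (E i) x \<partial>lborel)"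
    using Em by (intro sum.cong refl nn_integral_cmult_indicator[symmetric]) simp
  also have "\<dots> = (\<integral>\<^sup>+x. (\<Sum>i\<in>I. epowr (N (R i)) q * indicator (E i) x) \<partial>lborel)"
    using Em by (intro nn_integral_sum[symmetric] borel_measurable_times borel_measurable_const borel_measurable_indicator) simp
  also have "\<dots> \<le> (\<integral>\<^sup>+x. epowr (SUP Q\<in>S. indicator Q x * N Q) q \<partial>lborel)"
  proof (rule nn_integral_mono)
    fix x
    show "(\<Sum>i\<in>I. epowr (N (R i)) q * indicator (E i) x) \<le> epowr (SUP Q\<in>S. indicator Q x * N Q) q"
    proof (cases "\<exists>i\<in>I. x \<in> E i")
      case True
      then obtain i where i: "i \<in> I" "x \<in> E i" by blast
      have "x \<notin> E k" if k: "k \<in> I" "k \<noteq> i" for k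
        using i k unfolding E[OF i(1)] E[OF k(1)] by (cases "k < i") auto
      then have "(\<Sum>i\<in>I. epowr (N (R i)) q * indicator (E i) x) = epowr (N (R i)) q * indicator (E i) x"
        using I i(1) by (subst sum.remove[of _ i]) auto
      also have "\<dots> = epowr (indicator (R i) x * N (R i)) q"
        using i unfolding E[OF i(1)] by simp
      also have "\<dots> \<le> epowr (SUP Q\<in>S. indicator Q x * N Q) q"
        using i(1) S by (intro epowr_mono q SUP_upper) auto
      finally show ?thesis .
    next
      case False
      then have "(\<Sum>i\<in>I. epowr (N (R i)) q * indicator (E i) x) = 0" by (intro sum.neutral) auto
      then show ?thesis by (simp only: zero_le)
    qed
  qed
  finally show ?thesis .
qed


section \<open>Boundedness of the multilinear strong maximal operator\<close>

text \<open>The passage from the weighted to the unweighted problem. The scattered subfamily reduces the integral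
  to a sum of \<open>v (R i)\<close> to the power \<open>p\<close> times the weight of \<open>R i\<close>; the testing inequality replaces the weight by Lebesgue measure, which
  is comparable on \<open>R i\<close> and \<open>E i\<close>; and Hoelder's inequality separates the indices \<open>j\<close>.\<close>

lemma sparse_domination_finite:
  fixes a :: "'j \<Rightarrow> (real ^ 'n) set \<Rightarrow> ennreal"
  assumes \<omega>: "weight \<omega>" and \<theta>: "0 < \<theta>" "\<theta> < 1"
    and A: "\<And>E. E \<in> sets lebesgue \<Longrightarrow>
       emeasure (wmeasure \<omega>) {x. strong_maximal (indicator E) x > ennreal \<theta>} \<le> c * emeasure (wmeasure \<omega>) E"
    and J: "finite J" and p: "0 < p" and q: "\<And>j. j \<in> J \<Longrightarrow> 0 < q j" and pq: "(\<Sum>j\<in>J. p / q j) = 1"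
    and test: "\<And>R. R \<in> rectangles \<Longrightarrow>
       epowr (v R) p * emeasure (wmeasure \<omega>) R \<le> D * ((\<Prod>j\<in>J. epowr (N j R) p) * emeasure lborel R)"
    and max: "\<And>S j. finite S \<Longrightarrow> S \<subseteq> rectangles \<Longrightarrow> j \<in> J \<Longrightarrow>
       (\<integral>\<^sup>+x. epowr (SUP R\<in>S. indicator R x * N j R) (q j) \<partial>lborel) \<le> Y j"
    and S: "finite S" "S \<subseteq> rectangles"
  shows "(\<integral>\<^sup>+x. epowr (SUP R\<in>S. indicator R x * v R) p \<partial>wmeasure \<omega>)
    \<le> c * (D * (ennreal (1 / (1 - \<theta>)) * (\<Prod>j\<in>J. epowr (Y j) (p / q j))))"
proof -
  obtain xs where xs: "set xs = S" using finite_list[OF S(1)] by blast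
  define zs where "zs = rev (sort_key v xs)"
  define M where "M = length zs"
  define R where "R i = zs ! i" for i
  have setz: "set zs = S" unfolding zs_def using xs by simp
  have RS: "R ` {..<M} = S" unfolding R_def M_def setz[symmetric] by (auto simp: set_conv_nth)
  have Rr: "R i \<in> rectangles" if "i < M" for i using that RS S(2) by auto
  have Rb: "R i \<in> sets borel" if "i < M" for i by (rule rectangle_borel[OF Rr[OF that]])
  have "sorted (rev (map v zs))" unfolding zs_def by (simp add: rev_map)
  then have dec: "v (R k) \<le> v (R i)" if "i \<le> k" "k < M" for i k
    using sorted_rev_nth_mono[of "map v zs" i k] that unfolding R_def M_def by simp
  obtain B where B: "B \<subseteq> {..<M}"
    "\<And>i. i \<in> B \<Longrightarrow> emeasure lborel (R i) \<le> ennreal (1 / (1 - \<theta>)) * emeasure lborel (R i - (\<Union>j\<in>B \<inter> {..<i}. R j))"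
    "\<And>k. k \<le> M \<Longrightarrow> emeasure (wmeasure \<omega>) (\<Union>i<k. R i) \<le> c * emeasure (wmeasure \<omega>) (\<Union>i\<in>B \<inter> {..<k}. R i)"
    by (rule condition_A_scattered_selection[where R = R and N = M, OF \<theta> A Rr], assumption, assumption) (rule that)
  have finB: "finite B" using B(1) finite_subset by blast
  define E where "E i = R i - (\<Union>j\<in>B \<inter> {..<i}. R j)" for i
  have E: "emeasure lborel (R i) \<le> ennreal (1 / (1 - \<theta>)) * emeasure lborel (E i)" "emeasure lborel (E i) < top" if "i \<in> B" for i
  proof -
    show "emeasure lborel (R i) \<le> ennreal (1 / (1 - \<theta>)) * emeasure lborel (E i)" unfolding E_def by (rule B(2)[OF that])
    have iM: "i < M" using that B(1) by auto
    have "emeasure lborel (E i) \<le> emeasure lborel (R i)"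
      unfolding E_def using Rb[OF iM] by (intro emeasure_mono) auto
    also have "\<dots> < top" by (rule emeasure_rectangle(2)[OF Rr[OF iM]])
    finally show "emeasure lborel (E i) < top" .
  qed
  have "(\<integral>\<^sup>+x. epowr (SUP Q\<in>S. indicator Q x * v Q) p \<partial>wmeasure \<omega>)
      = (\<integral>\<^sup>+x. epowr (SUP i\<in>{..<M}. indicator (R i) x * v (R i)) p \<partial>wmeasure \<omega>)"
    unfolding RS[symmetric] image_image ..
  also have "\<dots> \<le> c * (\<Sum>i\<in>B. epowr (v (R i)) p * emeasure (wmeasure \<omega>) (R i))"
    by (rule nn_integral_epowr_sorted_max[OF weight_sigma_finite[OF \<omega>] p]) (use Rb dec B in auto)
  also have "\<dots> \<le> c * (\<Sum>i\<in>B. D * (ennreal (1 / (1 - \<theta>)) * ((\<Prod>j\<in>J. epowr (N j (R i)) p) * emeasure lborel (E i))))"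
  proof (intro mult_left_mono sum_mono)
    fix i assume i: "i \<in> B"
    have "epowr (v (R i)) p * emeasure (wmeasure \<omega>) (R i) \<le> D * ((\<Prod>j\<in>J. epowr (N j (R i)) p) * emeasure lborel (R i))"
      using i B(1) by (intro test Rr) auto
    also have "\<dots> \<le> D * ((\<Prod>j\<in>J. epowr (N j (R i)) p) * (ennreal (1 / (1 - \<theta>)) * emeasure lborel (E i)))"
      by (intro mult_left_mono E(1) i) auto
    finally show "epowr (v (R i)) p * emeasure (wmeasure \<omega>) (R i)
      \<le> D * (ennreal (1 / (1 - \<theta>)) * ((\<Prod>j\<in>J. epowr (N j (R i)) p) * emeasure lborel (E i)))"
      by (simp only: mult.left_commute)
  qed auto
  also have "\<dots> = c * (D * (ennreal (1 / (1 - \<theta>)) * (\<Sum>i\<in>B. (\<Prod>j\<in>J. epowr (N j (R i)) p) * emeasure lborel (E i))))"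
    unfolding sum_distrib_left ..
  also have "\<dots> \<le> c * (D * (ennreal (1 / (1 - \<theta>)) * (\<Prod>j\<in>J. epowr (Y j) (p / q j))))"
  proof (intro mult_left_mono zero_le)
    have "(\<Sum>i\<in>B. (\<Prod>j\<in>J. epowr (N j (R i)) p) * emeasure lborel (E i))
      \<le> (\<Prod>j\<in>J. epowr (\<Sum>i\<in>B. epowr (N j (R i)) (q j) * emeasure lborel (E i)) (p / q j))"
      by (rule sum_prod_powers_Holder[OF J p q pq finB E(2)])
    also have "\<dots> \<le> (\<Prod>j\<in>J. epowr (Y j) (p / q j))"
    proof (intro prod_mono_ennreal epowr_mono)
      fix j assume j: "j \<in> J"
      show "0 < p / q j" using p q[OF j] by simp
      have "(\<Sum>i\<in>B. epowr (N j (R i)) (q j) * emeasure lborel (E i))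
          \<le> (\<integral>\<^sup>+x. epowr (SUP Q\<in>S. indicator Q x * N j Q) (q j) \<partial>lborel)"
        by (rule scattered_sum_le_integral[OF finB _ q[OF j] E_def]) (use Rb B(1) RS in auto)
      also have "\<dots> \<le> Y j" by (rule max[OF S j])
      finally show "(\<Sum>i\<in>B. epowr (N j (R i)) (q j) * emeasure lborel (E i)) \<le> Y j" .
    qed
    finally show "(\<Sum>i\<in>B. (\<Prod>j\<in>J. epowr (N j (R i)) p) * emeasure lborel (E i))
      \<le> (\<Prod>j\<in>J. epowr (Y j) (p / q j))" .
  qed
  finally show ?thesis .
qed

text \<open>The supremum over all rectangles is an increasing limit of maxima over finite families.\<close>

lemma nn_integral_SUP_finite_families:
  fixes v :: "(real ^ 'n) set \<Rightarrow> ennreal"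
  assumes p: "0 < p"
    and bound: "\<And>S. finite S \<Longrightarrow> S \<subseteq> rectangles \<Longrightarrow>
      (\<integral>\<^sup>+x. epowr (SUP R\<in>S. indicator R x * v R) p \<partial>wmeasure \<omega>) \<le> C"
  shows "(\<lambda>x. SUP R\<in>{R\<in>rectangles. x \<in> R}. v R) \<in> borel_measurable (wmeasure \<omega>)"
    and "(\<integral>\<^sup>+x. epowr (SUP R\<in>{R\<in>rectangles. x \<in> R}. v R) p \<partial>wmeasure \<omega>) \<le> C"
proof -
  obtain F where F: "F \<subseteq> rectangles" "countable F"
    "\<And>x. (SUP R\<in>{R\<in>rectangles. x \<in> R}. v R) = (SUP R\<in>F. indicator R x * v R)"
    using countable_family_SUP[of rectangles v] rectangle_open by blast
  have meas: "(\<lambda>x. indicator R x * v R) \<in> borel_measurable (wmeasure \<omega>)" if "R \<in> rectangles" for R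
  proof -
    have [measurable]: "R \<in> sets (wmeasure \<omega>)" using rectangle_borel[OF that] by simp
    show ?thesis by measurable
  qed
  show "(\<lambda>x. SUP R\<in>{R\<in>rectangles. x \<in> R}. v R) \<in> borel_measurable (wmeasure \<omega>)"
    unfolding F(3) using F(1,2) meas by (intro borel_measurable_SUP) auto
  show "(\<integral>\<^sup>+x. epowr (SUP R\<in>{R\<in>rectangles. x \<in> R}. v R) p \<partial>wmeasure \<omega>) \<le> C"
  proof (cases "F = {}")
    case True
    then show ?thesis unfolding F(3) by (simp add: bot_ennreal)
  next
    case False
    define R where "R = from_nat_into F"
    have RF: "range R = F" unfolding R_def using False F(2) by (rule range_from_nat_into)
    define g where "g n x = epowr (SUP i\<in>{..<n}. indicator (R i) x * v (R i)) p" for n x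
    have gm: "g n \<in> borel_measurable (wmeasure \<omega>)" for n
    proof -
      have "(\<lambda>x. SUP i\<in>{..<n}. indicator (R i) x * v (R i)) \<in> borel_measurable (wmeasure \<omega>)"
        using meas RF F(1) by (intro borel_measurable_SUP) auto
      then show ?thesis unfolding g_def by (rule measurable_compose[OF _ borel_measurable_epowr])
    qed
    have inc: "incseq g"
      unfolding g_def incseq_def le_fun_def by (auto intro!: epowr_mono p SUP_subset_mono)
    have sup: "epowr (SUP Q\<in>F. indicator Q x * v Q) p = (SUP n. g n x)" for x
    proof -
      have "(SUP Q\<in>F. indicator Q x * v Q) = (SUP n. SUP i\<in>{..<n}. indicator (R i) x * v (R i))"
      proof (rule antisym)
        show "(SUP Q\<in>F. indicator Q x * v Q) \<le> (SUP n. SUP i\<in>{..<n}. indicator (R i) x * v (R i))"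
          unfolding RF[symmetric] image_image
        proof (rule SUP_least)
          fix i
          show "indicator (R i) x * v (R i) \<le> (SUP n. SUP i\<in>{..<n}. indicator (R i) x * v (R i))"
            by (rule SUP_upper2[of "Suc i"], simp, rule SUP_upper) simp
        qed
        show "(SUP n. SUP i\<in>{..<n}. indicator (R i) x * v (R i)) \<le> (SUP Q\<in>F. indicator Q x * v Q)"
          using RF by (intro SUP_least) (auto intro!: SUP_upper)
      qed
      then show ?thesis unfolding g_def by (simp only: epowr_SUP[OF p])
    qed
    have "(\<integral>\<^sup>+x. epowr (SUP R\<in>{R\<in>rectangles. x \<in> R}. v R) p \<partial>wmeasure \<omega>) = (SUP n. \<integral>\<^sup>+x. g n x \<partial>wmeasure \<omega>)"
      unfolding F(3) sup by (rule nn_integral_monotone_convergence_SUP[OF inc gm])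
    also have "\<dots> \<le> C"
    proof (rule SUP_least)
      fix n
      have "(\<integral>\<^sup>+x. epowr (SUP Q\<in>R ` {..<n}. indicator Q x * v Q) p \<partial>wmeasure \<omega>) \<le> C"
        using RF F(1) by (intro bound) auto
      then show "(\<integral>\<^sup>+x. g n x \<partial>wmeasure \<omega>) \<le> C" unfolding g_def image_image .
    qed
    finally show ?thesis .
  qed
qed

text \<open>The result for boxes given by their corners, transferred to sets of rectangles and, by modification
  on a null set, to Lebesgue measurable functions.\<close>

lemma orlicz_maximal_bound_rectangles:
  obtains C :: real where "C > 0"
    and "\<And>S q \<Phi> (g :: real ^ 'n \<Rightarrow> real). finite S \<Longrightarrow> S \<subseteq> rectangles \<Longrightarrow> 0 < q \<Longrightarrow>
      \<Phi> \<in> borel_measurable borel \<Longrightarrow> \<Phi> 0 = 0 \<Longrightarrow> g \<in> borel_measurable lebesgue \<Longrightarrow> (\<And>x. 0 \<le> g x) \<Longrightarrow>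
      (\<integral>\<^sup>+x. epowr (SUP R\<in>S. indicator R x * orlicz_norm \<Phi> R g) q \<partial>lborel)
        \<le> ennreal C * bump_integral CARD('n) q \<Phi> * (\<integral>\<^sup>+x. ennreal (g x powr q) \<partial>lborel)"
proof (rule orlicz_maximal_bound[where 'a = "real ^ 'n"])
  fix C :: real
  assume C: "C > 0"
    and bound: "\<And>S q \<Phi> (g :: real ^ 'n \<Rightarrow> real). finite S \<Longrightarrow>
      (\<And>a c b. (a, c) \<in> S \<Longrightarrow> b \<in> Basis \<Longrightarrow> a \<bullet> b < c \<bullet> b) \<Longrightarrow> 0 < q \<Longrightarrow>
      \<Phi> \<in> borel_measurable borel \<Longrightarrow> \<Phi> 0 = 0 \<Longrightarrow> g \<in> borel_measurable borel \<Longrightarrow> (\<And>x. 0 \<le> g x) \<Longrightarrow>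
      (\<integral>\<^sup>+x. epowr (SUP (a, c)\<in>S. indicator (box a c) x * orlicz_norm \<Phi> (box a c) g) q \<partial>lborel)
        \<le> ennreal C * bump_integral DIM(real ^ 'n) q \<Phi> * (\<integral>\<^sup>+x. ennreal (g x powr q) \<partial>lborel)"
  have "(\<integral>\<^sup>+x. epowr (SUP R\<in>S. indicator R x * orlicz_norm \<Phi> R g) q \<partial>lborel)
        \<le> ennreal C * bump_integral CARD('n) q \<Phi> * (\<integral>\<^sup>+x. ennreal (g x powr q) \<partial>lborel)"
    if S: "finite S" "S \<subseteq> rectangles" and q: "0 < q" and \<Phi>: "\<Phi> \<in> borel_measurable borel" "\<Phi> 0 = 0"
      and g: "g \<in> borel_measurable lebesgue" and g0: "\<And>x. 0 \<le> g x" for S q \<Phi> and g :: "real ^ 'n \<Rightarrow> real"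
  proof -
    have "S \<subseteq> (\<lambda>(a, c). box a c) ` {(a, c). \<forall>b\<in>Basis. a \<bullet> b < c \<bullet> b}"
    proof
      fix R assume "R \<in> S"
      then obtain a c where "R = box a c" "\<And>b. b \<in> Basis \<Longrightarrow> a \<bullet> b < c \<bullet> b"
        using S(2) rectanglesE[of R] by blast
      then show "R \<in> (\<lambda>(a, c). box a c) ` {(a, c). \<forall>b\<in>Basis. a \<bullet> b < c \<bullet> b}"
        by (intro image_eqI[of _ _ "(a, c)"]) auto
    qed
    from finite_subset_image[OF S(1) this] obtain P where
      P: "P \<subseteq> {(a, c). \<forall>b\<in>Basis. a \<bullet> b < c \<bullet> b}" "finite P" "S = (\<lambda>(a, c). box a c) ` P" by blast
    obtain g' where g': "g' \<in> borel_measurable lborel" "AE x in lborel. g x = g' x"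
      using completion_ex_borel_measurable_real[OF g] by blast
    \<comment> \<open>the Borel representative may be negative on a null set\<close>
    define h where "h x = \<bar>g' x\<bar>" for x
    have [measurable]: "g' \<in> borel_measurable borel" using g'(1) by simp
    have h: "h \<in> borel_measurable borel" unfolding h_def by measurable
    have ae: "AE x in lborel. g x = h x"
      using g'(2) by eventually_elim (metis abs_of_nonneg g0 h_def)
    have "(\<integral>\<^sup>+x. epowr (SUP R\<in>S. indicator R x * orlicz_norm \<Phi> R g) q \<partial>lborel)
      = (\<integral>\<^sup>+x. epowr (SUP (a, c)\<in>P. indicator (box a c) x * orlicz_norm \<Phi> (box a c) h) q \<partial>lborel)"
      unfolding P(3) orlicz_norm_cong_AE[OF ae] by (simp add: image_image case_prod_beta)
    also have "\<dots> \<le> ennreal C * bump_integral DIM(real ^ 'n) q \<Phi> * (\<integral>\<^sup>+x. ennreal (h x powr q) \<partial>lborel)"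
      using P(1) by (intro bound P(2) q \<Phi> h) (auto simp: h_def)
    also have "(\<integral>\<^sup>+x. ennreal (h x powr q) \<partial>lborel) = (\<integral>\<^sup>+x. ennreal (g x powr q) \<partial>lborel)"
      using ae by (intro nn_integral_cong_AE) auto
    finally show ?thesis by simp
  qed
  with C show thesis by (rule that)
qed

lemma eLp_norm_weighted:
  fixes f w :: "real ^ 'n \<Rightarrow> real"
  assumes [measurable]: "f \<in> borel_measurable lebesgue" "w \<in> borel_measurable lebesgue" and w0: "\<And>x. 0 \<le> w x"
  shows "eLp_norm q (wmeasure (\<lambda>x. w x powr q)) (\<lambda>x. ennreal \<bar>f x\<bar>)
    = epowr (\<integral>\<^sup>+x. ennreal ((\<bar>f x\<bar> * w x) powr q) \<partial>lborel) (1 / q)"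
proof -
  have "(\<integral>\<^sup>+x. epowr (ennreal \<bar>f x\<bar>) q \<partial>wmeasure (\<lambda>x. w x powr q))
      = (\<integral>\<^sup>+x. ennreal (w x powr q) * epowr (ennreal \<bar>f x\<bar>) q \<partial>lebesgue)"
    unfolding wmeasure_def by (rule nn_integral_density) measurable
  also have "\<dots> = (\<integral>\<^sup>+x. ennreal ((\<bar>f x\<bar> * w x) powr q) \<partial>lborel)"
    unfolding nn_integral_completion
    by (intro nn_integral_cong) (simp add: powr_mult ennreal_mult mult.commute)
  finally show ?thesis unfolding eLp_norm_def by simp
qed

lemma emeasure_wmeasure_rectangle:
  assumes R: "R \<in> rectangles" and "\<omega> \<in> borel_measurable lebesgue"
  shows "emeasure (wmeasure \<omega>) R = avg R (\<lambda>x. ennreal (\<omega> x)) * emeasure lborel R"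
proof -
  have "emeasure (wmeasure \<omega>) R = (\<integral>\<^sup>+x\<in>R. ennreal (\<omega> x) \<partial>lebesgue)"
    unfolding wmeasure_def using assms rectangle_borel[OF R] by (intro emeasure_density) auto
  moreover have "emeasure lborel R \<noteq> 0" "emeasure lborel R < top" using emeasure_rectangle[OF R] by auto
  ultimately show ?thesis
    unfolding avg_def using rectangle_borel[OF R] by (simp add: emeasure_lebesgue_borel ennreal_divide_times)
qed

theorem corollary3p4:
  fixes m :: nat and ps :: "nat \<Rightarrow> real" and p K :: real
    and \<nu> :: "real ^ 'n \<Rightarrow> real" and w :: "nat \<Rightarrow> real ^ 'n \<Rightarrow> real"
    and \<Psi> :: "nat \<Rightarrow> real \<Rightarrow> real"
  assumes m: "1 \<le> m"
    and ps: "\<And>j. j \<in> {1..m} \<Longrightarrow> 1 < ps j"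
    and p: "1 / real m < p" "1 / p = (\<Sum>j=1..m. 1 / ps j)"
    and \<nu>: "weight \<nu>"
    and w: "\<And>j. j \<in> {1..m} \<Longrightarrow> weight (w j)"
    and A: "condition_A (\<lambda>x. \<nu> x powr p)"
    and \<Psi>: "\<And>j. j \<in> {1..m} \<Longrightarrow> young_function (\<Psi> j)"
    and B: "\<And>j. j \<in> {1..m} \<Longrightarrow> B_star CARD('n) (ps j) (complementary (\<Psi> j))"
    and K: "0 < K"
    and bump: "\<And>R. R \<in> rectangles \<Longrightarrow>
      epowr (avg R (\<lambda>x. ennreal (\<nu> x powr p))) (1 / p) *
        (\<Prod>j=1..m. luxemburg_norm (\<Psi> j) R (\<lambda>x. inverse (ennreal (w j x)))) \<le> ennreal K"
  shows "bounded_Lp m (multi_strong_maximal m)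
    ps (\<lambda>j. wmeasure (\<lambda>x. w j x powr ps j)) p (wmeasure (\<lambda>x. \<nu> x powr p))"
proof (rule orlicz_maximal_bound_rectangles[where 'n = 'n])
  fix C0 :: real
  assume C0: "C0 > 0" and max: "\<And>S q \<Phi> (g :: real ^ 'n \<Rightarrow> real). finite S \<Longrightarrow> S \<subseteq> rectangles \<Longrightarrow> 0 < q \<Longrightarrow>
      \<Phi> \<in> borel_measurable borel \<Longrightarrow> \<Phi> 0 = 0 \<Longrightarrow> g \<in> borel_measurable lebesgue \<Longrightarrow> (\<And>x. 0 \<le> g x) \<Longrightarrow>
      (\<integral>\<^sup>+x. epowr (SUP R\<in>S. indicator R x * orlicz_norm \<Phi> R g) q \<partial>lborel)
        \<le> ennreal C0 * bump_integral CARD('n) q \<Phi> * (\<integral>\<^sup>+x. ennreal (g x powr q) \<partial>lborel)"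
  define \<omega> where "\<omega> x = \<nu> x powr p" for x
  define J where "J = {1..m}"
  have "0 < 1 / real m" using m by simp
  then have p0: "0 < p" using p(1) by linarith
  have ps0: "0 < ps j" if "j \<in> J" for j using ps that unfolding J_def by fastforce
  have pq: "(\<Sum>j\<in>J. p / ps j) = 1"
  proof -
    have "(\<Sum>j\<in>J. p / ps j) = p * (\<Sum>j=1..m. 1 / ps j)" by (simp add: J_def sum_distrib_left)
    also have "\<dots> = p * (1 / p)" by (simp only: p(2))
    finally show ?thesis using p0 by simp
  qed
  obtain \<theta> c :: real where \<theta>: "0 < \<theta>" "\<theta> < 1" and \<omega>: "weight \<omega>"
    and cA: "\<And>E. E \<in> sets lebesgue \<Longrightarrow>
       emeasure (wmeasure \<omega>) {x. strong_maximal (indicator E) x > ennreal \<theta>} \<le> ennreal c * emeasure (wmeasure \<omega>) E"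
    using A unfolding condition_A_def \<omega>_def by blast
  have wm: "w j \<in> borel_measurable lebesgue" and w0: "0 \<le> w j x" if "j \<in> J" for j x
    using w that unfolding J_def weight_def by auto
  define I where "I j = bump_integral CARD('n) (ps j) (complementary (\<Psi> j))" for j
  have I: "I j < top" if "j \<in> J" for j
    unfolding I_def using \<Psi> B ps0 that unfolding J_def by (intro bump_integral_finite) auto
  define L where "L j R = luxemburg_norm (\<Psi> j) R (\<lambda>x. inverse (ennreal (w j x)))" for j R
  define D where "D = epowr (2 ^ card J * ennreal K) p"
  \<comment> \<open>a bound for the \<open>p\<close>-th power of the operator norm\<close>
  define T where "T = ennreal c * (D * (ennreal (1 / (1 - \<theta>)) * (\<Prod>j\<in>J. epowr (ennreal C0 * I j) (p / ps j))))"
  have T: "T < top"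
  proof -
    have "D < top" unfolding D_def by (intro epowr_less_top) (simp add: ennreal_mult_less_top power_less_top_ennreal)
    moreover have "(\<Prod>j\<in>J. epowr (ennreal C0 * I j) (p / ps j)) < top"
    proof -
      have "epowr (ennreal C0 * I j) (p / ps j) < top" if "j \<in> J" for j
        using I[OF that] by (intro epowr_less_top) (simp add: ennreal_mult_less_top)
      then show ?thesis
        by (induction J rule: infinite_finite_induct) (simp_all add: ennreal_mult_less_top)
    qed
    ultimately show ?thesis unfolding T_def by (simp add: ennreal_mult_less_top)
  qed
  have main: "multi_strong_maximal m f \<in> borel_measurable (wmeasure \<omega>) \<and>
      eLp_norm p (wmeasure \<omega>) (multi_strong_maximal m f)
      \<le> epowr T (1 / p) * (\<Prod>j\<in>J. eLp_norm (ps j) (wmeasure (\<lambda>x. w j x powr ps j)) (\<lambda>x. ennreal \<bar>f j x\<bar>))"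
    if f: "\<And>j. j \<in> J \<Longrightarrow> f j \<in> Lp_space (ps j) (wmeasure (\<lambda>x. w j x powr ps j))" for f
  proof -
    have fm: "f j \<in> borel_measurable lebesgue" if "j \<in> J" for j
    proof -
      have "f j \<in> borel_measurable (wmeasure (\<lambda>x. w j x powr ps j))" using f[OF that] unfolding Lp_space_def by blast
      then show ?thesis using measurable_cong_sets[OF sets_wmeasure refl] by blast
    qed
    define Y where "Y j = (\<integral>\<^sup>+x. ennreal ((\<bar>f j x\<bar> * w j x) powr ps j) \<partial>lborel)" for j
    define N where "N j R = orlicz_norm (complementary (\<Psi> j)) R (\<lambda>x. \<bar>f j x\<bar> * w j x)" for j R
    define v where "v R = (\<Prod>j\<in>J. avg R (\<lambda>y. ennreal \<bar>f j y\<bar>))" for R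
    have Mf: "multi_strong_maximal m f = (\<lambda>x. SUP R\<in>{R\<in>rectangles. x \<in> R}. v R)"
      unfolding multi_strong_maximal_def v_def J_def by (rule ext) (rule refl)
    have test: "epowr (v R) p * emeasure (wmeasure \<omega>) R \<le> D * ((\<Prod>j\<in>J. epowr (N j R) p) * emeasure lborel R)"
      if R: "R \<in> rectangles" for R
    proof -
      have "epowr (v R) p * avg R (\<lambda>x. ennreal (\<omega> x)) \<le> D * (\<Prod>j\<in>J. epowr (N j R) p)"
        unfolding D_def v_def
      proof (rule bump_testing[where L = "\<lambda>j. L j R"])
        show "L j R \<noteq> 0" if "j \<in> J" for j
          unfolding L_def by (rule luxemburg_norm_inverse_nonzero[OF \<Psi>[OF that[unfolded J_def]] R wm[OF that]])
        show "epowr (avg R (\<lambda>x. ennreal (\<omega> x))) (1 / p) * (\<Prod>j\<in>J. L j R) \<le> ennreal K"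
          unfolding L_def J_def \<omega>_def by (rule bump[OF R])
        show "avg R (\<lambda>y. ennreal \<bar>f j y\<bar>) \<le> 2 * L j R * N j R" if "j \<in> J" "L j R < top" for j
          unfolding L_def N_def
          by (rule avg_le_Holder[OF \<Psi>[OF that(1)[unfolded J_def]] R fm[OF that(1)] wm[OF that(1)] w0[OF that(1)] that(2)[unfolded L_def]])
      qed (simp_all add: J_def p0 K)
      then have "epowr (v R) p * avg R (\<lambda>x. ennreal (\<omega> x)) * emeasure lborel R \<le> D * (\<Prod>j\<in>J. epowr (N j R) p) * emeasure lborel R"
        by (rule mult_right_mono) simp
      moreover have "\<omega> \<in> borel_measurable lebesgue" using \<omega> unfolding weight_def by blast
      ultimately show ?thesis by (simp only: emeasure_wmeasure_rectangle[OF R] mult.assoc)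
    qed
    have maxN: "(\<integral>\<^sup>+x. epowr (SUP R\<in>S. indicator R x * N j R) (ps j) \<partial>lborel) \<le> ennreal C0 * I j * Y j"
      if "finite S" "S \<subseteq> rectangles" "j \<in> J" for S j
      unfolding N_def I_def Y_def
    proof (rule max[OF that(1,2) ps0[OF that(3)] borel_measurable_complementary])
      show "complementary (\<Psi> j) 0 = 0" using \<Psi> that(3) unfolding J_def by (intro complementary_0) auto
      note [measurable] = fm[OF that(3)] wm[OF that(3)]
      show "(\<lambda>x. \<bar>f j x\<bar> * w j x) \<in> borel_measurable lebesgue" by measurable
      show "0 \<le> \<bar>f j x\<bar> * w j x" for x using w0[OF that(3)] by simp
    qed
    have fin: "(\<integral>\<^sup>+x. epowr (SUP R\<in>S. indicator R x * v R) p \<partial>wmeasure \<omega>)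
      \<le> ennreal c * (D * (ennreal (1 / (1 - \<theta>)) * (\<Prod>j\<in>J. epowr (ennreal C0 * I j * Y j) (p / ps j))))"
      if S: "finite S" "S \<subseteq> rectangles" for S
      by (rule sparse_domination_finite[OF \<omega> \<theta> cA _ p0 ps0 pq test maxN S]) (auto simp: J_def)
    also have "ennreal c * (D * (ennreal (1 / (1 - \<theta>)) * (\<Prod>j\<in>J. epowr (ennreal C0 * I j * Y j) (p / ps j))))
      = T * (\<Prod>j\<in>J. epowr (Y j) (p / ps j))"
      unfolding T_def by (simp only: epowr_mult prod.distrib mult.assoc)
    finally have fin: "(\<integral>\<^sup>+x. epowr (SUP R\<in>S. indicator R x * v R) p \<partial>wmeasure \<omega>) \<le> T * (\<Prod>j\<in>J. epowr (Y j) (p / ps j))"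
      if "finite S" "S \<subseteq> rectangles" for S using that by blast
    have "eLp_norm p (wmeasure \<omega>) (multi_strong_maximal m f) \<le> epowr (T * (\<Prod>j\<in>J. epowr (Y j) (p / ps j))) (1 / p)"
      unfolding eLp_norm_def Mf
      using p0 by (intro epowr_mono nn_integral_SUP_finite_families(2) fin) auto
    also have "\<dots> = epowr T (1 / p) * (\<Prod>j\<in>J. epowr (Y j) (1 / ps j))"
      using p0 by (simp add: epowr_mult epowr_prod epowr_epowr)
    also have "(\<Prod>j\<in>J. epowr (Y j) (1 / ps j)) = (\<Prod>j\<in>J. eLp_norm (ps j) (wmeasure (\<lambda>x. w j x powr ps j)) (\<lambda>x. ennreal \<bar>f j x\<bar>))"
      unfolding Y_def by (intro prod.cong refl eLp_norm_weighted[symmetric] fm wm w0)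
    finally have "eLp_norm p (wmeasure \<omega>) (multi_strong_maximal m f)
      \<le> epowr T (1 / p) * (\<Prod>j\<in>J. eLp_norm (ps j) (wmeasure (\<lambda>x. w j x powr ps j)) (\<lambda>x. ennreal \<bar>f j x\<bar>))" .
    moreover have "multi_strong_maximal m f \<in> borel_measurable (wmeasure \<omega>)"
      unfolding Mf by (rule nn_integral_SUP_finite_families(1)[OF p0 fin])
    ultimately show ?thesis by blast
  qed
  define C where "C = enn2real (epowr T (1 / p))"
  have C: "epowr T (1 / p) = ennreal C" unfolding C_def using epowr_less_top[OF T] by simp
  have "0 \<le> C" unfolding C_def by (rule enn2real_nonneg)
  moreover have "multi_strong_maximal m f \<in> borel_measurable (wmeasure (\<lambda>x. \<nu> x powr p)) \<and>
      eLp_norm p (wmeasure (\<lambda>x. \<nu> x powr p)) (multi_strong_maximal m f)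
      \<le> ennreal C * (\<Prod>j=1..m. eLp_norm (ps j) (wmeasure (\<lambda>x. w j x powr ps j)) (\<lambda>x. ennreal \<bar>f j x\<bar>))"
    if "\<forall>j\<in>{1..m}. f j \<in> Lp_space (ps j) (wmeasure (\<lambda>x. w j x powr ps j))" for f
    using main[of f] that unfolding C \<omega>_def J_def by blast
  ultimately show ?thesis unfolding bounded_Lp_def by blast
qed

end
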